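(* Let $n=p^{\beta}q^{\gamma}$ where $p,q$ are distinct primes and $\beta,\gamma\ge 1$ are integers, and suppose $\gcd(n,6)=1$. Let $G=\langle g\rangle$ be a cyclic group of order $n$. If $S=(x_1g)(x_2g)(x_3g)(x_4g)$ is any minimal zero-sum sequence over $G$ of length $4$, then $\mathrm{ind}(S)=1$.
   Context: $G$ is written additively. A sequence over $G$ is an unordered finite sequence of elements of $G$ with repetition allowed, written multiplicatively. $S$ is a zero-sum sequence if the sum of its terms is $0$, and a minimal zero-sum sequence if it is a zero-sum sequence and no proper nontrivial subsequence has sum $0$. For a sequence $S$ over $G$, writing $S=(n_1h)\cdot\ldots\cdot(n_kh)$ with $1\le n_1,\dots,n_k\le |G|$ for a generator $h$ of $G$, set $\|S\|_h=(n_1+\cdots+n_k)/\mathrm{ord}(h)$; the index is $\mathrm{ind}(S)=\min\{\|S\|_h : h\in G,\ \langle h\rangle=G\}$. *)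

theory Defs
  imports "HOL-Algebra.Algebra" "HOL-Library.Multiset"
begin

text \<open>
  Groups are those of HOL-Algebra, hence written multiplicatively: the additive \<open>k h\<close>, \<open>0\<close> and
  the sum of the terms of a sequence become \<open>h [^] k\<close>, \<open>\<one>\<close> and the product of the terms.
  A sequence over \<open>G\<close> is a finite multiset of elements of \<open>carrier G\<close>.
\<close>

definition seq_sum :: "('a, 'b) monoid_scheme \<Rightarrow> 'a multiset \<Rightarrow> 'a" where
  "seq_sum G S = finprod G (\<lambda>x. x [^]\<^bsub>G\<^esub> count S x) (set_mset S)"

definition zero_sum :: "('a, 'b) monoid_scheme \<Rightarrow> 'a multiset \<Rightarrow> bool" where
  "zero_sum G S \<longleftrightarrow> set_mset S \<subseteq> carrier G \<and> seq_sum G S = \<one>\<^bsub>G\<^esub>"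

definition minimal_zero_sum :: "('a, 'b) monoid_scheme \<Rightarrow> 'a multiset \<Rightarrow> bool" where
  "minimal_zero_sum G S \<longleftrightarrow>
     zero_sum G S \<and> (\<forall>T. T \<subset># S \<and> T \<noteq> {#} \<longrightarrow> \<not> zero_sum G T)"

definition group_generators :: "('a, 'b) monoid_scheme \<Rightarrow> 'a set" where
  "group_generators G = {h \<in> carrier G. generate G {h} = carrier G}"

text \<open>
  For a generator \<open>h\<close> of a finite group the number described here exists and is unique.
  Its range is \<open>1..|G|\<close>, so the neutral element has coefficient \<open>|G|\<close>, not \<open>0\<close>.
\<close>

definition seq_coeff :: "('a, 'b) monoid_scheme \<Rightarrow> 'a \<Rightarrow> 'a \<Rightarrow> nat" where
  "seq_coeff G h x = (THE k. 1 \<le> k \<and> k \<le> order G \<and> x = h [^]\<^bsub>G\<^esub> k)"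

definition seq_norm :: "('a, 'b) monoid_scheme \<Rightarrow> 'a \<Rightarrow> 'a multiset \<Rightarrow> real" where
  "seq_norm G h S = real (\<Sum>x\<in>#S. seq_coeff G h x) / real (group.ord G h)"

definition seq_index :: "('a, 'b) monoid_scheme \<Rightarrow> 'a multiset \<Rightarrow> real" where
  "seq_index G S = Min ((\<lambda>h. seq_norm G h S) ` group_generators G)"

end

theory Submission
  imports "HOL-Analysis.Analysis" "HOL-Number_Theory.Residues" Defs
begin

text \<open>
  Multiplying a generator by \<open>-1\<close> replaces a norm \<open>m\<close> by \<open>4 - m\<close>, so if the index is not 1, then all norms
  are 2: with exponents \<open>u\<^sub>1, \<dots>, u\<^sub>4\<close> and the sawtooth function \<open>B\<close> of period \<open>n\<close>, the sum of the
  \<open>B (g u\<^sub>i)\<close> vanishes for every unit \<open>g\<close>. By the Fourier series of \<open>B\<close> this says that the function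
  \<open>f k = \<Sum> 2 \<i> sin (2 \<pi> k u\<^sub>i / n)\<close> satisfies \<open>\<Sum>\<^sub>k f (g k) / k = 0\<close>. Write \<open>f = (1 - P / p) (1 - Q / q) h\<close> with
  \<open>(P f) k = f (p k)\<close>, \<open>(Q f) k = f (q k)\<close>. Then \<open>\<Sum> h (g k) / k = 0\<close>, summed over the \<open>k\<close> prime to \<open>n\<close>, and
  since \<open>L(1, \<chi>) \<noteq> 0\<close> for all odd characters, \<open>h\<close> vanishes on the units. The inverse Fourier transform
  of \<open>h\<close> is a measure of small support, with mass \<open>\<plusminus> p\<^sup>-\<^sup>i q\<^sup>-\<^sup>j\<close> at the points \<open>\<plusminus> p\<^sup>i q\<^sup>j u\<^sub>k\<close>, and vanishing
  of \<open>h\<close> on the units makes it the sum of an \<open>n / p\<close>-periodic and an \<open>n / q\<close>-periodic function.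
  Counting points in the cosets of the subgroup of order \<open>p q\<close> leaves only the possibility that two
  of the \<open>u\<^sub>i\<close> add up to 0, which minimality excludes.
\<close>

section \<open>Dirichlet's test and the sawtooth series\<close>

text \<open>The function \<open>f\<close> does not live on the units: indices sharing a factor with
  \<open>n\<close> contribute, and the \<open>u\<^sub>i\<close> may share factors with
  \<open>n\<close> too. The factors (1 - P/p)(1 - Q/q) are inclusion-exclusion over the multiples of
  p and q; applied to h they leave precisely the sum over k prime to n, where plain characters
  modulo n act, with neither primitivity nor Gauss sums. The price is that the transform of h at x
  collects every p^i q^j \<open>u\<^sub>k\<close> congruent to x or -x. If x is nonzero modulo both
  prime powers dividing n, valuations leave one pair (i, j) for each index; elsewhere infinitely
  many may contribute. Hence the counting keeps avoiding points that are 0 modulo a prime power, and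
  the case in which no \<open>u\<^sub>i\<close> is admissible is treated apart. That n is prime to 6
  enters in three ways: 2 can be cancelled; at a point \<open>u\<^sub>i\<close> a mass other than 1
  or -1 has size at most 1/5, so three of them cannot outweigh a mass 1; and the larger prime is at
  least 7, which exceeds the five obstructions met in a coset, four points and one inadmissible
  column.\<close>

lemma sum_by_parts:
  fixes a b :: "nat \<Rightarrow> complex"
  shows "(\<Sum>k<N. a k * b k) = (\<Sum>k<N. a k) * b N + (\<Sum>k<N. (\<Sum>j<Suc k. a j) * (b k - b (Suc k)))"
  by (induction N) (simp_all add: algebra_simps)

text \<open>A full period contributes 0, so the sum can be shortened to less than one period, where
  the triangle inequality gives a bound independent of \<open>N\<close>.\<close>

lemma periodic_partial_sums_bounded:
  fixes F :: "nat \<Rightarrow> 'a :: real_normed_vector"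
  assumes per: "\<And>k. F (k + n) = F k" and n: "n > 0" and 0: "(\<Sum>k<n. F k) = 0"
  shows "norm (\<Sum>k<N. F k) \<le> (\<Sum>k<n. norm (F k))"
proof (induction N rule: less_induct)
  case (less N)
  show ?case
  proof (cases "N < n")
    case True
    have "norm (\<Sum>k<N. F k) \<le> (\<Sum>k<N. norm (F k))" by (rule norm_sum)
    also have "\<dots> \<le> (\<Sum>k<n. norm (F k))"
      using True by (intro sum_mono2) auto
    finally show ?thesis .
  next
    case False
    then obtain M where M: "N = n + M" using le_Suc_ex by force
    have "(\<Sum>k<n + M. F k) = (\<Sum>k<n. F k) + (\<Sum>k<M. F (k + n))"
      by (induction M) (simp_all add: add_ac)
    then show ?thesis using less[of M] n 0 M by (simp add: per)
  qed
qed

text \<open>Summation by parts: the boundary term tends to 0 and the remaining series is dominated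
  by \<open>A * v k\<close>. A majorant \<open>v\<close> of the variation replaces monotonicity
  because the weights 1/k - k^-(1+d) needed near s = 1 are not monotone.\<close>

lemma dirichlet_test:
  fixes a :: "nat \<Rightarrow> complex" and b v :: "nat \<Rightarrow> real"
  assumes A: "\<And>N. norm (\<Sum>k<N. a k) \<le> A"
    and b: "b \<longlonglongrightarrow> 0" and bv: "\<And>k. \<bar>b k - b (Suc k)\<bar> \<le> v k" and v: "v sums V"
  shows "summable (\<lambda>k. a k * b k)" "norm (suminf (\<lambda>k. a k * b k)) \<le> A * V"
proof -
  have A0: "A \<ge> 0" using A[of 0] by simp
  define c where "c k = (\<Sum>j<Suc k. a j) * (complex_of_real (b k) - b (Suc k))" for k
  have cb: "norm (c k) \<le> A * v k" for k
  proof -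
    have "norm (c k) = norm (\<Sum>j<Suc k. a j) * \<bar>b k - b (Suc k)\<bar>"
      unfolding c_def norm_mult by (metis norm_of_real of_real_diff)
    also have "\<dots> \<le> A * v k"
      by (rule mult_mono[OF A bv A0]) simp
    finally show ?thesis .
  qed
  have sv: "summable (\<lambda>k. A * v k)" using v sums_summable summable_mult by blast
  have sc: "summable (\<lambda>k. norm (c k))"
    by (rule summable_comparison_test'[OF sv, of 0]) (use cb in auto)
  have "(\<lambda>N. (\<Sum>k<N. a k) * complex_of_real (b N)) \<longlonglongrightarrow> 0"
  proof (rule Lim_null_comparison)
    show "\<forall>\<^sub>F N in sequentially. norm ((\<Sum>k<N. a k) * complex_of_real (b N)) \<le> A * \<bar>b N\<bar>"
      by (auto simp: norm_mult intro!: always_eventually mult_right_mono A)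
    show "(\<lambda>N. A * \<bar>b N\<bar>) \<longlonglongrightarrow> 0"
      using tendsto_mult_right_zero[OF tendsto_rabs_zero[OF b]] by blast
  qed
  moreover have "(\<lambda>N. \<Sum>k<N. c k) \<longlonglongrightarrow> suminf c"
    using summable_norm_cancel[OF sc] summable_LIMSEQ by blast
  ultimately have "(\<lambda>N. (\<Sum>k<N. a k) * complex_of_real (b N) + (\<Sum>k<N. c k)) \<longlonglongrightarrow> 0 + suminf c"
    by (rule tendsto_add)
  then have S: "(\<lambda>k. a k * b k) sums suminf c"
    unfolding sums_def c_def
    by (subst sum_by_parts) simp
  then show "summable (\<lambda>k. a k * b k)" by (simp add: sums_iff)
  have "norm (suminf c) \<le> (suminf (\<lambda>k. norm (c k)))" by (rule summable_norm[OF sc])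
  also have "\<dots> \<le> (suminf (\<lambda>k. A * v k))" by (rule suminf_le[OF cb sc sv])
  also have "\<dots> = A * V" using v by (metis sums_mult sums_unique)
  finally show "norm (suminf (\<lambda>k. a k * b k)) \<le> A * V" using S by (simp add: sums_iff)
qed

text \<open>Monotonicity is asked only from index 1 on: the weights in use, such as 1/k, are 0 at
  \<open>k = 0\<close> by the conventions of HOL, and \<open>a 0 = 0\<close> hides that index. The
  variation telescopes to \<open>b 1\<close>.\<close>

lemma dirichlet_test_antimono:
  fixes a :: "nat \<Rightarrow> complex" and b :: "nat \<Rightarrow> real"
  assumes A: "\<And>N. norm (\<Sum>k<N. a k) \<le> A" and a0: "a 0 = 0"
    and b: "b \<longlonglongrightarrow> 0" and mono: "\<And>k. b (Suc (Suc k)) \<le> b (Suc k)"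
  shows "summable (\<lambda>k. a k * b k)" "norm (suminf (\<lambda>k. a k * b k)) \<le> A * b 1"
proof -
  define a' where "a' k = a (Suc k)" for k
  define b' where "b' k = b (Suc k)" for k
  have A': "norm (\<Sum>k<N. a' k) \<le> A" for N
    using A[of "Suc N"] unfolding a'_def by (subst (asm) sum.lessThan_Suc_shift) (simp add: a0)
  have b'0: "b' \<longlonglongrightarrow> 0" unfolding b'_def using b by (rule LIMSEQ_Suc)
  have v: "(\<lambda>k. b' k - b' (Suc k)) sums (b' 0 - 0)"
    using telescope_sums'[OF b'0] by simp
  have bv: "\<bar>b' k - b' (Suc k)\<bar> \<le> b' k - b' (Suc k)" for k using mono unfolding b'_def by simp
  note D = dirichlet_test[OF A' b'0 bv v]
  show s: "summable (\<lambda>k. a k * b k)"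
    using D(1) unfolding a'_def b'_def by (subst (asm) summable_Suc_iff)
  have "(suminf (\<lambda>k. a k * b k)) = (suminf (\<lambda>k. a' k * b' k))"
    using suminf_split_head[OF s] by (simp add: a0 a'_def b'_def)
  then show "norm (suminf (\<lambda>k. a k * b k)) \<le> A * b 1" using D(2) by (simp add: b'_def)
qed

text \<open>Abel's method: \<open>(1 - r ^ k) / k\<close> decreases in \<open>k\<close>.\<close>

lemma sawtooth_complex:
  fixes z :: complex
  assumes "norm z = 1" "z \<noteq> 1"
  shows "(\<lambda>k. z ^ k / of_nat k) sums (- Ln (1 - z))"
proof -
  define a where "a k = (if k = 0 then 0 else z ^ k)" for k
  define A where "A = 2 / norm (1 - z) + 1"
  have A: "norm (\<Sum>k<N. a k) \<le> A" for N
  proof (cases N)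
    case 0
    then show ?thesis by (simp add: A_def)
  next
    case (Suc M)
    have "(\<Sum>k<N. z ^ k) = (\<Sum>k<N. a k) + 1"
      unfolding Suc a_def by (subst (1 2) sum.lessThan_Suc_shift) simp
    then have "(\<Sum>k<N. a k) = (1 - z ^ N) / (1 - z) - 1"
      using assms by (simp add: sum_gp_strict)
    also have "norm \<dots> \<le> norm (1 - z ^ N) / norm (1 - z) + 1"
      by (metis norm_divide norm_one norm_triangle_ineq4)
    also have "\<dots> \<le> 2 / norm (1 - z) + 1"
      using norm_triangle_ineq4[of 1 "z ^ N"] assms
      by (intro add_right_mono divide_right_mono) (simp_all add: norm_power)
    finally show ?thesis by (simp add: A_def)
  qed
  have a0: "a 0 = 0" by (simp add: a_def)
  have b0: "(\<lambda>k. 1 / real k) \<longlonglongrightarrow> 0" by (rule lim_1_over_n)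
  have S: "summable (\<lambda>k. a k * of_real (1 / real k))"
    by (rule dirichlet_test_antimono[OF A a0 b0]) (simp add: field_simps)
  let ?s = "suminf (\<lambda>k. a k * of_real (1 / real k))"
  \<comment> \<open>This sum is the series of \<open>a k * (1 - r ^ k) / k\<close>. Its weight at 1
    is \<open>1 - r\<close>, so the test yields a bound that tends to 0 as r tends to 1.\<close>
  have *: "norm (?s + Ln (1 - of_real r * z)) \<le> A * (1 - r)" if r: "0 < r" "r < 1" for r :: real
  proof -
    have "norm (of_real r * z) < 1" using r assms by (simp add: norm_mult)
    then have "norm (- (of_real r * z)) < 1" by simp
    from Ln_series[OF this] have "(\<lambda>k. (-1) ^ Suc k / of_nat k * (- (of_real r * z)) ^ k) sums Ln (1 - of_real r * z)"
      by simp
    moreover have "(-1) ^ Suc k / of_nat k * (- (of_real r * z)) ^ k = - (a k * of_real (r ^ k / real k))" for k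
      by (cases "k = 0") (simp_all add: a_def power_mult_distrib power_minus' minus_one_power_iff)
    ultimately have L: "(\<lambda>k. - (a k * of_real (r ^ k / real k))) sums Ln (1 - of_real r * z)"
      by (simp only:)
    have "(\<lambda>k. a k * of_real (1 / real k) + - (a k * of_real (r ^ k / real k))) sums (?s + Ln (1 - of_real r * z))"
      using S L by (intro sums_add) (auto simp: summable_sums)
    then have T: "(\<lambda>k. a k * of_real ((1 - r ^ k) / real k)) sums (?s + Ln (1 - of_real r * z))"
      by (simp add: algebra_simps diff_divide_distrib)
    have "norm (suminf (\<lambda>k. a k * of_real ((1 - r ^ k) / real k))) \<le> A * ((1 - r ^ 1) / real 1)"
    proof (rule dirichlet_test_antimono[OF A a0])
      show "(\<lambda>k. (1 - r ^ k) / real k) \<longlonglongrightarrow> 0"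
      proof (rule Lim_null_comparison[OF _ b0])
        show "\<forall>\<^sub>F k in sequentially. norm ((1 - r ^ k) / real k) \<le> 1 / real k"
        proof (rule always_eventually, rule allI)
          fix k
          have "0 \<le> r ^ k" "r ^ k \<le> 1" using r by (auto simp: power_le_one)
          then show "norm ((1 - r ^ k) / real k) \<le> 1 / real k" by (simp add: divide_right_mono)
        qed
      qed
    next
      fix k
      \<comment> \<open>\<open>r ^ Suc k\<close> is at most the average of the lower powers. Hence
        the average of 1, ..., r^(m-1), which is (1 - r^m) / (m (1 - r)), decreases with m.\<close>
      have le: "real (Suc k) * r ^ Suc k \<le> (\<Sum>i<Suc k. r ^ i)"
      proof -
        have "(\<Sum>i<Suc k. r ^ Suc k) \<le> (\<Sum>i<Suc k. r ^ i)"
          by (intro sum_mono power_decreasing) (use r in auto)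
        then show ?thesis by simp
      qed
      have e: "1 - r ^ m = (1 - r) * (\<Sum>i<m. r ^ i)" for m
        using r by (simp add: sum_gp_strict)
      have "real (Suc k) * (1 - r ^ Suc (Suc k)) \<le> real (Suc (Suc k)) * (1 - r ^ Suc k)"
      proof -
        have "real (Suc k) * (\<Sum>i<Suc (Suc k). r ^ i) \<le> real (Suc (Suc k)) * (\<Sum>i<Suc k. r ^ i)"
          using le by (simp add: algebra_simps)
        then have "(1 - r) * (real (Suc k) * (\<Sum>i<Suc (Suc k). r ^ i)) \<le> (1 - r) * (real (Suc (Suc k)) * (\<Sum>i<Suc k. r ^ i))"
          using r by (intro mult_left_mono) auto
        then show ?thesis unfolding e by (simp only: mult_ac)
      qed
      then show "(1 - r ^ Suc (Suc k)) / real (Suc (Suc k)) \<le> (1 - r ^ Suc k) / real (Suc k)"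
        by (subst pos_divide_le_eq, simp, subst times_divide_eq_left, subst pos_le_divide_eq, simp) (simp only: mult.commute)
    qed
    then show ?thesis using T by (simp add: sums_iff)
  qed
  have ev: "\<forall>\<^sub>F r in at_left (1::real). 0 < r \<and> r < 1"
    using eventually_at_left_real[of 0 1] by (simp add: eventually_mono)
  have "((\<lambda>r. A * (1 - r)) \<longlongrightarrow> A * (1 - 1)) (at_left (1::real))"
    by (intro tendsto_intros)
  then have lim0: "((\<lambda>r. A * (1 - r)) \<longlongrightarrow> 0) (at_left (1::real))" by simp
  have "((\<lambda>r::real. ?s + Ln (1 - of_real r * z)) \<longlongrightarrow> 0) (at_left 1)"
    by (rule Lim_null_comparison[OF _ lim0], rule eventually_mono[OF ev]) (use * in blast)
  moreover have "((\<lambda>r::real. ?s + Ln (1 - of_real r * z)) \<longlongrightarrow> ?s + Ln (1 - of_real 1 * z)) (at_left 1)"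
  proof (intro tendsto_intros)
    \<comment> \<open>This keeps \<open>1 - z\<close> off the branch cut, where \<open>Ln\<close> is
      not continuous.\<close>
    have "Re z < 1"
    proof (rule ccontr)
      assume "\<not> Re z < 1"
      then have "Re z = 1" using complex_Re_le_cmod[of z] assms(1) by simp
      moreover have "(Re z)\<^sup>2 + (Im z)\<^sup>2 = 1" using cmod_power2[of z] assms(1) by simp
      ultimately show False using assms(2) by (simp add: complex_eq_iff)
    qed
    then show "1 - complex_of_real 1 * z \<notin> \<real>\<^sub>\<le>\<^sub>0"
      by (auto simp: complex_nonpos_Reals_iff)
  qed
  ultimately have "?s + Ln (1 - of_real 1 * z) = 0"
    by (intro tendsto_unique[of "at_left (1::real)"]) simp_all
  then have "?s + Ln (1 - z) = 0" by simp
  then have "?s = - Ln (1 - z)" by (simp add: add_eq_0_iff2)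
  moreover have "(\<lambda>k. a k * of_real (1 / real k)) = (\<lambda>k. z ^ k / of_nat k)"
    by (rule ext) (simp add: a_def)
  ultimately show ?thesis using summable_sums[OF S] by metis
qed

text \<open>Imaginary part of the logarithm series at z = e^(2 pi i t): \<open>1 - z\<close> has the
  polar form 2 sin(pi t) e^(i (pi t - pi/2)), and minus its argument is pi (1/2 - t).\<close>

lemma sawtooth_series:
  fixes t :: real
  assumes "0 < t" "t < 1"
  shows "(\<lambda>k. sin (2 * pi * t * real k) / real k) sums (pi * (1 / 2 - t))"
proof -
  define z where "z = cis (2 * pi * t)"
  have e: "1 - z = rcis (2 * sin (pi * t)) (pi * t - pi / 2)"
  proof (rule complex_eqI)
    have c: "cos (2 * pi * t) = 1 - 2 * (sin (pi * t))\<^sup>2"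
      using cos_double_sin[of "pi * t"] by (simp add: mult_ac)
    have s: "sin (2 * pi * t) = 2 * sin (pi * t) * cos (pi * t)"
      using sin_double[of "pi * t"] by (simp add: mult_ac)
    have "cos (pi * t - pi / 2) = sin (pi * t)" "sin (pi * t - pi / 2) = - cos (pi * t)"
      by (simp_all add: cos_diff sin_diff)
    then show "Re (1 - z) = Re (rcis (2 * sin (pi * t)) (pi * t - pi / 2))"
      "Im (1 - z) = Im (rcis (2 * sin (pi * t)) (pi * t - pi / 2))"
      by (simp_all add: z_def c s power2_eq_square)
  qed
  have sp: "sin (pi * t) > 0" using assms by (intro sin_gt_zero) auto
  have "pi * t < pi * 1" using assms by (intro mult_strict_left_mono) auto
  moreover have "pi * t > 0" using assms by simp
  ultimately have "- pi < pi * t - pi / 2" "pi * t - pi / 2 \<le> pi"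
    using pi_gt_zero by linarith+
  then have "Arg (1 - z) = pi * t - pi / 2"
    unfolding e by (intro Arg_unique[of "2 * sin (pi * t)"])
      (use sp assms in \<open>auto simp: rcis_def cis_conv_exp mult_ac\<close>)
  moreover have z1: "z \<noteq> 1" using e sp by (auto simp: rcis_def)
  ultimately have I: "Im (- Ln (1 - z)) = pi * (1 / 2 - t)"
    by (simp add: Arg_eq_Im_Ln[symmetric] algebra_simps)
  have "Im (z ^ k / of_nat k) = sin (2 * pi * t * real k) / real k" for k
    unfolding z_def Complex.DeMoivre by (simp add: mult_ac)
  then have e': "(\<lambda>k. Im (z ^ k / of_nat k)) = (\<lambda>k. sin (2 * pi * t * real k) / real k)"
    by (rule ext)
  have "(\<lambda>k. Im (z ^ k / of_nat k)) sums Im (- Ln (1 - z))"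
    by (intro sums_Im sawtooth_complex) (use z1 in \<open>auto simp: z_def\<close>)
  then show ?thesis unfolding I e' .
qed

section \<open>Nonvanishing of \<open>L(1, \<chi>)\<close>\<close>

text \<open>A Dirichlet character modulo \<open>n\<close>, extended by 0 to nonunits. With
  \<open>n > 1\<close> also 0 is a nonunit, which makes the terms at index 0 vanish.\<close>

locale dcharacter =
  fixes n :: nat and ch :: "nat \<Rightarrow> complex"
  assumes periodic: "ch (k + n) = ch k"
    and mult: "ch (j * k) = ch j * ch k"
    and norm_coprime: "coprime k n \<Longrightarrow> norm (ch k) = 1"
    and not_coprime: "\<not> coprime k n \<Longrightarrow> ch k = 0"
    and n_gt_1: "n > 1"
begin

lemma zero [simp]: "ch 0 = 0"
  using not_coprime[of 0] n_gt_1 by simp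

lemma one [simp]: "ch (Suc 0) = 1"
  using mult[of 1 1] norm_coprime[of 1] by auto

lemma norm_le_1: "norm (ch k) \<le> 1"
  using norm_coprime not_coprime by (cases "coprime k n") auto

lemma mod: "ch (k mod n) = ch k"
proof -
  have "ch (j + m * n) = ch j" for j m
    by (induction m) (use periodic in \<open>simp_all add: algebra_simps, metis add.assoc add.commute\<close>)
  from this[of "k mod n" "k div n"] show ?thesis by (simp add: mult.commute)
qed

lemma square: "dcharacter n (\<lambda>k. ch k ^ 2)"
  using n_gt_1 by unfold_locales
    (simp_all add: periodic mult power_mult_distrib norm_power norm_coprime not_coprime)

text \<open>Multiplication by \<open>g\<close> permutes the residues, so the sum equals
  \<open>ch g\<close> times itself.\<close>

lemma sum_period_eq_0:
  assumes "coprime g n" "ch g \<noteq> 1"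
  shows "(\<Sum>k<n. ch k) = 0"
proof -
  have inj: "inj_on (\<lambda>k. g * k mod n) {..<n}"
  proof (rule inj_onI)
    fix x y assume xy: "x \<in> {..<n}" "y \<in> {..<n}" "g * x mod n = g * y mod n"
    then have "[x = y] (mod n)"
      using cong_mult_lcancel_nat[of g n x y] assms by (simp add: cong_def)
    then show "x = y" using xy by (simp add: cong_def)
  qed
  have im: "(\<lambda>k. g * k mod n) ` {..<n} = {..<n}"
    using n_gt_1 by (intro card_subset_eq) (auto simp: card_image[OF inj])
  have "(\<Sum>k<n. ch k) = (\<Sum>k<n. ch (g * k mod n))"
    using sum.reindex[OF inj, of ch] by (simp add: im)
  also have "\<dots> = ch g * (\<Sum>k<n. ch k)"
    by (simp add: mod mult sum_distrib_left)
  finally have "(1 - ch g) * (\<Sum>k<n. ch k) = 0" by (simp add: algebra_simps)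
  then show ?thesis using assms by simp
qed

lemma partial_sums_bounded:
  assumes "(\<Sum>k<n. ch k) = 0"
  shows "norm (\<Sum>k<N. ch k) \<le> n"
proof -
  have "norm (\<Sum>k<N. ch k) \<le> (\<Sum>k<n. norm (ch k))"
    by (rule periodic_partial_sums_bounded) (use periodic n_gt_1 assms in auto)
  also have "\<dots> \<le> (\<Sum>k<n. 1)" by (intro sum_mono norm_le_1)
  finally show ?thesis by simp
qed

end

section \<open>Euler products for s > 1\<close>

lemma summable_powr_minus: "s > 1 \<Longrightarrow> summable (\<lambda>k. real k powr - s)"
  by (simp add: summable_real_powr_iff)

text \<open>Makes sieving a subtraction of series; it serves both the Euler product and the
  inclusion-exclusion over the multiples of two primes.\<close>

lemma sums_dvd_reindex:
  fixes u :: "nat \<Rightarrow> 'a :: real_normed_vector"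
  assumes "(\<lambda>k. u (p * k)) sums t" "p > 0"
  shows "(\<lambda>k. if p dvd k then u k else 0) sums t"
proof -
  have "strict_mono (\<lambda>k. p * k)" using assms by (auto simp: strict_mono_def)
  moreover have "k \<notin> range (\<lambda>k. p * k) \<Longrightarrow> (if p dvd k then u k else 0) = 0" for k
    by (auto simp: dvd_def)
  ultimately show ?thesis
    using sums_mono_reindex[of "\<lambda>k. p * k" "\<lambda>k. if p dvd k then u k else 0" t] assms(1) by simp
qed

context dcharacter
begin

lemma summable_term: "s > 1 \<Longrightarrow> summable (\<lambda>k. norm (ch k * of_real (real k powr - s)))"
  by (rule summable_comparison_test'[OF summable_powr_minus, of s 0])
    (auto simp: norm_mult norm_le_1 mult_left_le_one_le)

definition L :: "real \<Rightarrow> complex" where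
  "L s = suminf (\<lambda>k. ch k * of_real (real k powr - s))"

text \<open>Multiplying an index by a new prime \<open>q\<close> leaves divisibility by the primes
  of \<open>P\<close> unchanged, so the surviving terms at multiples of \<open>q\<close> are the
  whole sieved series times \<open>ch q * q powr - s\<close>. Subtracting them yields one more Euler
  factor.\<close>

lemma sieve_sums:
  assumes "s > 1" "finite P" "\<forall>p\<in>P. Factorial_Ring.prime p"
  shows "(\<lambda>k. if \<exists>p\<in>P. p dvd k then 0 else ch k * of_real (real k powr - s)) sums
    (L s * (\<Prod>p\<in>P. 1 - ch p * of_real (real p powr - s)))"
  using assms(2,3)
proof (induction P rule: finite_induct)
  case empty
  then show ?case
    unfolding L_def using summable_sums[OF summable_norm_cancel[OF summable_term[OF assms(1)]]] by simp
next
  case (insert q P)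
  let ?a = "\<lambda>k. ch k * complex_of_real (real k powr - s)"
  let ?u = "\<lambda>k. if \<exists>p\<in>P. p dvd k then 0 else ?a k"
  let ?t = "L s * (\<Prod>p\<in>P. 1 - ?a p)"
  have q: "Factorial_Ring.prime q" using insert by simp
  have u: "?u sums ?t" using insert by simp
  have "?u (q * k) = ?a q * ?u k" for k
  proof -
    have "p dvd q * k \<longleftrightarrow> p dvd k" if "p \<in> P" for p
      using that insert q by (metis insert_iff prime_dvd_mult_iff primes_dvd_imp_eq)
    then show ?thesis by (auto simp: mult powr_mult)
  qed
  then have "(\<lambda>k. ?u (q * k)) sums (?a q * ?t)" using sums_mult[OF u] by simp
  then have "(\<lambda>k. if q dvd k then ?u k else 0) sums (?a q * ?t)"
    by (rule sums_dvd_reindex) (use q in \<open>simp add: prime_gt_0_nat\<close>)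
  from sums_diff[OF u this] have "(\<lambda>k. ?u k - (if q dvd k then ?u k else 0)) sums (?t - ?a q * ?t)" .
  moreover have "?u k - (if q dvd k then ?u k else 0) = (if \<exists>p\<in>insert q P. p dvd k then 0 else ?a k)" for k
    by simp
  moreover have "?t - ?a q * ?t = L s * (\<Prod>p\<in>insert q P. 1 - ?a p)"
    using insert(1,2) by (simp add: algebra_simps)
  ultimately show ?case by (simp only:)
qed

text \<open>After sieving by all primes up to \<open>N\<close> only \<open>k = 1\<close> and indices
  beyond \<open>N\<close> survive, so the distance to 1 is at most a tail of a convergent series. In
  this multiplied-out form neither infinite products nor inverses occur.\<close>

lemma euler_product:
  assumes s: "s > 1"
  shows "(\<lambda>N. L s * (\<Prod>p | Factorial_Ring.prime p \<and> p \<le> N. 1 - ch p * of_real (real p powr - s))) \<longlonglongrightarrow> 1"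
proof -
  define P where "P N = {p. Factorial_Ring.prime p \<and> p \<le> N}" for N :: nat
  let ?a = "\<lambda>k. ch k * complex_of_real (real k powr - s)"
  define b where "b k = real k powr - s" for k
  have sb: "summable b" unfolding b_def using summable_powr_minus[OF s] .
  define t where "t N = L s * (\<Prod>p\<in>P N. 1 - ?a p)" for N
  have "norm (t N - 1) \<le> suminf (\<lambda>k. b (k + Suc N))" for N
  proof -
    let ?u = "\<lambda>k. if \<exists>p\<in>P N. p dvd k then 0 else ?a k"
    have 1: "(\<lambda>k. if k = 1 then 1 else 0) sums (1::complex)" by (rule sums_single)
    have "?u sums t N"
      unfolding t_def by (rule sieve_sums[OF s]) (auto simp: P_def)
    define w where "w k = ?u k - (if k = 1 then 1 else 0)" for k
    have "w sums (t N - 1)" using sums_diff[OF \<open>?u sums t N\<close> 1] unfolding w_def .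
    moreover have u0: "w k = 0" if "k < Suc N" for k
    proof (cases "k \<le> 1")
      case True
      then consider "k = 0" | "k = 1" by linarith
      then show ?thesis by cases (auto simp: P_def w_def)
    next
      case False
      then obtain p where "Factorial_Ring.prime p" "p dvd k" using prime_factor_nat[of k] by auto
      moreover have "p \<le> k" using \<open>p dvd k\<close> False by (intro dvd_imp_le) auto
      ultimately show ?thesis using that False by (auto simp: P_def w_def)
    qed
    ultimately have "(\<lambda>k. w (k + Suc N)) sums (t N - 1)"
      by (subst sums_iff_shift) simp
    then have T: "t N - 1 = suminf (\<lambda>k. w (k + Suc N))"
      by (simp only: sums_iff)
    have le: "norm (w k) \<le> b k" for k
    proof (cases "k = 1")
      case True
      then have "w k = 0" by (auto simp: w_def P_def)
      then show ?thesis by (simp add: b_def)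
    qed (auto simp: w_def b_def norm_mult norm_le_1 mult_left_le_one_le)
    have sb': "summable (\<lambda>k. b (k + Suc N))" using sb by (rule summable_ignore_initial_segment)
    show "norm (t N - 1) \<le> suminf (\<lambda>k. b (k + Suc N))"
      unfolding T by (rule norm_suminf_le[OF _ sb']) (rule le)
  qed
  moreover have "(\<lambda>N. suminf (\<lambda>k. b (k + Suc N))) \<longlonglongrightarrow> 0"
    using LIMSEQ_Suc[OF suminf_exist_split2[OF sb]] by simp
  ultimately have "(\<lambda>N. t N - 1) \<longlonglongrightarrow> 0"
    by (intro Lim_null_comparison[where f = "\<lambda>N. t N - 1"]) auto
  then show ?thesis unfolding t_def P_def by (simp add: LIM_zero_iff)
qed

end

section \<open>Characters with a nonreal value: the 3-4-1 inequality\<close>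

lemma ln_norm_series:
  fixes w :: complex
  assumes "norm w < 1"
  shows "(\<lambda>m. Re (w ^ m) / real m) sums (- ln (norm (1 - w)))"
proof -
  have w1: "1 - w \<noteq> 0" using assms by auto
  have "norm (- w) < 1" using assms by simp
  from sums_minus[OF sums_Re[OF Ln_series[OF this]]]
  have "(\<lambda>m. - Re ((-1) ^ Suc m / of_nat m * (- w) ^ m)) sums (- ln (norm (1 - w)))"
    using w1 by (simp add: Re_Ln)
  moreover have "(\<lambda>m. - Re ((-1) ^ Suc m / of_nat m * (- w) ^ m)) = (\<lambda>m. Re (w ^ m) / real m)"
  proof
    fix m
    have e: "(-1) ^ Suc m / of_nat m * (- w) ^ m = - (w ^ m / of_nat m)"
      by (simp add: power_minus' minus_one_power_iff)
    show "- Re ((-1) ^ Suc m / of_nat m * (- w) ^ m) = Re (w ^ m) / real m"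
      unfolding e by simp
  qed
  ultimately show ?thesis by simp
qed

text \<open>The nonnegative trigonometric polynomial \<open>3 + 4 cos t + cos (2 t) = 2 (1 + cos t)\<^sup>2\<close>.\<close>

lemma three_four_one:
  fixes z :: complex
  assumes z: "norm z = 1" and r: "0 \<le> r" "r < 1"
  shows "(1 - r) ^ 3 * norm (1 - z * of_real r) ^ 4 * norm (1 - z\<^sup>2 * of_real r) \<le> 1"
proof -
  have n: "norm (complex_of_real r) < 1" "norm (z * of_real r) < 1" "norm (z\<^sup>2 * of_real r) < 1"
    using z r by (simp_all add: norm_mult norm_power)
  have p: "1 - r > 0" "norm (1 - z * of_real r) > 0" "norm (1 - z\<^sup>2 * of_real r) > 0"
    using n r by auto
  have r1: "norm (1 - complex_of_real r) = 1 - r"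
    using r by (metis norm_of_real of_real_1 of_real_diff abs_of_pos p(1))
  let ?u = "\<lambda>m. 3 * (Re (of_real r ^ m) / real m) + 4 * (Re ((z * of_real r) ^ m) / real m)
      + Re ((z\<^sup>2 * of_real r) ^ m) / real m"
  let ?l = "3 * (- ln (1 - r)) + 4 * (- ln (norm (1 - z * of_real r))) + - ln (norm (1 - z\<^sup>2 * of_real r))"
  have "?u sums ?l"
    using ln_norm_series[OF n(1)] ln_norm_series[OF n(2)] ln_norm_series[OF n(3)]
    unfolding r1 by (intro sums_add sums_mult)
  moreover have "?u m \<ge> 0" for m
  proof -
    define c s where "c = Re (z ^ m)" and "s = Im (z ^ m)"
    have "c\<^sup>2 + s\<^sup>2 = 1"
      using cmod_power2[of "z ^ m"] z by (simp add: c_def s_def norm_power)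
    moreover have "Re (z\<^sup>2 ^ m) = c\<^sup>2 - s\<^sup>2"
    proof -
      have "z\<^sup>2 ^ m = z ^ m * z ^ m"
        by (metis power2_eq_square power_mult power_mult_distrib)
      then show ?thesis by (simp add: c_def s_def power2_eq_square)
    qed
    ultimately have "3 + 4 * c + Re (z\<^sup>2 ^ m) = 2 * (1 + c)\<^sup>2"
      by (simp add: power2_eq_square algebra_simps)
    moreover have "?u m = r ^ m / real m * (3 + 4 * c + Re (z\<^sup>2 ^ m))"
      unfolding power_mult_distrib of_real_power[symmetric]
      by (simp add: c_def add_divide_distrib algebra_simps)
    ultimately show ?thesis using r by simp
  qed
  ultimately have "0 \<le> ?l" by (intro sums_le[OF _ sums_zero, of ?u ?l])
  moreover have "ln ((1 - r) ^ 3 * norm (1 - z * of_real r) ^ 4 * norm (1 - z\<^sup>2 * of_real r)) = - ?l"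
    using p by (simp add: ln_mult ln_realpow)
  ultimately show ?thesis
    using p by (subst ln_le_zero_iff[symmetric]) auto
qed

text \<open>Comparison with a telescoping series: from k = 2 on, k^-(1+d) is at most ((k-1)^-d -
  k^-d) / d, and these terms sum to 1/d. The term at 1 is absorbed by
  \<open>d \<le> 1\<close>.\<close>

lemma zeta_bound:
  fixes d :: real
  assumes d: "0 < d" "d \<le> 1"
  shows "suminf (\<lambda>k. real k powr - (1 + d)) \<le> 2 / d"
proof -
  let ?f = "\<lambda>k. real k powr - (1 + d)"
  let ?g = "\<lambda>k. real (Suc k) powr - d"
  have g0: "?g \<longlonglongrightarrow> 0"
    by (rule LIMSEQ_Suc[where f = "\<lambda>k. real k powr - d"])
      (use d in \<open>auto intro!: tendsto_neg_powr filterlim_real_sequentially\<close>)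
  have g: "(\<lambda>k. (?g k - ?g (Suc k)) / d) sums (1 / d)"
    using sums_divide[OF telescope_sums'[OF g0]] by simp
  have le: "?f (k + 2) \<le> (?g k - ?g (Suc k)) / d" for k
  proof -
    define x where "x = real (k + 2)"
    have x: "x > 1" by (simp add: x_def)
    have "1 / x \<le> - ln ((x - 1) / x)"
      using ln_le_minus_one[of "(x - 1) / x"] x by (simp add: field_simps)
    also have "\<dots> = ln x - ln (x - 1)" using x by (simp add: ln_div)
    finally have "1 + d / x \<le> 1 + d * (ln x - ln (x - 1))"
      using d mult_left_mono[of "1 / x" "ln x - ln (x - 1)" d] by simp
    also have "\<dots> \<le> exp (d * (ln x - ln (x - 1)))" by (rule exp_ge_add_one_self)
    finally have "x powr - d * (1 + d / x) \<le> x powr - d * exp (d * (ln x - ln (x - 1)))"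
      by (intro mult_left_mono) auto
    also have "\<dots> = (x - 1) powr - d"
      using x by (simp add: powr_def exp_add[symmetric] algebra_simps)
    finally have "d * (x powr - d / x) \<le> (x - 1) powr - d - x powr - d"
      by (simp add: algebra_simps)
    moreover have "x powr - d / x = x powr - (1 + d)"
      using x by (simp add: powr_diff powr_minus_divide divide_simps powr_add)
    moreover have "?g k = (x - 1) powr - d" "?g (Suc k) = x powr - d" "?f (k + 2) = x powr - (1 + d)"
      by (simp_all add: x_def algebra_simps)
    ultimately show ?thesis using d by (simp add: field_simps)
  qed
  have s: "summable ?f" by (rule summable_powr_minus) (use d in simp)
  have "suminf ?f = suminf (\<lambda>k. ?f (k + 2)) + (\<Sum>k<2. ?f k)"
    by (rule suminf_split_initial_segment[OF s])
  also have "(\<Sum>k<2. ?f k) = 1" by (simp add: numeral_2_eq_2)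
  also have "suminf (\<lambda>k. ?f (k + 2)) \<le> suminf (\<lambda>k. (?g k - ?g (Suc k)) / d)"
    by (rule suminf_le[OF le summable_ignore_initial_segment[OF s]]) (use g in \<open>simp add: sums_iff\<close>)
  also have "\<dots> = 1 / d" using g by (simp only: sums_iff)
  also have "1 / d + 1 \<le> 2 / d" using d by (simp add: field_simps)
  finally show ?thesis by simp
qed

text \<open>In \<open>b k = (1 - k powr - d) / k\<close> the numerator is at most d ln k and changes
  by at most d/k in one step, so the variation is at most d (ln k + 1) / k^2. Since ln k + 1 is at
  most 2 sqrt k, this is summable with the factor \<open>d\<close> in front, which is what makes the
  bound for L near a zero at 1 linear in \<open>d\<close>.\<close>

lemma powr_bounded_variation:
  fixes d :: real and k :: nat
  assumes d: "0 < d" "d \<le> 1"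
  defines "b \<equiv> \<lambda>k. 1 / real k - real k powr - (1 + d)"
  shows "\<bar>b k - b (Suc k)\<bar> \<le> 2 * d * real k powr - (3 / 2)"
proof (cases "k = 0")
  case True
  then show ?thesis by (simp add: b_def)
next
  case False
  define x where "x = real k"
  have x: "x \<ge> 1" using False by (simp add: x_def)
  define D where "D t = t powr - d" for t :: real
  have D: "1 - D t \<le> d * ln t" if "t > 0" for t
    using exp_ge_add_one_self[of "- d * ln t"] that by (simp add: D_def powr_def)
  have D1: "D t \<le> 1" if "t \<ge> 1" for t
    using powr_mono[of "- d" 0 t] d that by (simp add: D_def)
  have D0: "D t \<ge> 0" for t by (simp add: D_def)
  have b: "b j = (1 - D (real j)) / real j" if "j > 0" for j
    using that by (simp add: b_def D_def powr_diff powr_minus_divide divide_simps powr_add)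
  have "ln ((x + 1) / x) \<le> 1 / x"
    using ln_le_minus_one[of "(x + 1) / x"] x by (simp add: field_simps)
  then have Dq: "1 - D ((x + 1) / x) \<le> d / x"
    using D[of "(x + 1) / x"] d x mult_left_mono[of "ln ((x + 1) / x)" "1 / x" d] by simp
  have "D (x + 1) = D x * D ((x + 1) / x)"
    using x by (simp add: D_def powr_divide)
  then have e: "D x - D (x + 1) = D x * (1 - D ((x + 1) / x))" by (simp add: algebra_simps)
  have "D x * (1 - D ((x + 1) / x)) \<le> 1 * (d / x)"
    by (rule mult_mono) (use Dq D1[of x] D1[of "(x + 1) / x"] x D0 d in auto)
  then have E1: "D x - D (x + 1) \<le> d / x" using e by simp
  have E2: "(D x - D (x + 1)) / (x + 1) \<le> d / (x * (x + 1))"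
    using divide_right_mono[OF E1, of "x + 1"] x by simp
  have E0: "D x - D (x + 1) \<ge> 0" unfolding e
    using D0 D1[of "(x + 1) / x"] x by simp
  have "ln (sqrt x) \<le> sqrt x - 1" by (rule ln_le_minus_one) (use x in simp)
  then have lnx: "ln x + 1 \<le> 2 * sqrt x" using x by (simp add: ln_sqrt)
  have "b k - b (Suc k) = (1 - D x) / (x * (x + 1)) - (D x - D (x + 1)) / (x + 1)"
  proof -
    have "(1 - s) / x - (1 - t) / (x + 1) = (1 - s) / (x * (x + 1)) - (s - t) / (x + 1)" for s t
      using x by (simp add: divide_simps) (simp add: algebra_simps)
    then show ?thesis using False by (simp add: b x_def add.commute)
  qed
  also have "\<bar>\<dots>\<bar> \<le> \<bar>(1 - D x) / (x * (x + 1))\<bar> + \<bar>(D x - D (x + 1)) / (x + 1)\<bar>"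
    by (rule abs_triangle_ineq4)
  also have "\<dots> \<le> d * ln x / (x * (x + 1)) + (d / x) / (x + 1)"
    using x E0 E2 D[of x] D1[of x] by (intro add_mono) (auto simp: abs_div divide_right_mono)
  also have "\<dots> = d * (ln x + 1) / (x * (x + 1))"
    using x by (simp add: distrib_left add_divide_distrib)
  also have "\<dots> \<le> d * (2 * sqrt x) / (x * x)"
    using x d lnx by (intro frac_le mult_left_mono mult_nonneg_nonneg) auto
  also have "\<dots> = 2 * d * x powr - (3 / 2)"
  proof -
    have "x powr - (3 / 2) = x powr (1 / 2 - 2)" by simp
    also have "\<dots> = sqrt x / (x * x)"
      using x unfolding powr_diff by (simp add: powr_half_sqrt power2_eq_square)
    finally show ?thesis by simp
  qed
  finally show ?thesis by (simp add: x_def)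
qed

context dcharacter
begin

lemma principal: "dcharacter n (\<lambda>k. if coprime k n then 1 else 0)"
proof -
  have "coprime (k + n) n \<longleftrightarrow> coprime k n" for k
    by (simp add: coprime_iff_gcd_eq_1)
  then show ?thesis using n_gt_1 by unfold_locales auto
qed

text \<open>The series at 1 being 0, minus \<open>L (1 + d)\<close> is the series with weights 1/k -
  k^-(1+d), of variation O(d). Thus a zero at 1 is of order at least one.\<close>

lemma L_near_1:
  assumes 0: "(\<Sum>k<n. ch k) = 0" and L1: "(\<lambda>k. ch k / of_nat k) sums 0" and d: "0 < d" "d \<le> 1"
  shows "norm (L (1 + d)) \<le> 2 * n * suminf (\<lambda>k. real k powr - (3 / 2)) * d"
proof -
  let ?b = "\<lambda>k. 1 / real k - real k powr - (1 + d)"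
  have "(\<lambda>k. ch k * of_real (real k powr - (1 + d))) sums L (1 + d)"
    unfolding L_def by (rule summable_sums, rule summable_norm_cancel, rule summable_term) (use d in simp)
  from sums_diff[OF L1 this]
  have S: "(\<lambda>k. ch k * of_real (?b k)) sums (- L (1 + d))" by (simp add: algebra_simps)
  have "(\<lambda>k. real k powr - (1 + d)) \<longlonglongrightarrow> 0"
    by (rule tendsto_neg_powr[OF _ filterlim_real_sequentially]) (use d in simp)
  then have b0: "?b \<longlonglongrightarrow> 0" using tendsto_diff[OF lim_1_over_n] by force
  have v: "(\<lambda>k. 2 * d * real k powr - (3 / 2)) sums (2 * d * suminf (\<lambda>k. real k powr - (3 / 2)))"
    by (intro sums_mult summable_sums summable_powr_minus) simp
  have "norm (suminf (\<lambda>k. ch k * of_real (?b k))) \<le> n * (2 * d * suminf (\<lambda>k. real k powr - (3 / 2)))"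
    by (rule dirichlet_test(2)[OF partial_sums_bounded[OF 0] b0 powr_bounded_variation[OF d] v])
  then show ?thesis using S by (simp add: sums_iff mult_ac)
qed

lemma L_bounded:
  assumes 0: "(\<Sum>k<n. ch k) = 0" and s: "s > 1"
  shows "norm (L s) \<le> n"
proof -
  have "norm (L s) \<le> n * (real 1 powr - s)" unfolding L_def
  proof (rule dirichlet_test_antimono(2)[OF partial_sums_bounded[OF 0] zero])
    show "(\<lambda>k. real k powr - s) \<longlonglongrightarrow> 0"
      by (rule tendsto_neg_powr[OF _ filterlim_real_sequentially]) (use s in simp)
    show "real (Suc (Suc k)) powr - s \<le> real (Suc k) powr - s" for k
      by (rule powr_mono2') (use s in auto)
  qed
  then show ?thesis by simp
qed

lemma norm_L_le:
  assumes d: "0 < d" "d \<le> 1"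
  shows "norm (L (1 + d)) \<le> 2 / d"
proof -
  have "norm (L (1 + d)) \<le> suminf (\<lambda>k. real k powr - (1 + d))"
    unfolding L_def
    by (rule norm_suminf_le[OF _ summable_powr_minus])
      (use d in \<open>auto simp: norm_mult norm_le_1 mult_left_le_one_le\<close>)
  then show ?thesis using zeta_bound[OF d] by simp
qed

text \<open>Each Euler factor of \<open>L(s, 1)\<^sup>3 L(s, ch)\<^sup>4 L(s, ch\<^sup>2)\<close> is at least 1 in absolute value.\<close>

lemma mertens_inequality:
  assumes s: "s > 1"
  defines "L0 \<equiv> dcharacter.L (\<lambda>k. if coprime k n then 1 else 0)"
    and "L2 \<equiv> dcharacter.L (\<lambda>k. ch k ^ 2)"
  shows "1 \<le> norm (L0 s) ^ 3 * norm (L s) ^ 4 * norm (L2 s)"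
proof -
  let ?r = "\<lambda>p. complex_of_real (real p powr - s)"
  let ?c = "\<lambda>k. if coprime k n then 1 else (0::complex)"
  let ?P = "\<lambda>N. {p::nat. Factorial_Ring.prime p \<and> p \<le> N}"
  let ?M = "norm (L0 s) ^ 3 * norm (L s) ^ 4 * norm (L2 s)"
  define T where "T N = norm (L0 s * (\<Prod>p\<in>?P N. 1 - ?c p * ?r p)) ^ 3
      * norm (L s * (\<Prod>p\<in>?P N. 1 - ch p * ?r p)) ^ 4 * norm (L2 s * (\<Prod>p\<in>?P N. 1 - ch p ^ 2 * ?r p))" for N
  have "T \<longlonglongrightarrow> norm (1::complex) ^ 3 * norm (1::complex) ^ 4 * norm (1::complex)"
    unfolding T_def L0_def L2_def
    by (intro tendsto_mult tendsto_power tendsto_norm euler_product[OF s]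
        dcharacter.euler_product[OF principal s] dcharacter.euler_product[OF square s])
  then have "T \<longlonglongrightarrow> 1" by simp
  moreover have "T N \<le> ?M" for N
  proof -
    let ?F = "\<lambda>p. norm (1 - ?c p * ?r p) ^ 3 * norm (1 - ch p * ?r p) ^ 4 * norm (1 - ch p ^ 2 * ?r p)"
    have F: "?F p \<le> 1" if "p \<in> ?P N" for p
    proof (cases "coprime p n")
      case True
      have p: "real p > 1" using that prime_gt_1_nat by auto
      have r: "0 \<le> real p powr - s" "real p powr - s < 1"
        using p s powr_less_mono[of "- s" 0 "real p"] by auto
      have "norm (1 - ?r p) = 1 - real p powr - s"
        using r by (metis norm_of_real of_real_1 of_real_diff abs_of_nonneg diff_ge_0_iff_ge less_imp_le)
      then show ?thesis using three_four_one[OF norm_coprime[OF True] r] True by simp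
    qed (simp add: not_coprime)
    have "T N = ?M * (\<Prod>p\<in>?P N. ?F p)"
      by (simp add: T_def norm_mult power_mult_distrib prod.distrib prod_norm[symmetric] prod_power_distrib)
    also have "\<dots> \<le> ?M * 1"
      by (intro mult_left_mono prod_le_1) (use F in auto)
    finally show ?thesis by simp
  qed
  ultimately show ?thesis by (intro LIMSEQ_le_const2[of T]) auto
qed

text \<open>As d tends to 0 the principal series is O(1/d), that of \<open>ch\<close> is O(d), and
  that of \<open>ch\<^sup>2\<close> stays bounded since \<open>ch\<^sup>2\<close> is not principal.
  The Mertens product is then O(d^(4-3)), which cannot stay above 1.\<close>

lemma L_1_neq_0_complex:
  assumes g: "coprime g n" "ch g ^ 2 \<noteq> 1"
  shows "\<not> (\<lambda>k. ch k / of_nat k) sums 0"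
proof
  assume L1: "(\<lambda>k. ch k / of_nat k) sums 0"
  interpret L0: dcharacter n "\<lambda>k. if coprime k n then 1 else 0" by (rule principal)
  interpret L2: dcharacter n "\<lambda>k. ch k ^ 2" by (rule square)
  have "ch g \<noteq> 1" using g by auto
  note z = sum_period_eq_0[OF g(1) this] L2.sum_period_eq_0[OF g]
  define C where "C = 2 * n * suminf (\<lambda>k. real k powr - (3 / 2))"
  have "suminf (\<lambda>k. real k powr - (3 / 2)) \<ge> 0"
    by (intro suminf_nonneg summable_powr_minus) auto
  then have C: "C \<ge> 0" by (simp add: C_def)
  \<comment> \<open>(2/d)^3 (C d)^4 n equals K d, and the choice \<open>d = 1 / (K + 1)\<close>
    makes this smaller than 1.\<close>
  define K where "K = 8 * C ^ 4 * n"
  have K: "K \<ge> 0" by (simp add: K_def)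
  define d where "d = 1 / (K + 1)"
  have d: "0 < d" "d \<le> 1" using K by (auto simp: d_def)
  have "1 \<le> norm (L0.L (1 + d)) ^ 3 * norm (L (1 + d)) ^ 4 * norm (L2.L (1 + d))"
    by (rule mertens_inequality) (use d in simp)
  also have "\<dots> \<le> (2 / d) ^ 3 * (C * d) ^ 4 * n"
    using L0.norm_L_le[OF d] L_near_1[OF z(1) L1 d] L2.L_bounded[OF z(2), of "1 + d"] d
    by (intro mult_mono power_mono mult_nonneg_nonneg zero_le_power) (use C in \<open>auto simp: C_def\<close>)
  also have "\<dots> = K * d" using d by (simp add: K_def power_divide power_mult_distrib eval_nat_numeral)
  also have "\<dots> < 1" using K by (simp add: d_def)
  finally show False by simp
qed

end

section \<open>Real characters: the Lambert series\<close>

lemma sum_powers_nonneg: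
  fixes r :: real
  assumes "r \<in> {-1, 0, 1}"
  shows "(\<Sum>i\<le>a. r ^ i) \<ge> 0"
proof -
  have "(\<Sum>i\<le>a. (-1::real) ^ i) = (if even a then 1 else 0)" by (induction a) auto
  moreover have "(\<Sum>i\<le>a. (0::real) ^ i) = 1" by (induction a) auto
  ultimately show ?thesis using assms by auto
qed

lemma divisors_prime_power_times:
  fixes p m :: nat
  assumes p: "Factorial_Ring.prime p" and m: "\<not> p dvd m"
  shows "bij_betw (\<lambda>(i, d). p ^ i * d) ({..a} \<times> {d. d dvd m}) {d. d dvd p ^ a * m}"
proof (rule bij_betw_imageI)
  show "inj_on (\<lambda>(i, d). p ^ i * d) ({..a} \<times> {d. d dvd m})"
  proof (rule inj_onI, clarify)
    fix i d j e assume d: "d dvd m" "e dvd m" "p ^ i * d = p ^ j * e"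
    have nd: "\<not> p dvd d" "\<not> p dvd e" using d m dvd_trans by blast+
    then have "multiplicity p (p ^ i * d) = i" "multiplicity p (p ^ j * e) = j"
      using p by (auto intro!: multiplicity_decomposeI[of _ p] simp: prime_gt_0_nat)
    then show "i = j \<and> d = e" using d p by (simp add: prime_gt_0_nat)
  qed
  show "(\<lambda>(i, d). p ^ i * d) ` ({..a} \<times> {d. d dvd m}) = {d. d dvd p ^ a * m}"
  proof (intro equalityI subsetI)
    fix x assume "x \<in> {d. d dvd p ^ a * m}"
    then obtain b c where "x = b * c" "b dvd p ^ a" "c dvd m"
      using division_decomp by blast
    then show "x \<in> (\<lambda>(i, d). p ^ i * d) ` ({..a} \<times> {d. d dvd m})"
      using divides_primepow_nat[OF p] by fastforce
  qed (auto intro: mult_dvd_mono le_imp_power_dvd)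
qed

lemma sum_multiples:
  fixes x :: "'a :: comm_monoid_add" and f :: "nat \<Rightarrow> 'a"
  assumes "d > 0"
  shows "(\<Sum>m\<in>{1..M}. if d dvd m then f m else 0) = (\<Sum>j\<in>{1..M div d}. f (d * j))"
proof -
  have "(\<Sum>m\<in>{1..M}. if d dvd m then f m else 0) = (\<Sum>m\<in>{m\<in>{1..M}. d dvd m}. f m)"
    by (rule sum.inter_filter[symmetric]) simp
  also have "{m\<in>{1..M}. d dvd m} = (\<lambda>j. d * j) ` {1..M div d}"
  proof (intro equalityI subsetI)
    fix m assume "m \<in> {m\<in>{1..M}. d dvd m}"
    then obtain j where "m = d * j" "1 \<le> m" "m \<le> M" by auto
    then show "m \<in> (\<lambda>j. d * j) ` {1..M div d}"
      using assms by (auto simp: less_eq_div_iff_mult_less_eq mult.commute intro!: imageI)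
  qed (use assms in \<open>auto simp: less_eq_div_iff_mult_less_eq mult.commute\<close>)
  also have "sum f ((\<lambda>j. d * j) ` {1..M div d}) = (\<Sum>j\<in>{1..M div d}. f (d * j))"
    using assms by (subst sum.reindex) (auto simp: inj_on_def)
  finally show ?thesis .
qed

text \<open>Pairing the exponents i and j - 1 - i, the inequality of the means bounds the sum of j
  powers below by j x^((j-1)/2); the square root \<open>y\<close> avoids half-integral exponents.
  For \<open>k\<close> and \<open>Suc k\<close> these exponents add up to k - 1/2, less than
  \<open>k\<close>. The estimate is the monotonicity of the weights in the Lambert argument.\<close>

lemma geometric_sum_lower_bound:
  fixes x :: real
  assumes x: "0 < x" "x < 1"
  shows "real k * real (Suc k) * x ^ k \<le> (\<Sum>i<k. x ^ i) * (\<Sum>i<Suc k. x ^ i)"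
proof -
  define y where "y = sqrt x"
  have y: "0 < y" "y < 1" "x = y\<^sup>2" using x by (auto simp: y_def)
  have A: "real j * y ^ (j - 1) \<le> (\<Sum>i<j. x ^ i)" for j
  proof -
    have "2 * (real j * y ^ (j - 1)) = (\<Sum>i<j. 2 * y ^ (j - 1))" by simp
    also have "\<dots> \<le> (\<Sum>i<j. x ^ i + x ^ (j - Suc i))"
    proof (rule sum_mono)
      fix i assume "i \<in> {..<j}"
      then have "y ^ (j - 1) = y ^ i * y ^ (j - Suc i)" by (simp flip: power_add)
      moreover have "x ^ i = (y ^ i)\<^sup>2" "x ^ (j - Suc i) = (y ^ (j - Suc i))\<^sup>2"
        by (simp_all add: y(3) power_mult[symmetric] mult.commute)
      ultimately show "2 * y ^ (j - 1) \<le> x ^ i + x ^ (j - Suc i)"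
        using sum_squares_bound[of "y ^ i" "y ^ (j - Suc i)"] by simp
    qed
    also have "\<dots> = 2 * (\<Sum>i<j. x ^ i)"
      by (simp add: sum.distrib sum.nat_diff_reindex)
    finally show ?thesis by simp
  qed
  have "real k * real (Suc k) * x ^ k \<le> (real k * y ^ (k - 1)) * (real (Suc k) * y ^ k)"
  proof (cases k)
    case (Suc l)
    have "x ^ k = y ^ (2 * k)" by (simp add: y(3) power_mult)
    also have "\<dots> \<le> y ^ (k - 1 + k)" using y by (intro power_decreasing) auto
    finally show ?thesis using Suc by (simp add: power_add mult_ac mult_left_mono)
  qed simp
  also have "\<dots> \<le> (\<Sum>i<k. x ^ i) * (\<Sum>i<Suc k. x ^ i)"
    using A[of k] A[of "Suc k"] y x by (intro mult_mono sum_nonneg) auto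
  finally show ?thesis .
qed

context dcharacter
begin

text \<open>For real \<open>ch\<close>, the Dirichlet convolution of \<open>ch\<close> with the
  constant 1: the coefficients of the Lambert series of \<open>ch\<close> as a power series.\<close>

definition conv :: "nat \<Rightarrow> real" where
  "conv m = (\<Sum>d | d dvd m. Re (ch d))"

context
  assumes real: "\<And>k. coprime k n \<Longrightarrow> ch k ^ 2 = 1"
begin

lemma Re_ch: "ch k = of_real (Re (ch k))" "Re (ch k) \<in> {-1, 0, 1}"
proof -
  have "ch k = 1 \<or> ch k = -1 \<or> ch k = 0"
    using real[of k] not_coprime[of k] by (auto simp: power2_eq_1_iff)
  then show "ch k = of_real (Re (ch k))" "Re (ch k) \<in> {-1, 0, 1}" by auto
qed

lemma Re_mult: "Re (ch (j * k)) = Re (ch j) * Re (ch k)"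
proof -
  obtain a b where "ch j = of_real a" "ch k = of_real b"
    using Re_ch(1) by blast
  then show ?thesis by (simp add: mult)
qed

lemma Re_power: "Re (ch (k ^ i)) = Re (ch k) ^ i"
  by (induction i) (simp_all add: Re_mult)

text \<open>Splitting off the full power of a prime p multiplies the convolution by 1 + r + ... +
  r^a with r = \<open>Re (ch p)\<close> in {-1, 0, 1}, which is never negative.\<close>

lemma conv_nonneg: "m > 0 \<Longrightarrow> conv m \<ge> 0"
proof (induction m rule: less_induct)
  case (less m)
  show ?case
  proof (cases "m = 1")
    case True
    then show ?thesis by (simp add: conv_def)
  next
    case False
    then obtain p where p: "Factorial_Ring.prime p" "p dvd m" using prime_factor_nat by blast
    obtain m' where m': "m = p ^ multiplicity p m * m'" "\<not> p dvd m'"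
      using multiplicity_decompose'[of m p] less.prems prime_gt_1_nat[OF p(1)] by auto
    define a where "a = multiplicity p m"
    have "a > 0" using p less.prems by (simp add: a_def prime_multiplicity_gt_zero_iff)
    then have "p ^ a > 1" by (intro one_less_power prime_gt_1_nat p)
    moreover have "m' > 0" using m' less.prems by (cases m') auto
    ultimately have "m' < m" using m'(1) by (metis a_def mult_less_cancel2 mult_1)
    have "conv m = (\<Sum>(i, d)\<in>{..a} \<times> {d. d dvd m'}. Re (ch (p ^ i * d)))"
      unfolding conv_def using sum.reindex_bij_betw[OF divisors_prime_power_times[OF p(1) m'(2), of a], of "\<lambda>d. Re (ch d)"]
      using m'(1) by (simp add: a_def case_prod_beta)
    also have "\<dots> = (\<Sum>i\<le>a. Re (ch p) ^ i) * conv m'"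
      by (simp add: conv_def sum_product sum.cartesian_product Re_mult Re_power)
    also have "\<dots> \<ge> 0"
      using less.IH[OF \<open>m' < m\<close> \<open>m' > 0\<close>] Re_ch(2) sum_powers_nonneg by simp
    finally show ?thesis .
  qed
qed

text \<open>Only the divisor 1 is prime to \<open>n\<close>. This supplies infinitely many
  coefficients equal to 1, which make the power series unbounded near 1.\<close>

lemma conv_prime_power:
  assumes "Factorial_Ring.prime p" "p dvd n"
  shows "conv (p ^ j) = 1"
proof -
  have "\<not> coprime p n" using assms not_prime_unit by (auto simp: coprime_def)
  then have "ch p = 0" by (rule not_coprime)
  have "conv (p ^ j) = (\<Sum>(i, d)\<in>{..j} \<times> {d. d dvd 1}. Re (ch (p ^ i * d)))"
    unfolding conv_def
    using sum.reindex_bij_betw[OF divisors_prime_power_times[OF assms(1), of 1 j], of "\<lambda>d. Re (ch d)"]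
      prime_gt_1_nat[OF assms(1)] by (simp add: case_prod_beta)
  also have "\<dots> = (\<Sum>i\<le>j. 0 ^ i)"
    using \<open>ch p = 0\<close> by (simp add: Re_power sum.cartesian_product[symmetric])
  also have "\<dots> = 1" by (induction j) auto
  finally show ?thesis .
qed

text \<open>After an exchange of finite sums each \<open>k\<close> contributes a truncated geometric
  series in x^k. The missing tail begins at the exponent \<open>k * Suc (M div k)\<close>, not below
  \<open>M\<close>, whence an error of at most \<open>x ^ M / (1 - x)\<close> for each
  \<open>k\<close>.\<close>

lemma lambert_partial_sum:
  fixes x :: real
  assumes x: "0 < x" "x < 1"
  shows "\<bar>(\<Sum>m\<in>{1..M}. conv m * x ^ m) - (\<Sum>k\<in>{1..M}. Re (ch k) * (x ^ k / (1 - x ^ k)))\<bar>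
    \<le> real M * x ^ M / (1 - x)"
proof -
  let ?r = "\<lambda>k. Re (ch k)"
  have lt1: "x ^ k < 1" if "k \<ge> 1" for k using x that by (simp add: power_less_one_iff)
  have "(\<Sum>m\<in>{1..M}. conv m * x ^ m) = (\<Sum>m\<in>{1..M}. \<Sum>k\<in>{1..M}. if k dvd m then ?r k * x ^ m else 0)"
  proof (rule sum.cong)
    fix m assume m: "m \<in> {1..M}"
    have "1 \<le> d \<and> d \<le> M" if "d dvd m" for d
      using dvd_imp_le[OF that] dvd_pos_nat[OF _ that] m by auto
    then have e: "{d. d dvd m} = {d\<in>{1..M}. d dvd m}" by auto
    show "conv m * x ^ m = (\<Sum>k\<in>{1..M}. if k dvd m then ?r k * x ^ m else 0)"
      unfolding conv_def sum_distrib_right e by (rule sum.inter_filter) simp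
  qed simp
  also have "\<dots> = (\<Sum>k\<in>{1..M}. \<Sum>m\<in>{1..M}. if k dvd m then ?r k * x ^ m else 0)"
    by (rule sum.swap)
  also have "\<dots> = (\<Sum>k\<in>{1..M}. ?r k * ((x ^ k - x ^ (k * Suc (M div k))) / (1 - x ^ k)))"
  proof (rule sum.cong)
    fix k assume "k \<in> {1..M}"
    then have k: "k > 0" by simp
    have "(\<Sum>m\<in>{1..M}. if k dvd m then ?r k * x ^ m else 0) = (\<Sum>j\<in>{1..M div k}. ?r k * x ^ (k * j))"
      by (rule sum_multiples[OF k])
    also have "\<dots> = ?r k * (\<Sum>j\<in>{1..M div k}. (x ^ k) ^ j)"
      by (simp add: sum_distrib_left power_mult)
    also have "(\<Sum>j\<in>{1..M div k}. (x ^ k) ^ j) = (x ^ k - x ^ (k * Suc (M div k))) / (1 - x ^ k)"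
      using lt1[of k] k by (simp add: sum_gp power_mult power_add)
    finally show "(\<Sum>m\<in>{1..M}. if k dvd m then ?r k * x ^ m else 0)
        = ?r k * ((x ^ k - x ^ (k * Suc (M div k))) / (1 - x ^ k))" .
  qed simp
  finally have "(\<Sum>m\<in>{1..M}. conv m * x ^ m) - (\<Sum>k\<in>{1..M}. ?r k * (x ^ k / (1 - x ^ k)))
      = (\<Sum>k\<in>{1..M}. - (?r k * (x ^ (k * Suc (M div k)) / (1 - x ^ k))))"
    by (simp add: sum_subtractf[symmetric] diff_divide_distrib right_diff_distrib)
  also have "\<bar>\<dots>\<bar> \<le> (\<Sum>k\<in>{1..M}. x ^ M / (1 - x))"
  proof (rule order_trans[OF sum_abs sum_mono])
    fix k assume "k \<in> {1..M}"
    then have k: "k \<ge> 1" by simp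
    have "M \<le> k * Suc (M div k)"
      using mult_div_mod_eq[of k M] mod_less_divisor[of k M] k unfolding mult_Suc_right by linarith
    then have 1: "x ^ (k * Suc (M div k)) \<le> x ^ M" using x by (intro power_decreasing) auto
    have "x ^ k \<le> x ^ 1" using x k by (intro power_decreasing) auto
    then have 2: "x ^ (k * Suc (M div k)) / (1 - x ^ k) \<le> x ^ M / (1 - x)"
      using 1 x by (intro frac_le) auto
    have 3: "\<bar>?r k\<bar> \<le> 1" using Re_ch(2)[of k] by auto
    have 4: "0 \<le> x ^ (k * Suc (M div k)) / (1 - x ^ k)" using x lt1[OF k] by simp
    show "\<bar>- (?r k * (x ^ (k * Suc (M div k)) / (1 - x ^ k)))\<bar> \<le> x ^ M / (1 - x)"
      unfolding abs_minus_cancel abs_mult abs_of_nonneg[OF 4]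
      using mult_mono[OF 3 2 _ 4] by simp
  qed
  finally show ?thesis by simp
qed

text \<open>Monsky's argument: the Lambert series of \<open>ch\<close> would stay bounded as \<open>x\<close> tends to 1.\<close>

lemma lambert_bounded:
  fixes x :: real
  assumes x: "0 < x" "x < 1" and 0: "(\<Sum>k<n. ch k) = 0" and L1: "(\<lambda>k. ch k / of_nat k) sums 0"
  shows "(\<Sum>m\<in>{1..M}. conv m * x ^ m) \<le> n"
proof -
  let ?q = "\<lambda>k. x ^ k / (1 - x ^ k)"
  \<comment> \<open>The weights 1 / (k (1 - x)) have sum 0 against \<open>ch\<close> by
    \<open>L1\<close>; subtracting the Lambert weights from them leaves monotone weights with
    \<open>b 1 = 1\<close>, so the bound does not depend on \<open>x\<close>.\<close>
  define b where "b k = 1 / real k / (1 - x) - ?q k" for k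
  have lt1: "x ^ k < 1" if "k > 0" for k using x that by (simp add: power_less_one_iff)
  have b0: "b \<longlonglongrightarrow> 0"
  proof -
    have "b \<longlonglongrightarrow> 0 / (1 - x) - 0 / (1 - 0)"
      unfolding b_def by (intro tendsto_intros lim_1_over_n LIMSEQ_power_zero) (use x in auto)
    then show ?thesis by simp
  qed
  have bmono: "b (Suc (Suc j)) \<le> b (Suc j)" for j
  proof -
    define k where "k = Suc j"
    define A where "A i = (\<Sum>l<i. x ^ l)" for i
    have e: "1 - x ^ i = (1 - x) * A i" for i using x by (simp add: A_def sum_gp_strict)
    have A: "A i > 0" if "i > 0" for i
    proof -
      have "0 < (1 - x) * A i" unfolding e[symmetric] using lt1[OF that] by simp
      then show ?thesis using x by (simp add: zero_less_mult_iff)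
    qed
    have AA: "real k * real (Suc k) * x ^ k \<le> A k * A (Suc k)"
      unfolding A_def by (rule geometric_sum_lower_bound[OF x])
    have k: "k > 0" by (simp add: k_def)
    have "?q k - ?q (Suc k) = x ^ k * (1 - x) / ((1 - x ^ k) * (1 - x ^ Suc k))"
      using lt1[OF k] lt1[of "Suc k"] by (simp add: divide_simps del: power_Suc) (simp add: algebra_simps)
    also have "\<dots> = x ^ k / (A k * A (Suc k)) / (1 - x)"
      unfolding e using x by (simp add: mult_ac)
    also have "\<dots> \<le> 1 / (real k * real (Suc k)) / (1 - x)"
    proof (rule divide_right_mono)
      show "x ^ k / (A k * A (Suc k)) \<le> 1 / (real k * real (Suc k))"
        using AA A[OF k] A[of "Suc k"] k by (simp add: divide_simps mult_ac del: of_nat_Suc)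
    qed (use x in simp)
    also have "1 / (real k * real (Suc k)) = 1 / real k - 1 / real (Suc k)"
      using k by (simp add: divide_simps)
    finally have "b (Suc k) \<le> b k"
      unfolding b_def by (simp add: diff_divide_distrib)
    then show ?thesis by (simp add: k_def)
  qed
  have s: "summable (\<lambda>k. ch k * of_real (b k))" and le: "norm (suminf (\<lambda>k. ch k * of_real (b k))) \<le> n * b 1"
    by (rule dirichlet_test_antimono[OF partial_sums_bounded[OF 0] zero b0 bmono])+
  have "b 1 = 1" using x by (simp add: b_def diff_divide_distrib[symmetric])
  define t where "t = - Re (suminf (\<lambda>k. ch k * of_real (b k)))"
  have t: "t \<le> n"
    using le \<open>b 1 = 1\<close> abs_Re_le_cmod[of "suminf (\<lambda>k. ch k * of_real (b k))"] by (simp add: t_def)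
  have "(\<lambda>k. Re (ch k / of_nat k / of_real (1 - x) - ch k * of_real (b k))) sums Re (0 / of_real (1 - x) - suminf (\<lambda>k. ch k * of_real (b k)))"
    by (intro sums_Re sums_diff sums_divide L1 summable_sums s)
  moreover have "(\<lambda>k. Re (ch k / of_nat k / of_real (1 - x) - ch k * of_real (b k))) = (\<lambda>k. Re (ch k) * ?q k)"
  proof
    fix k
    have "ch k / of_nat k / of_real (1 - x) - ch k * of_real (b k)
        = of_real (Re (ch k) * (1 / real k / (1 - x) - b k))"
      by (subst (1 2) Re_ch(1)) (simp add: algebra_simps)
    then show "Re (ch k / of_nat k / of_real (1 - x) - ch k * of_real (b k)) = Re (ch k) * ?q k"
      by (simp only: Re_complex_of_real) (simp add: b_def)
  qed
  ultimately have "(\<lambda>k. Re (ch k) * ?q k) sums t" by (simp add: t_def)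
  then have "(\<lambda>M. \<Sum>k<Suc M. Re (ch k) * ?q k) \<longlonglongrightarrow> t"
    unfolding sums_def by (rule LIMSEQ_Suc)
  moreover have "(\<Sum>k<Suc M. Re (ch k) * ?q k) = (\<Sum>k\<in>{1..M}. Re (ch k) * ?q k)" for M
    by (induction M) simp_all
  ultimately have T: "(\<lambda>M. \<Sum>k\<in>{1..M}. Re (ch k) * ?q k) \<longlonglongrightarrow> t" by simp
  let ?S = "\<lambda>M. \<Sum>m\<in>{1..M}. conv m * x ^ m"
  have "(\<lambda>M. real M * x ^ M) \<longlonglongrightarrow> 0"
    using powser_times_n_limit_0[of x] x by simp
  from tendsto_divide[OF this tendsto_const[of "1 - x"]] x
  have e: "(\<lambda>M. real M * x ^ M / (1 - x)) \<longlonglongrightarrow> 0" by simp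
  have "(\<lambda>M. ?S M - (\<Sum>k\<in>{1..M}. Re (ch k) * ?q k)) \<longlonglongrightarrow> 0"
  proof (rule Lim_null_comparison[OF _ e], rule always_eventually, rule allI)
    show "norm (?S M - (\<Sum>k\<in>{1..M}. Re (ch k) * ?q k)) \<le> real M * x ^ M / (1 - x)" for M
      unfolding real_norm_def by (rule lambert_partial_sum[OF x])
  qed
  from tendsto_add[OF this T] have "?S \<longlonglongrightarrow> t" by simp
  moreover have "incseq ?S"
    by (rule incseq_SucI) (use conv_nonneg x in simp)
  ultimately have "?S M \<le> t" by (rule incseq_le[rotated])
  then show ?thesis using t by linarith
qed

lemma L_1_neq_0_real:
  assumes 0: "(\<Sum>k<n. ch k) = 0"
  shows "\<not> (\<lambda>k. ch k / of_nat k) sums 0"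
proof
  assume L1: "(\<lambda>k. ch k / of_nat k) sums 0"
  obtain p where p: "Factorial_Ring.prime p" "p dvd n" using prime_factor_nat[of n] n_gt_1 by auto
  \<comment> \<open>\<open>Suc n\<close> powers of \<open>p\<close>, each with coefficient 1 and a
    term tending to 1, exceed the bound \<open>n\<close> in the limit.\<close>
  define J where "J = Suc n"
  have p1: "p > 1" using p prime_gt_1_nat by simp
  have inj: "inj_on (\<lambda>j. p ^ j) {..<J}" using p1 by (auto simp: inj_on_def)
  have le: "(\<Sum>j<J. x ^ (p ^ j)) \<le> n" if x: "0 < x" "x < 1" for x :: real
  proof -
    have "(\<Sum>j<J. x ^ (p ^ j)) = (\<Sum>m\<in>(\<lambda>j. p ^ j) ` {..<J}. conv m * x ^ m)"
      by (subst sum.reindex[OF inj]) (simp add: conv_prime_power[OF p])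
    also have "\<dots> \<le> (\<Sum>m\<in>{1..p ^ J}. conv m * x ^ m)"
    proof (rule sum_mono2)
      show "(\<lambda>j. p ^ j) ` {..<J} \<subseteq> {1..p ^ J}"
        using p1 by (auto intro: power_increasing simp: Suc_le_eq)
    qed (use conv_nonneg x in auto)
    also have "\<dots> \<le> n" by (rule lambert_bounded[OF x 0 L1])
    finally show ?thesis .
  qed
  have "((\<lambda>x::real. \<Sum>j<J. x ^ (p ^ j)) \<longlongrightarrow> (\<Sum>j<J. 1 ^ (p ^ j))) (at_left 1)"
    by (intro tendsto_intros)
  moreover have "\<forall>\<^sub>F x in at_left (1::real). (\<Sum>j<J. x ^ (p ^ j)) \<le> n"
    using eventually_at_left_real[of 0 1] by (rule eventually_mono) (use le in auto)
  ultimately have "(\<Sum>j<J. (1::real) ^ (p ^ j)) \<le> n"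
    by (intro tendsto_upperbound[of _ _ "at_left (1::real)"]) auto
  then show False by (simp add: J_def)
qed

end

theorem L_1_neq_0:
  assumes "coprime g n" "ch g \<noteq> 1"
  shows "\<not> (\<lambda>k. ch k / of_nat k) sums 0"
proof (cases "\<exists>h. coprime h n \<and> ch h ^ 2 \<noteq> 1")
  case True
  then show ?thesis using L_1_neq_0_complex by blast
next
  case False
  then show ?thesis using L_1_neq_0_real[OF _ sum_period_eq_0[OF assms]] by blast
qed

end

section \<open>Odd functions orthogonal to \<open>1 / k\<close>\<close>

text \<open>The condition on \<open>n dvd j + k\<close> says at once that \<open>F\<close> is odd
  and, for \<open>n > 0\<close>, \<open>n\<close>-periodic, without negative arguments. The last
  clause is orthogonality of 1/k to all unit dilates of \<open>F\<close>, convergence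
  included.\<close>

definition annihilated :: "nat \<Rightarrow> (nat \<Rightarrow> complex) \<Rightarrow> bool" where
  "annihilated n F \<longleftrightarrow> (\<forall>j k. n dvd j + k \<longrightarrow> F j = - F k) \<and> (\<forall>k. \<not> coprime k n \<longrightarrow> F k = 0)
    \<and> (\<forall>g. coprime g n \<longrightarrow> (\<lambda>k. F (g * k) / of_nat k) sums 0)"

text \<open>\<open>j * (n - 1)\<close> represents - j: both \<open>j\<close> and \<open>k\<close>
  are opposite to it.\<close>

lemma odd_imp_periodic:
  fixes F :: "nat \<Rightarrow> 'a :: group_add"
  assumes odd: "\<And>j k. n dvd j + k \<Longrightarrow> F j = - F k" and "n > 0" and "[j = k] (mod n)"
  shows "F j = F k"
proof -
  have e: "i + i * (n - 1) = i * n" for i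
    using \<open>n > 0\<close> by (metis Suc_diff_1 mult_Suc_right)
  have "[k + j * (n - 1) = j + j * (n - 1)] (mod n)"
    using assms(3) by (intro cong_add cong_refl) (simp add: cong_sym)
  then have "n dvd k + j * (n - 1)" unfolding e by (simp add: cong_def mod_eq_0_iff_dvd)
  then have "F k = - F (j * (n - 1))" by (rule odd)
  moreover have "F j = - F (j * (n - 1))" by (rule odd) (unfold e, simp)
  ultimately show ?thesis by simp
qed

lemma annihilated_lincomb:
  assumes F: "annihilated n F" and g: "coprime g n"
  shows "annihilated n (\<lambda>k. \<Sum>j<m. c j * F (g ^ j * k))"
  unfolding annihilated_def
proof (intro conjI allI impI)
  fix i k assume "n dvd i + k"
  then have "n dvd g ^ j * i + g ^ j * k" for j
    using dvd_mult[of n "i + k" "g ^ j"] by (simp add: distrib_left)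
  then have "F (g ^ j * i) = - F (g ^ j * k)" for j using F unfolding annihilated_def by blast
  then show "(\<Sum>j<m. c j * F (g ^ j * i)) = - (\<Sum>j<m. c j * F (g ^ j * k))"
    by (simp add: sum_negf)
next
  fix k assume "\<not> coprime k n"
  then have "F (g ^ j * k) = 0" for j using F unfolding annihilated_def by simp
  then show "(\<Sum>j<m. c j * F (g ^ j * k)) = 0" by simp
next
  fix h assume h: "coprime h n"
  have "(\<lambda>k. c j * (F ((g ^ j * h) * k) / of_nat k)) sums (c j * 0)" for j
    using F g h unfolding annihilated_def by (intro sums_mult) simp
  then have "(\<lambda>k. \<Sum>j<m. c j * (F ((g ^ j * h) * k) / of_nat k)) sums (\<Sum>j<m. c j * 0)"
    by (intro sums_sum)
  then show "(\<lambda>k. (\<Sum>j<m. c j * F (g ^ j * (h * k))) / of_nat k) sums 0"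
    by (simp add: sum_divide_distrib mult.assoc)
qed

lemma sum_roots_of_unity:
  fixes m j :: nat
  assumes "0 < j" "j < m"
  shows "(\<Sum>l<m. cis (2 * pi / m) ^ (l * j)) = 0"
proof -
  define w where "w = cis (2 * pi / m) ^ j"
  have "w ^ m = (cis (2 * pi / m) ^ m) ^ j" by (simp add: w_def flip: power_mult) (simp add: mult.commute)
  also have "cis (2 * pi / m) ^ m = 1" using assms by (simp add: Complex.DeMoivre)
  finally have "w ^ m = 1" by simp
  moreover have "w \<noteq> 1"
  proof
    assume "w = 1"
    then have "cos (real j * (2 * pi / m)) = 1"
      by (simp add: w_def Complex.DeMoivre complex_eq_iff)
    then obtain i :: int where "real j * (2 * pi / m) = i * (2 * pi)"
      using cos_one_2pi_int by auto
    then have "real j = real_of_int i * real m" using assms by (simp add: field_simps)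
    then have "int j = i * int m" by (metis of_int_eq_iff of_int_mult of_int_of_nat_eq)
    then have "int m dvd int j" by simp
    then show False using assms by (simp add: nat_dvd_not_less)
  qed
  ultimately show ?thesis
    by (simp add: sum_gp_strict w_def mult.commute[of _ j] power_mult)
qed

text \<open>Translation by \<open>g\<close> has finite order, so it acts diagonalizably; a common eigenvector of all
  translations is a multiple of a character.\<close>

lemma annihilated_eigenvector_step:
  assumes F: "annihilated n F" and g: "coprime g n" and n: "n > 0" and k0: "F k0 \<noteq> 0"
  obtains c m z where "\<exists>k. (\<Sum>j<m. c j * F (g ^ j * k)) \<noteq> 0"
    "\<And>k. (\<Sum>j<m. c j * F (g ^ j * (g * k))) = z * (\<Sum>j<m. c j * F (g ^ j * k))"
proof -
  define m where "m = totient n"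
  have m: "m > 0" using n by (simp add: m_def)
  define w where "w = cis (2 * pi / m)"
  have w0: "w \<noteq> 0" by (simp add: w_def)
  have wm: "w ^ m = 1" using m by (simp add: w_def Complex.DeMoivre)
  \<comment> \<open>Since g^m is 1 modulo \<open>n\<close>, these are, up to the factor
    \<open>m\<close>, the projections to the eigenspaces of the dilation by \<open>g\<close>, with
    eigenvalue w^(-l). Their sum over \<open>l\<close> is \<open>m\<close> times \<open>F\<close>,
    so one of them is nonzero at \<open>k0\<close>.\<close>
  define E where "E l k = (\<Sum>j<m. w ^ (l * j) * F (g ^ j * k))" for l k
  have "(\<Sum>l<m. E l k0) = (\<Sum>j<m. \<Sum>l<m. w ^ (l * j) * F (g ^ j * k0))"
    unfolding E_def by (rule sum.swap)
  also have "\<dots> = (\<Sum>j<m. if j = 0 then of_nat m * F k0 else 0)"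
    by (rule sum.cong) (use sum_roots_of_unity in \<open>auto simp: w_def simp flip: sum_distrib_right\<close>)
  also have "\<dots> = of_nat m * F k0" using m by simp
  finally have "(\<Sum>l<m. E l k0) \<noteq> 0" using m k0 by simp
  then obtain l where l: "E l k0 \<noteq> 0" by (meson sum.not_neutral_contains_not_neutral)
  have "w ^ l * E l (g * k) = E l k" for k
  proof -
    define t where "t j = w ^ (l * j) * F (g ^ j * k)" for j
    have "[g ^ m * k = 1 * k] (mod n)"
      unfolding m_def by (intro cong_mult cong_refl euler_theorem g)
    then have "F (g ^ m * k) = F (1 * k)"
      by (rule odd_imp_periodic[rotated 2]) (use F n in \<open>auto simp: annihilated_def\<close>)
    moreover have "w ^ (l * m) = 1" using wm by (metis mult.commute power_mult power_one)
    ultimately have "t m = t 0" by (simp add: t_def)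
    have "w ^ l * E l (g * k) = (\<Sum>j<m. t (Suc j))"
      unfolding E_def t_def sum_distrib_left
      by (rule sum.cong) (simp_all add: power_add mult_ac)
    also have "\<dots> = (\<Sum>j<Suc m. t j) - t 0" by (subst sum.lessThan_Suc_shift) simp
    also have "\<dots> = (\<Sum>j<m. t j)" using \<open>t m = t 0\<close> by simp
    finally show ?thesis by (simp add: E_def t_def)
  qed
  then have "E l (g * k) = inverse (w ^ l) * E l k" for k
    using w0 by (metis divide_inverse_commute nonzero_mult_div_cancel_left power_not_zero)
  then show ?thesis using l that[of "\<lambda>j. w ^ (l * j)" m "inverse (w ^ l)"] unfolding E_def by blast
qed

text \<open>Dilations commute, so the combination that creates an eigenvector for a new
  \<open>g\<close> retains the eigenvalues already obtained.\<close>

lemma annihilated_eigenvector: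
  assumes F: "annihilated n F" "F k0 \<noteq> 0" and n: "n > 0" and A: "finite A" "\<forall>g\<in>A. coprime g n"
  shows "\<exists>F'. annihilated n F' \<and> (\<exists>k. F' k \<noteq> 0) \<and> (\<forall>g\<in>A. \<exists>z. \<forall>k. F' (g * k) = z * F' k)"
  using A
proof (induction A rule: finite_induct)
  case empty
  then show ?case using F by blast
next
  case (insert g A)
  then obtain F' k where F': "annihilated n F'" "F' k \<noteq> 0" "\<forall>h\<in>A. \<exists>z. \<forall>k. F' (h * k) = z * F' k"
    by auto
  have g: "coprime g n" using insert by simp
  obtain c m z where cmz: "\<exists>k. (\<Sum>j<m. c j * F' (g ^ j * k)) \<noteq> 0"
    "\<And>k. (\<Sum>j<m. c j * F' (g ^ j * (g * k))) = z * (\<Sum>j<m. c j * F' (g ^ j * k))"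
    by (rule annihilated_eigenvector_step[OF F'(1) g n F'(2)]) blast
  let ?E = "\<lambda>k. \<Sum>j<m. c j * F' (g ^ j * k)"
  have "\<exists>z. \<forall>k. ?E (h * k) = z * ?E k" if h: "h \<in> A" for h
  proof -
    obtain y where y: "\<forall>k. F' (h * k) = y * F' k" using bspec[OF F'(3) h] ..
    have e: "F' (g ^ j * (h * k)) = y * F' (g ^ j * k)" for j k
      using y[rule_format, of "g ^ j * k"] by (simp add: mult_ac)
    have "?E (h * k) = y * ?E k" for k
      unfolding e sum_distrib_left by (simp only: mult.left_commute)
    then show ?thesis by blast
  qed
  then show ?case using annihilated_lincomb[OF F'(1) g, of c m] cmz by blast
qed

text \<open>A nonzero \<open>F\<close> would yield a common eigenvector \<open>E\<close> of all unit
  dilations. Its value at 1 cannot vanish, and \<open>E j / E 1\<close> is a Dirichlet character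
  with value -1 at n - 1, hence nonprincipal, whose L-series at 1 would be 0.\<close>

theorem annihilated_imp_zero:
  assumes F: "annihilated n F" and n: "n > 0"
  shows "F k = 0"
proof (rule ccontr)
  assume k: "F k \<noteq> 0"
  have "finite {g. coprime g n \<and> g < n}" by simp
  from annihilated_eigenvector[OF F k n this] obtain E k where E: "annihilated n E" "E k \<noteq> 0"
    and eig: "\<forall>g\<in>{g. coprime g n \<and> g < n}. \<exists>z. \<forall>k. E (g * k) = z * E k"
    by blast
  have odd: "E i = - E j" if "n dvd i + j" for i j using E that unfolding annihilated_def by blast
  have n1: "n > 1"
  proof (rule ccontr)
    assume "\<not> n > 1"
    then have "n = 1" using n by simp
    then show False using odd[of k k] E(2) by simp
  qed
  have nc: "E j = 0" if "\<not> coprime j n" for j using E that unfolding annihilated_def by blast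
  have per: "E i = E j" if "[i = j] (mod n)" for i j
    using odd_imp_periodic[OF odd n that] .
  have eig': "\<exists>z. \<forall>k. E (g * k) = z * E k" if g: "coprime g n" for g
  proof -
    obtain z where z: "\<And>k. E ((g mod n) * k) = z * E k"
      using eig n g by (metis (mono_tags, lifting) coprime_mod_left_iff gr_implies_not0 mem_Collect_eq mod_less_divisor)
    have "E (g * k) = E ((g mod n) * k)" for k
      by (rule per) (simp add: cong_def mod_mult_left_eq)
    then show ?thesis using z by auto
  qed
  have mult': "E (g * j) * E 1 = E g * E j" for g j
  proof (cases "coprime g n")
    case True
    then obtain z where z: "\<And>k. E (g * k) = z * E k" using eig' by blast
    show ?thesis using z[of j] z[of 1] by simp
  qed (simp add: nc)
  have E1: "E 1 \<noteq> 0"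
  proof
    assume "E 1 = 0"
    have "coprime k n" using nc E(2) by blast
    then obtain z where z: "\<And>j. E (k * j) = z * E j" using eig' by blast
    show False using z[of 1] \<open>E 1 = 0\<close> E(2) by simp
  qed
  define ch where "ch j = E j / E 1" for j
  have chm: "ch (i * j) = ch i * ch j" for i j
    using mult'[of i j] E1 by (simp add: ch_def field_simps)
  have ch1: "ch 1 = 1" using E1 by (simp add: ch_def)
  have chp: "ch (i ^ j) = ch i ^ j" for i j by (induction j) (use chm ch1 in auto)
  interpret dcharacter n ch
  proof
    show "ch (j + n) = ch j" for j
      unfolding ch_def using per[of "j + n" j] by (simp add: cong_def)
    show "ch (i * j) = ch i * ch j" for i j by (rule chm)
    show "norm (ch j) = 1" if "coprime j n" for j
    proof -
      have "ch (j ^ totient n) = ch 1"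
        unfolding ch_def using per[OF euler_theorem[OF that]] by simp
      then have "norm (ch j) ^ totient n = 1" unfolding chp ch1 by (metis norm_one norm_power)
      then show ?thesis
        using n power_eq_imp_eq_base[of "norm (ch j)" "totient n" 1] by simp
    qed
    show "ch j = 0" if "\<not> coprime j n" for j using nc[OF that] by (simp add: ch_def)
    show "n > 1" by (rule n1)
  qed
  have "E (n - 1) = - E 1" by (rule odd) (use n1 in simp)
  then have "ch (n - 1) = -1" using E1 by (simp add: ch_def)
  then have "ch (n - 1) \<noteq> 1" "coprime (n - 1) n" using not_coprime by force+
  then have "\<not> (\<lambda>k. ch k / of_nat k) sums 0" by (intro L_1_neq_0)
  moreover have "(\<lambda>k. E (1 * k) / of_nat k) sums 0"
    using E(1) unfolding annihilated_def by (metis coprime_1_left)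
  then have "(\<lambda>k. E k / of_nat k / E 1) sums (0 / E 1)" by (intro sums_divide) simp
  then have "(\<lambda>k. ch k / of_nat k) sums 0" by (simp add: ch_def mult.commute)
  ultimately show False by blast
qed

text \<open>Pair \<open>k\<close> with \<open>n - k\<close>; the value at 0 is its own
  negative.\<close>

lemma odd_sum_eq_0:
  fixes F :: "nat \<Rightarrow> complex"
  assumes odd: "\<And>j k. n dvd j + k \<Longrightarrow> F j = - F k"
  shows "(\<Sum>k<n. F k) = 0"
proof -
  have "F n = - F 0" "F 0 = - F 0" by (rule odd; simp)+
  then have *: "F n = 0" "F 0 = 0" by simp_all
  have "(\<Sum>k<n. F k) = (\<Sum>k<n. F (n - Suc k))"
    by (rule sum.nat_diff_reindex[symmetric])
  also have "\<dots> = (\<Sum>k<n. - F (Suc k))"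
    by (rule sum.cong) (auto intro!: odd)
  also have "\<dots> = - (\<Sum>k<n. F k)"
    using sum.lessThan_Suc_shift[of F n] * by (simp add: sum_negf)
  finally show ?thesis by simp
qed

lemma odd_summable:
  fixes F :: "nat \<Rightarrow> complex"
  assumes odd: "\<And>j k. n dvd j + k \<Longrightarrow> F j = - F k" and n: "n > 0"
  shows "summable (\<lambda>k. F k / of_nat k)"
proof -
  have per: "F (k + n) = F k" for k
    by (rule odd_imp_periodic[OF odd n]) (auto simp: cong_def)
  have F0: "F 0 = 0" using odd[of 0 0] by simp
  have "(\<Sum>k<n. F k) = 0" by (rule odd_sum_eq_0) (rule odd)
  note b = periodic_partial_sums_bounded[OF per n this]
  have "summable (\<lambda>k. F k * of_real (1 / real k))"
    by (rule dirichlet_test_antimono[OF b F0 lim_1_over_n])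
      (simp add: field_simps)
  then show ?thesis by simp
qed

text \<open>With \<open>(P f) k = f (p k)\<close>, this is the operator \<open>(1 - P / p)\<^sup>-\<^sup>1\<close>.\<close>

definition resolvent :: "nat \<Rightarrow> (nat \<Rightarrow> complex) \<Rightarrow> nat \<Rightarrow> complex" where
  "resolvent p f k = suminf (\<lambda>a. f (p ^ a * k) / of_nat p ^ a)"

context
  fixes f :: "nat \<Rightarrow> complex" and B :: real and p :: nat
  assumes bounded: "\<And>k. norm (f k) \<le> B" and p: "p \<ge> 2"
begin

lemma resolvent_bound_sums: "(\<lambda>a. B / real p ^ a) sums (B / (1 - 1 / real p))"
proof -
  have "(\<lambda>a. B * (1 / real p) ^ a) sums (B * (1 / (1 - 1 / real p)))"
    using p by (intro sums_mult geometric_sums) simp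
  then show ?thesis by (simp add: power_one_over divide_inverse power_inverse)
qed

lemma resolvent_term_le: "norm (f (p ^ a * k) / of_nat p ^ a) \<le> B / real p ^ a"
  using bounded[of "p ^ a * k"] p by (simp add: norm_divide norm_power divide_right_mono)

lemma resolvent_sums: "(\<lambda>a. f (p ^ a * k) / of_nat p ^ a) sums resolvent p f k"
  unfolding resolvent_def
  by (intro summable_sums summable_comparison_test'[OF sums_summable[OF resolvent_bound_sums], of 0]
      resolvent_term_le)

lemma resolvent_bounded: "norm (resolvent p f k) \<le> B / (1 - 1 / real p)"
  unfolding resolvent_def sums_unique[OF resolvent_bound_sums]
  by (intro norm_suminf_le resolvent_term_le sums_summable[OF resolvent_bound_sums])

lemma resolvent_step: "resolvent p f k - resolvent p f (p * k) / of_nat p = f k"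
proof -
  have s: "(\<lambda>a. f (p ^ Suc a * k) / of_nat p ^ Suc a) sums (resolvent p f k - f k)"
    using resolvent_sums[of k] by (subst sums_Suc_iff) simp
  have "(\<lambda>a. f (p ^ a * (p * k)) / of_nat p ^ a / of_nat p) sums (resolvent p f (p * k) / of_nat p)"
    by (intro sums_divide resolvent_sums)
  moreover have "(\<lambda>a. f (p ^ a * (p * k)) / of_nat p ^ a / of_nat p) = (\<lambda>a. f (p ^ Suc a * k) / of_nat p ^ Suc a)"
    by (simp add: mult_ac)
  ultimately have "resolvent p f k - f k = resolvent p f (p * k) / of_nat p"
    using s sums_unique2 by metis
  then show ?thesis by (simp add: algebra_simps)
qed

lemma resolvent_odd:
  assumes odd: "\<And>j k. n dvd j + k \<Longrightarrow> f j = - f k" and jk: "n dvd j + k"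
  shows "resolvent p f j = - resolvent p f k"
proof -
  have "f (p ^ a * j) = - f (p ^ a * k)" for a
    by (rule odd) (use jk in \<open>simp flip: distrib_left\<close>)
  then have "(\<lambda>a. - (f (p ^ a * k) / of_nat p ^ a)) sums resolvent p f j"
    using resolvent_sums[of j] by simp
  then show ?thesis using sums_minus[OF resolvent_sums[of k]] sums_unique2 by blast
qed

end

text \<open>With S(c) the sum of h(gcj)/j, inclusion-exclusion gives S(1) - S(p)/p - S(q)/q +
  S(pq)/(pq) for the sum of h(gj)/j over j prime to \<open>n\<close>. Expanding \<open>f\<close>
  through \<open>h\<close> gives the same expression for the sum of f(gj)/j, which is 0. Oddness of
  \<open>h\<close> makes every S(c) converge.\<close>

theorem resolvent_vanishes_on_units:
  fixes f :: "nat \<Rightarrow> complex"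
  assumes p: "Factorial_Ring.prime p" and q: "Factorial_Ring.prime q" and pq: "p \<noteq> q"
    and n: "\<And>k. coprime k n \<longleftrightarrow> \<not> p dvd k \<and> \<not> q dvd k" "n > 0"
    and odd: "\<And>j k. n dvd j + k \<Longrightarrow> f j = - f k"
    and bounded: "\<And>k. norm (f k) \<le> B"
    and sums: "\<And>g. coprime g n \<Longrightarrow> (\<lambda>k. f (g * k) / of_nat k) sums 0"
    and k: "coprime k n"
  shows "resolvent p (resolvent q f) k = 0"
proof -
  define h where "h = resolvent p (resolvent q f)"
  have p2: "p \<ge> 2" and q2: "q \<ge> 2" using p q prime_ge_2_nat by auto
  have bounded': "norm (resolvent q f j) \<le> B / (1 - 1 / real q)" for j
    by (rule resolvent_bounded[OF bounded q2])
  have odd': "resolvent q f i = - resolvent q f j" if "n dvd i + j" for i j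
    by (rule resolvent_odd[OF bounded q2 odd that])
  have h_odd: "h i = - h j" if "n dvd i + j" for i j
    unfolding h_def by (rule resolvent_odd[OF bounded' p2 odd' that])
  have f: "f j = h j - h (p * j) / of_nat p - h (q * j) / of_nat q + h (p * (q * j)) / (of_nat p * of_nat q)" for j
  proof -
    have r: "resolvent q f i = h i - h (p * i) / of_nat p" for i
      unfolding h_def by (rule resolvent_step[OF bounded' p2, symmetric])
    have "f j = resolvent q f j - resolvent q f (q * j) / of_nat q"
      by (rule resolvent_step[OF bounded q2, symmetric])
    then show ?thesis unfolding r by (simp add: diff_divide_distrib)
  qed
  define F where "F j = (if coprime j n then h j else 0)" for j
  have "annihilated n F"
    unfolding annihilated_def
  proof (intro conjI allI impI)
    fix i j assume ij: "n dvd i + j"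
    have "coprime i n \<longleftrightarrow> coprime j n"
    proof -
      have "\<not> coprime p n" "\<not> coprime q n" using n(1)[of p] n(1)[of q] by simp_all
      then have "p dvd n" "q dvd n" using p q prime_imp_coprime_nat by blast+
      then have "p dvd i + j" "q dvd i + j" using ij dvd_trans by blast+
      then have "p dvd i \<longleftrightarrow> p dvd j" "q dvd i \<longleftrightarrow> q dvd j"
        using dvd_add_right_iff dvd_add_left_iff by blast+
      then show ?thesis unfolding n(1) by blast
    qed
    then show "F i = - F j" using h_odd[OF ij] by (simp add: F_def)
  next
    fix j assume "\<not> coprime j n"
    then show "F j = 0" by (simp add: F_def)
  next
    fix g assume g: "coprime g n"
    have sm: "(\<lambda>j. h (c * j) / of_nat j) sums suminf (\<lambda>j. h (c * j) / of_nat j)" for c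
      by (rule summable_sums, rule odd_summable[OF _ n(2)], rule h_odd) (simp flip: distrib_left)
    define u where "u j = h (g * j) / of_nat j" for j
    define S where "S c = suminf (\<lambda>j. h (g * c * j) / of_nat j)" for c
    have u: "(\<lambda>j. if c dvd j then u j else 0) sums (S c / of_nat c)" if c: "c > 0" for c
    proof (rule sums_dvd_reindex[OF _ c])
      have "(\<lambda>j. h (g * c * j) / of_nat j / of_nat c) sums (S c / of_nat c)"
        unfolding S_def by (intro sums_divide sm)
      then show "(\<lambda>j. u (c * j)) sums (S c / of_nat c)" by (simp add: u_def mult_ac)
    qed
    have "(\<lambda>j. (if 1 dvd j then u j else 0) - (if p dvd j then u j else 0) - (if q dvd j then u j else 0)
        + (if p * q dvd j then u j else 0)) sums (S 1 / of_nat 1 - S p / of_nat p - S q / of_nat q + S (p * q) / of_nat (p * q))"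
      using p2 q2 by (intro sums_add sums_diff u) auto
    moreover have "(if 1 dvd j then u j else 0) - (if p dvd j then u j else 0) - (if q dvd j then u j else 0)
        + (if p * q dvd j then u j else 0) = F (g * j) / of_nat j" for j
    proof -
      have "p * q dvd j \<longleftrightarrow> p dvd j \<and> q dvd j"
        by (intro iffI conjI divides_mult primes_coprime p q pq)
          (auto dest: dvd_mult_left dvd_mult_right)
      moreover have "coprime (g * j) n \<longleftrightarrow> \<not> p dvd j \<and> \<not> q dvd j"
        using g n(1) by (simp add: prime_dvd_mult_iff p q)
      ultimately show ?thesis by (auto simp: F_def u_def)
    qed
    ultimately have "(\<lambda>j. F (g * j) / of_nat j) sums (S 1 / of_nat 1 - S p / of_nat p - S q / of_nat q + S (p * q) / of_nat (p * q))"
      by simp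
    moreover have "S 1 / of_nat 1 - S p / of_nat p - S q / of_nat q + S (p * q) / of_nat (p * q) = 0"
    proof -
      have "(\<lambda>j. h (g * 1 * j) / of_nat j - h (g * p * j) / of_nat j / of_nat p - h (g * q * j) / of_nat j / of_nat q
        + h (g * (p * q) * j) / of_nat j / (of_nat p * of_nat q)) sums (S 1 - S p / of_nat p - S q / of_nat q + S (p * q) / (of_nat p * of_nat q))"
        unfolding S_def by (intro sums_add sums_diff sums_divide sm)
      moreover have "h (g * 1 * j) / of_nat j - h (g * p * j) / of_nat j / of_nat p - h (g * q * j) / of_nat j / of_nat q
        + h (g * (p * q) * j) / of_nat j / (of_nat p * of_nat q) = f (g * j) / of_nat j" for j
        unfolding f[of "g * j"] by (simp add: diff_divide_distrib add_divide_distrib mult_ac)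
      ultimately have "(\<lambda>j. f (g * j) / of_nat j) sums (S 1 - S p / of_nat p - S q / of_nat q + S (p * q) / (of_nat p * of_nat q))"
        by simp
      then show ?thesis using sums[OF g] sums_unique2 by force
    qed
    ultimately show "(\<lambda>j. F (g * j) / of_nat j) sums 0" by simp
  qed
  then have "F k = 0" by (rule annihilated_imp_zero[OF _ n(2)])
  then show ?thesis using k by (simp add: F_def h_def)
qed

section \<open>Finite Fourier transforms\<close>

definition unity_root :: "nat \<Rightarrow> int \<Rightarrow> complex" where
  "unity_root n t = cis (2 * pi * of_int t / of_nat n)"

definition inv_fourier :: "nat \<Rightarrow> (nat \<Rightarrow> complex) \<Rightarrow> int \<Rightarrow> complex" where
  "inv_fourier n h x = (\<Sum>k<n. h k * unity_root n (- (int k * x))) / of_nat n"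

text \<open>The inverse transform of k -> 2 i sin(2 pi k y / n): a unit mass at \<open>y\<close>
  minus a unit mass at - y, modulo \<open>n\<close>, evaluated at \<open>x\<close>.\<close>

definition odd_mass :: "nat \<Rightarrow> int \<Rightarrow> int \<Rightarrow> real" where
  "odd_mass n y x = of_bool ([y = x] (mod int n)) - of_bool ([y = - x] (mod int n))"

context
  fixes n :: nat
  assumes n: "n > 0"
begin

lemma unity_root_add: "unity_root n (s + t) = unity_root n s * unity_root n t"
  by (simp add: unity_root_def cis_mult add_divide_distrib distrib_left)

lemma unity_root_power: "unity_root n (int k * t) = unity_root n t ^ k"
  by (simp add: unity_root_def Complex.DeMoivre mult_ac)

lemma unity_root_eq_1_iff: "unity_root n t = 1 \<longleftrightarrow> int n dvd t"
proof
  assume "unity_root n t = 1"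
  then have "cos (2 * pi * of_int t / real n) = 1"
    by (simp add: unity_root_def complex_eq_iff)
  then obtain i :: int where "2 * pi * of_int t / real n = i * (2 * pi)"
    using cos_one_2pi_int by auto
  then have "real_of_int t = of_int (i * int n)" using n by (simp add: field_simps)
  then have "t = i * int n" by (simp only: of_int_eq_iff)
  then show "int n dvd t" by simp
next
  assume "int n dvd t"
  then obtain i where "t = int n * i" by blast
  then have "2 * pi * of_int t / of_nat n = 2 * pi * of_int i" using n by simp
  then show "unity_root n t = 1"
    unfolding unity_root_def by (simp only: cis_multiple_2pi Ints_of_int)
qed

lemma unity_root_cong: "[s = t] (mod int n) \<Longrightarrow> unity_root n s = unity_root n t"
  using unity_root_add[of "s - t" t] unity_root_eq_1_iff[of "s - t"]
  by (simp add: cong_iff_dvd_diff)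

lemma norm_unity_root [simp]: "norm (unity_root n t) = 1"
  by (simp add: unity_root_def)

lemma sum_unity_root: "(\<Sum>k<n. unity_root n (int k * t)) = (if int n dvd t then of_nat n else 0)"
proof -
  have "unity_root n t ^ n = 1"
    using unity_root_eq_1_iff[of "int n * t"] by (simp add: unity_root_power)
  then show ?thesis
    using unity_root_eq_1_iff[of t] by (auto simp: unity_root_power sum_gp_strict)
qed

lemma inv_fourier_resolvent_sums:
  assumes "\<And>k. norm (h k) \<le> B" "p \<ge> 2"
  shows "(\<lambda>a. inv_fourier n (\<lambda>k. h (p ^ a * k)) x / of_nat p ^ a) sums inv_fourier n (resolvent p h) x"
proof -
  have "(\<lambda>a. (\<Sum>k<n. h (p ^ a * k) / of_nat p ^ a * unity_root n (- (int k * x))) / of_nat n) sums inv_fourier n (resolvent p h) x"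
    unfolding inv_fourier_def
    by (intro sums_divide sums_sum sums_mult2 resolvent_sums[OF assms])
  then show ?thesis by (simp add: inv_fourier_def sum_divide_distrib mult_ac)
qed

lemma inv_fourier_odd_mass:
  "inv_fourier n (\<lambda>k. \<Sum>i\<in>I. unity_root n (int k * u i) - unity_root n (- (int k * u i))) x
    = of_real (\<Sum>i\<in>I. odd_mass n (u i) x)"
proof -
  have 1: "(\<Sum>k<n. unity_root n (int k * y) * unity_root n (- (int k * x))) = of_nat n * of_bool ([y = x] (mod int n))" for y
  proof -
    have "unity_root n (int k * y) * unity_root n (- (int k * x)) = unity_root n (int k * (y - x))" for k
      by (simp add: unity_root_add[symmetric] algebra_simps)
    then show ?thesis using sum_unity_root[of "y - x"] by (simp add: cong_iff_dvd_diff)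
  qed
  have 2: "of_bool ([- y = x] (mod int n)) = (of_bool ([y = - x] (mod int n)) :: complex)" for y
    using cong_minus_minus_iff[of "- y" x "int n"] by simp
  have of_bool: "complex_of_real (of_bool b) = of_bool b" for b by simp
  have "(\<Sum>k<n. (\<Sum>i\<in>I. unity_root n (int k * u i) - unity_root n (- (int k * u i))) * unity_root n (- (int k * x)))
     = (\<Sum>i\<in>I. (\<Sum>k<n. unity_root n (int k * u i) * unity_root n (- (int k * x)))
          - (\<Sum>k<n. unity_root n (int k * (- u i)) * unity_root n (- (int k * x))))"
    unfolding sum_distrib_right left_diff_distrib sum_subtractf[symmetric]
    by (subst sum.swap) simp
  also have "\<dots> = (\<Sum>i\<in>I. of_nat n * (of_bool ([u i = x] (mod int n)) - of_bool ([u i = - x] (mod int n))))"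
    unfolding 1 2 by (simp add: right_diff_distrib)
  finally show ?thesis
    using n by (simp add: inv_fourier_def odd_mass_def of_bool sum_distrib_left[symmetric])
qed

lemma inv_fourier_cong: "[x = y] (mod int n) \<Longrightarrow> inv_fourier n h x = inv_fourier n h y"
proof -
  assume "[x = y] (mod int n)"
  then have "unity_root n (- (int k * x)) = unity_root n (- (int k * y))" for k
    by (intro unity_root_cong) (simp add: cong_scalar_left cong_minus_minus_iff)
  then show ?thesis by (simp add: inv_fourier_def)
qed

text \<open>On the support of \<open>h\<close> the index is a multiple of \<open>r\<close>, so its
  product with \<open>t\<close> is 0 modulo \<open>n\<close> and the shift changes no
  exponential.\<close>

lemma inv_fourier_shift:
  assumes "\<And>k. \<not> r dvd k \<Longrightarrow> h k = 0" and t: "int n dvd int r * t"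
  shows "inv_fourier n h (x + t) = inv_fourier n h x"
proof -
  have "h k * unity_root n (- (int k * (x + t))) = h k * unity_root n (- (int k * x))" for k
  proof (cases "r dvd k")
    case True
    then obtain j where "k = r * j" by blast
    then have e: "int k * t = int r * t * int j" by simp
    have "int n dvd int k * t" unfolding e using t by (rule dvd_mult2)
    then have "[- (int k * (x + t)) = - (int k * x)] (mod int n)"
      by (simp add: cong_iff_dvd_diff algebra_simps)
    then show ?thesis using unity_root_cong by simp
  qed (use assms in simp)
  then show ?thesis
    unfolding inv_fourier_def by (intro arg_cong2[where f = "(/)"] sum.cong refl)
qed

text \<open>\<open>h\<close> splits into a part carried by multiples of \<open>p\<close> and one
  carried by multiples of \<open>q\<close>. The transform of the first is invariant under
  \<open>s\<close>, that of the second under \<open>t\<close>, so the mixed second difference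
  vanishes.\<close>

lemma inv_fourier_box:
  assumes h: "\<And>k. \<not> p dvd k \<Longrightarrow> \<not> q dvd k \<Longrightarrow> h k = 0"
    and s: "int n dvd int p * s" and t: "int n dvd int q * t"
  shows "inv_fourier n h x - inv_fourier n h (x + s) - inv_fourier n h (x + t) + inv_fourier n h (x + s + t) = 0"
proof -
  let ?h1 = "\<lambda>k. if p dvd k then h k else 0" and ?h2 = "\<lambda>k. if p dvd k then 0 else h k"
  have d: "inv_fourier n h y = inv_fourier n ?h1 y + inv_fourier n ?h2 y" for y
    unfolding inv_fourier_def add_divide_distrib[symmetric] sum.distrib[symmetric]
    by (intro arg_cong2[where f = "(/)"] sum.cong) auto
  have 1: "inv_fourier n ?h1 (y + s) = inv_fourier n ?h1 y" for y
    by (rule inv_fourier_shift[OF _ s]) simp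
  have 2: "inv_fourier n ?h2 (y + t) = inv_fourier n ?h2 y" for y
    by (rule inv_fourier_shift[OF _ t]) (simp add: h)
  have "inv_fourier n ?h1 (x + s + t) = inv_fourier n ?h1 (x + t)"
    using 1[of "x + t"] by (simp add: add_ac)
  then show ?thesis by (simp add: d 1 2)
qed

end

section \<open>Valuations of residues\<close>

lemma multiplicity_eq_of_cong:
  fixes x y r :: int
  assumes c: "[y = x] (mod m)" and m: "r ^ e dvd m" and x: "\<not> r ^ e dvd x"
  shows "multiplicity r y = multiplicity r x"
proof (rule multiplicity_cong)
  fix j
  have *: "[y = x] (mod r ^ e)" using c m by (rule cong_dvd_modulus)
  show "r ^ j dvd y \<longleftrightarrow> r ^ j dvd x"
  proof (cases "j \<le> e")
    case True
    then have "[y = x] (mod r ^ j)" using * by (meson cong_dvd_modulus le_imp_power_dvd)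
    then show ?thesis by (rule cong_dvd_iff)
  next
    case False
    then have "r ^ e dvd r ^ j" by (simp add: le_imp_power_dvd)
    then show ?thesis using x cong_dvd_iff[OF *] dvd_trans by blast
  qed
qed

lemma multiplicity_uminus_int: "multiplicity r (- x) = multiplicity r (x :: int)"
  by (rule multiplicity_cong) simp

text \<open>If \<open>r ^ b y\<close> is congruent to \<open>x\<close> or \<open>- x\<close>, comparing valuations determines \<open>b\<close>.\<close>

lemma odd_mass_geometric_sums:
  fixes x y :: int and r n e :: nat
  assumes r: "Factorial_Ring.prime r" and n: "int r ^ e dvd int n" and x: "\<not> int r ^ e dvd x"
    and y: "y \<noteq> 0"
  defines "d \<equiv> multiplicity (int r) x - multiplicity (int r) y"
  shows "(\<lambda>b. odd_mass n (int r ^ b * y) x / real r ^ b) sums (odd_mass n (int r ^ d * y) x / real r ^ d)"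
proof -
  have r': "Factorial_Ring.prime (int r)" using r by simp
  have m: "multiplicity (int r) (int r ^ b * y) = b + multiplicity (int r) y" for b
    using r' y by (simp add: prime_elem_multiplicity_mult_distrib multiplicity_same_power not_prime_unit)
  \<comment> \<open>Natural subtraction truncates \<open>d\<close> to 0 when \<open>y\<close> has
    the larger valuation; then no \<open>int r ^ b * y\<close> is congruent to \<open>x\<close> or
    \<open>- x\<close>, and the remaining term at 0 vanishes too.\<close>
  have "odd_mass n (int r ^ b * y) x = 0" if "b \<noteq> d" for b
  proof -
    have "b = d" if "[int r ^ b * y = x] (mod int n)"
      using multiplicity_eq_of_cong[OF that n x] m[of b] by (simp add: d_def)
    moreover have "b = d" if "[int r ^ b * y = - x] (mod int n)"
      using multiplicity_eq_of_cong[OF that n] x m[of b] by (simp add: d_def multiplicity_uminus_int)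
    ultimately show ?thesis using that by (auto simp: odd_mass_def)
  qed
  then have "(\<lambda>b. odd_mass n (int r ^ b * y) x / real r ^ b) = (\<lambda>b. if b = d then odd_mass n (int r ^ b * y) x / real r ^ b else 0)"
    by auto
  then show ?thesis
    using sums_single[of d "\<lambda>b. odd_mass n (int r ^ b * y) x / real r ^ b"] by simp
qed

section \<open>Four residues whose multiples have average \<open>n / 2\<close>\<close>

text \<open>Pigeonhole: the \<open>m\<close> obstructions together spoil at most
  \<open>m < r\<close> of the columns.\<close>

lemma exists_avoiding:
  fixes H :: "nat \<Rightarrow> nat \<Rightarrow> bool"
  assumes "\<And>i j k. i < m \<Longrightarrow> j < r \<Longrightarrow> k < r \<Longrightarrow> H i j \<Longrightarrow> H i k \<Longrightarrow> j = k" and "m < r"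
  shows "\<exists>j<r. \<forall>i<m. \<not> H i j"
proof (rule ccontr)
  assume "\<not> ?thesis"
  then have "{..<r} \<subseteq> (\<Union>i<m. {j. j < r \<and> H i j})" by auto
  then have "r \<le> card (\<Union>i<m. {j. j < r \<and> H i j})"
    using card_mono[of "\<Union>i<m. {j. j < r \<and> H i j}" "{..<r}"] by auto
  also have "\<dots> \<le> (\<Sum>i<m. card {j. j < r \<and> H i j})" by (rule card_UN_le) simp
  also have "\<dots> \<le> (\<Sum>i<m. 1)"
  proof (rule sum_mono)
    fix i assume "i \<in> {..<m}"
    then have "\<forall>j\<in>{j. j < r \<and> H i j}. \<forall>k\<in>{j. j < r \<and> H i j}. j = k" using assms(1) by auto
    then show "card {j. j < r \<and> H i j} \<le> 1"
      using card_le_Suc0_iff_eq[of "{j. j < r \<and> H i j}"] by simp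
  qed
  finally show False using \<open>m < r\<close> by simp
qed

lemma sum_less_4: "(\<Sum>i<4. f i) = f 0 + f 1 + f 2 + f (3::nat)" for f :: "nat \<Rightarrow> 'a :: comm_monoid_add"
  by (simp add: eval_nat_numeral add_ac)

text \<open>A counterexample in terms of exponents: all unit multiples have residue sum
  \<open>2 * n\<close>. Pairs with sum 0 are not excluded, since finding one is the aim. The
  assumptions are symmetric in \<open>p\<close> and \<open>q\<close>, so \<open>swap\<close> doubles
  every result.\<close>

locale half_sums =
  fixes p q b c n :: nat and u :: "nat \<Rightarrow> int"
  assumes p: "Factorial_Ring.prime p" "p \<ge> 5" and q: "Factorial_Ring.prime q" "q \<ge> 5" and pq: "p \<noteq> q"
    and b: "b \<ge> 1" and c: "c \<ge> 1" and n: "n = p ^ b * q ^ c"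
    and nonzero: "\<And>i. i < 4 \<Longrightarrow> \<not> int n dvd u i"
    and zero: "int n dvd (\<Sum>i<4. u i)"
    and half: "\<And>g. coprime g n \<Longrightarrow> (\<Sum>i<4. int g * u i mod int n) = 2 * int n"
begin

lemma swap: "half_sums q p c b n u"
  using p q pq b c n nonzero zero half by unfold_locales (auto simp: mult.commute)

lemma n_pos: "n > 0"
  using p q by (simp add: n prime_gt_0_nat)

lemma coprime_n_iff: "coprime k n \<longleftrightarrow> \<not> p dvd k \<and> \<not> q dvd k"
proof -
  have "coprime k r \<longleftrightarrow> \<not> r dvd k" if "Factorial_Ring.prime r" for r
    using that prime_imp_coprime_nat[OF that, of k] not_prime_unit
    by (metis coprime_commute coprime_absorb_left)
  then show ?thesis using p q b c by (simp add: n)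
qed

lemma odd_n: "odd n"
proof -
  have "odd p" "odd q" using p q prime_odd_nat by auto
  then show ?thesis by (simp add: n)
qed

lemma coprime_pq_powers: "coprime (int p ^ i) (int q ^ j)"
  using primes_coprime[OF p(1) q(1) pq] by simp

lemma n_dvd_iff: "int n dvd x \<longleftrightarrow> int p ^ b dvd x \<and> int q ^ c dvd x"
proof
  assume "int p ^ b dvd x \<and> int q ^ c dvd x"
  then show "int n dvd x" using divides_mult[OF _ _ coprime_pq_powers] by (simp add: n)
qed (auto simp: n dest: dvd_mult_left dvd_mult_right)

lemma two_dvd_cancel:
  "int p ^ i dvd 2 * x \<longleftrightarrow> int p ^ i dvd x"
proof -
  have "odd p" using p prime_odd_nat by auto
  then have "coprime (int p ^ i) 2" by simp
  then show ?thesis by (rule coprime_dvd_mult_right_iff)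
qed

lemma multiplicity_mult_q: "x \<noteq> 0 \<Longrightarrow> multiplicity (int p) (int q ^ j * x) = multiplicity (int p) x"
proof -
  assume x: "x \<noteq> 0"
  have "\<not> p dvd q" using p(1) q(1) pq primes_dvd_imp_eq by blast
  then have "\<not> p dvd q ^ j" using p(1) prime_dvd_power by blast
  then have "\<not> int p dvd int q ^ j" by (simp only: of_nat_power[symmetric] of_nat_dvd_iff not_False_eq_True)
  then have "multiplicity (int p) (int q ^ j) = 0" by (rule not_dvd_imp_multiplicity_0)
  then show ?thesis
    using x p q by (simp add: prime_elem_multiplicity_mult_distrib)
qed

definition f :: "nat \<Rightarrow> complex" where
  "f k = (\<Sum>i<4. unity_root n (int k * u i) - unity_root n (- (int k * u i)))"

lemma f_cong:
  assumes "\<And>i. i < 4 \<Longrightarrow> [int j * u i = int k * u i] (mod int n)"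
  shows "f j = f k"
  unfolding f_def
  by (intro sum.cong refl arg_cong2[where f = "(-)"] unity_root_cong[OF n_pos])
    (use assms in \<open>auto simp: cong_minus_minus_iff\<close>)

lemma f_odd:
  assumes "n dvd j + k"
  shows "f j = - f k"
proof -
  have *: "unity_root n (int j * u i) = unity_root n (- (int k * u i))" for i
  proof (rule unity_root_cong[OF n_pos])
    have "int n dvd int (j + k) * u i" using assms by (intro dvd_mult2) (simp only: of_nat_dvd_iff)
    then show "[int j * u i = - (int k * u i)] (mod int n)"
      by (simp add: cong_iff_dvd_diff distrib_right)
  qed
  have **: "unity_root n (- (int j * u i)) = unity_root n (int k * u i)" for i
  proof (rule unity_root_cong[OF n_pos])
    have "int n dvd - (int (j + k) * u i)" using assms by (simp only: dvd_minus_iff) (intro dvd_mult2, simp only: of_nat_dvd_iff)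
    then show "[- (int j * u i) = int k * u i] (mod int n)"
      by (simp add: cong_iff_dvd_diff distrib_right)
  qed
  show ?thesis unfolding f_def * ** by (simp add: sum_negf[symmetric])
qed

lemma f_bounded: "norm (f k) \<le> 8"
proof -
  have "norm (f k) \<le> (\<Sum>i<4. norm (unity_root n (int k * u i) - unity_root n (- (int k * u i))))"
    unfolding f_def by (rule norm_sum)
  also have "\<dots> \<le> (\<Sum>i<4::nat. 2)"
  proof (rule sum_mono)
    fix i
    show "norm (unity_root n (int k * u i) - unity_root n (- (int k * u i))) \<le> 2"
      using norm_triangle_ineq4[of "unity_root n (int k * u i)" "unity_root n (- (int k * u i))"]
      by (simp add: norm_unity_root[OF n_pos])
  qed
  finally show ?thesis by simp
qed

text \<open>At t_i, the fractional part of g u_i / n, the sawtooth series has the value pi (1/2 -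
  t_i). The t_i add up to 2 by \<open>half\<close>, and \<open>nonzero\<close> keeps them off 0,
  where the sawtooth jumps.\<close>

lemma f_sums:
  assumes g: "coprime g n"
  shows "(\<lambda>k. f (g * k) / of_nat k) sums 0"
proof -
  define t where "t i = real_of_int (int g * u i mod int n) / real n" for i
  have t: "0 < t i" "t i < 1" if "i < 4" for i
  proof -
    have "\<not> int n dvd int g * u i"
      using nonzero[OF that] g coprime_dvd_mult_right_iff[of "int n" "int g" "u i"]
      by (simp add: coprime_commute)
    then have "int g * u i mod int n \<noteq> 0" by (simp add: dvd_eq_mod_eq_0)
    then have "0 < int g * u i mod int n" "int g * u i mod int n < int n"
      using n_pos pos_mod_bound[of "int n" "int g * u i"] pos_mod_sign[of "int n" "int g * u i"] by linarith+
    then have "0 < real_of_int (int g * u i mod int n)" "real_of_int (int g * u i mod int n) < real_of_int (int n)"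
      by (simp_all only: of_int_0_less_iff of_int_less_iff)
    then show "0 < t i" "t i < 1" using n_pos by (simp_all add: t_def)
  qed
  have fg: "f (g * k) = (\<Sum>i<4. of_real (sin (2 * pi * t i * real k)) * (2 * \<i>))" for k
    unfolding f_def
  proof (rule sum.cong)
    fix i
    let ?r = "int g * u i mod int n"
    have e: "[int (g * k) * u i = int k * ?r] (mod int n)"
      by (simp add: cong_def mod_mult_right_eq) (simp add: mult_ac)
    then have "unity_root n (int (g * k) * u i) = unity_root n (int k * ?r)"
      "unity_root n (- (int (g * k) * u i)) = unity_root n (- (int k * ?r))"
      by (auto intro!: unity_root_cong[OF n_pos] simp: cong_minus_minus_iff)
    moreover have "unity_root n s - unity_root n (- s) = of_real (sin (2 * pi * of_int s / real n)) * (2 * \<i>)" for s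
      by (simp add: unity_root_def complex_eq_iff)
    moreover have "2 * pi * of_int (int k * ?r) / real n = 2 * pi * t i * real k"
      by (simp add: t_def)
    ultimately show "unity_root n (int (g * k) * u i) - unity_root n (- (int (g * k) * u i))
        = of_real (sin (2 * pi * t i * real k)) * (2 * \<i>)" by simp
  qed simp
  have "(\<lambda>k. \<Sum>i<4. of_real (sin (2 * pi * t i * real k) / real k) * (2 * \<i>)) sums
      (\<Sum>i<4. of_real (pi * (1 / 2 - t i)) * (2 * \<i>))"
    by (intro sums_sum sums_mult2 sums_of_real sawtooth_series t) auto
  moreover have "(\<Sum>i<4. complex_of_real (pi * (1 / 2 - t i)) * (2 * \<i>)) = 0"
  proof -
    have "(\<Sum>i<4. t i) = real_of_int (\<Sum>i<4. int g * u i mod int n) / real n"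
      by (simp add: t_def sum_divide_distrib)
    also have "\<dots> = 2" unfolding half[OF g] using n_pos by simp
    finally have "(\<Sum>i<4. pi * (1 / 2 - t i)) = 0"
      by (simp add: sum_distrib_left[symmetric] sum_subtractf)
    then show ?thesis
      unfolding sum_distrib_right[symmetric] of_real_sum[symmetric] by (simp only: of_real_0 mult_zero_left)
  qed
  ultimately show ?thesis by (simp add: fg sum_divide_distrib)
qed

definition h :: "nat \<Rightarrow> complex" where
  "h = resolvent p (resolvent q f)"

lemma h_eq_0: "\<not> p dvd k \<Longrightarrow> \<not> q dvd k \<Longrightarrow> h k = 0"
  unfolding h_def
  by (rule resolvent_vanishes_on_units[OF p(1) q(1) pq coprime_n_iff n_pos f_odd f_bounded f_sums])
    (auto simp: coprime_n_iff)

lemma pos_pq: "p \<ge> 2" "q \<ge> 2" using p q by auto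

lemma resolvent_f_bounded: "norm (resolvent q f k) \<le> 8 / (1 - 1 / real q)"
  by (rule resolvent_bounded[OF f_bounded pos_pq(2)])

lemma inv_fourier_f: "inv_fourier n (\<lambda>k. f (m * k)) x = of_real (\<Sum>i<4. odd_mass n (int m * u i) x)"
  using inv_fourier_odd_mass[OF n_pos, of "\<lambda>i. int m * u i" "{..<4}" x]
  by (simp add: f_def mult_ac)

text \<open>The only exponent for which a power of \<open>p\<close> times \<open>u i\<close> can
  match the \<open>p\<close>-adic valuation of \<open>x\<close>; truncated to 0 if that of
  \<open>u i\<close> is already larger.\<close>

definition dp :: "nat \<Rightarrow> int \<Rightarrow> nat" where
  "dp i x = multiplicity (int p) x - multiplicity (int p) (u i)"

definition dq :: "nat \<Rightarrow> int \<Rightarrow> nat" where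
  "dq i x = multiplicity (int q) x - multiplicity (int q) (u i)"

definition D :: "nat \<Rightarrow> int \<Rightarrow> nat" where
  "D i x = p ^ dp i x * q ^ dq i x"

lemma u_nonzero: "i < 4 \<Longrightarrow> u i \<noteq> 0"
  using nonzero[of i] by auto

text \<open>Only the series in powers of \<open>q\<close> collapses here. The factor p^a, which does
  not affect \<open>q\<close>-adic valuations, stays free: it runs through the outer resolvent, and
  \<open>a = 0\<close> serves the case where every \<open>u i\<close> is divisible by
  \<open>p ^ b\<close>.\<close>

lemma inv_fourier_resolvent_f:
  assumes x: "\<not> int q ^ c dvd x"
  shows "inv_fourier n (resolvent q (\<lambda>k. f (p ^ a * k))) x
    = of_real (\<Sum>i<4. odd_mass n (int q ^ dq i x * (int p ^ a * u i)) x / real q ^ dq i x)"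
proof -
  have "(\<lambda>j. inv_fourier n (\<lambda>k. f (p ^ a * (q ^ j * k))) x / of_nat q ^ j) sums
      inv_fourier n (resolvent q (\<lambda>k. f (p ^ a * k))) x"
    by (rule inv_fourier_resolvent_sums[OF n_pos f_bounded pos_pq(2)])
  moreover have "inv_fourier n (\<lambda>k. f (p ^ a * (q ^ j * k))) x / of_nat q ^ j
      = of_real (\<Sum>i<4. odd_mass n (int q ^ j * (int p ^ a * u i)) x / real q ^ j)" for j
    using inv_fourier_f[of "p ^ a * q ^ j" x] by (simp add: mult_ac sum_divide_distrib)
  moreover have "(\<lambda>j. of_real (\<Sum>i<4. odd_mass n (int q ^ j * (int p ^ a * u i)) x / real q ^ j)) sums
      complex_of_real (\<Sum>i<4. odd_mass n (int q ^ dq i x * (int p ^ a * u i)) x / real q ^ dq i x)"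
  proof (intro sums_of_real sums_sum)
    fix i :: nat assume "i \<in> {..<4}"
    then have u: "u i \<noteq> 0" using u_nonzero by simp
    have d: "dq i x = multiplicity (int q) x - multiplicity (int q) (int p ^ a * u i)"
      using half_sums.multiplicity_mult_q[OF swap u] by (simp add: dq_def)
    show "(\<lambda>j. odd_mass n (int q ^ j * (int p ^ a * u i)) x / real q ^ j) sums
        (odd_mass n (int q ^ dq i x * (int p ^ a * u i)) x / real q ^ dq i x)"
      unfolding d by (rule odd_mass_geometric_sums[OF q(1) _ x]) (use u p in \<open>auto simp: n\<close>)
  qed
  ultimately show ?thesis using sums_unique2 by fastforce
qed

definition mass :: "int \<Rightarrow> real" where
  "mass x = (\<Sum>i<4. odd_mass n (int (D i x) * u i) x / real (D i x))"

text \<open>For \<open>x\<close> nonzero modulo both prime powers each of the two geometric series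
  keeps a single term for each \<open>i\<close>. At other points infinitely many powers may be
  congruent to \<open>x\<close>, so the closed form is restricted to these.\<close>

lemma inv_fourier_h:
  assumes x: "\<not> int p ^ b dvd x" "\<not> int q ^ c dvd x"
  shows "inv_fourier n h x = of_real (mass x)"
proof -
  have r: "resolvent q f (p ^ a * k) = resolvent q (\<lambda>k. f (p ^ a * k)) k" for a k
    unfolding resolvent_def by (simp add: mult.left_commute)
  have "(\<lambda>a. inv_fourier n (\<lambda>k. resolvent q f (p ^ a * k)) x / of_nat p ^ a) sums inv_fourier n h x"
    unfolding h_def by (rule inv_fourier_resolvent_sums[OF n_pos resolvent_f_bounded pos_pq(1)])
  moreover have "inv_fourier n (\<lambda>k. resolvent q f (p ^ a * k)) x / of_nat p ^ a
      = of_real (\<Sum>i<4. odd_mass n (int p ^ a * (int q ^ dq i x * u i)) x / real p ^ a / real q ^ dq i x)" for a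
    unfolding r inv_fourier_resolvent_f[OF x(2)] by (simp add: sum_divide_distrib mult_ac)
  moreover have "(\<lambda>a. of_real (\<Sum>i<4. odd_mass n (int p ^ a * (int q ^ dq i x * u i)) x / real p ^ a / real q ^ dq i x)) sums
      complex_of_real (\<Sum>i<4. odd_mass n (int p ^ dp i x * (int q ^ dq i x * u i)) x / real p ^ dp i x / real q ^ dq i x)"
  proof (intro sums_of_real sums_sum sums_divide)
    fix i :: nat assume "i \<in> {..<4}"
    then have u: "u i \<noteq> 0" using u_nonzero by simp
    have d: "dp i x = multiplicity (int p) x - multiplicity (int p) (int q ^ dq i x * u i)"
      using multiplicity_mult_q[OF u] by (simp add: dp_def)
    show "(\<lambda>a. odd_mass n (int p ^ a * (int q ^ dq i x * u i)) x / real p ^ a) sums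
        (odd_mass n (int p ^ dp i x * (int q ^ dq i x * u i)) x / real p ^ dp i x)"
      unfolding d by (rule odd_mass_geometric_sums[OF p(1) _ x(1)]) (use u q in \<open>auto simp: n\<close>)
  qed
  ultimately have "inv_fourier n h x = complex_of_real (\<Sum>i<4. odd_mass n (int p ^ dp i x * (int q ^ dq i x * u i)) x / real p ^ dp i x / real q ^ dq i x)"
    using sums_unique2 by fastforce
  then show ?thesis by (simp add: mass_def D_def mult_ac)
qed

end

section \<open>Translates by the subgroups of order p and q\<close>

lemma odd_mass_neq_0:
  assumes "odd_mass n y x \<noteq> 0"
  obtains e :: int where "e = 1 \<or> e = -1" "int n dvd y - e * x" "odd_mass n y x = of_int e"
proof (cases "[y = x] (mod int n)")
  case True
  then have "odd_mass n y x = 1" using assms by (auto simp: odd_mass_def of_bool_def split: if_splits)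
  then show thesis using that[of 1] True by (simp add: cong_iff_dvd_diff)
next
  case False
  then have "[y = - x] (mod int n)" "odd_mass n y x = -1"
    using assms by (auto simp: odd_mass_def of_bool_def split: if_splits)
  then show thesis using that[of "-1"] by (simp add: cong_iff_dvd_diff)
qed

context half_sums
begin

lemma n_dvdD: "int n dvd x \<Longrightarrow> int p ^ b dvd x" "int n dvd x \<Longrightarrow> int q ^ c dvd x"
  by (simp_all only: n_dvd_iff)

lemma power_b: "int p ^ b = int p ^ (b - 1) * int p"
  using b by (cases b) simp_all

lemma n_div_p: "int (n div p) = int p ^ (b - 1) * int q ^ c"
proof -
  have "n = p * (p ^ (b - 1) * q ^ c)" using b by (cases b) (simp_all add: n)
  then have "n div p = p ^ (b - 1) * q ^ c" using p by simp
  then show ?thesis by simp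
qed

lemma power_dvd_shift:
  assumes "int n dvd int p * s"
  shows "int q ^ c dvd s" "int p ^ (b - 1) dvd s"
proof -
  have "coprime (int q ^ c) (int p)" using coprime_pq_powers[of 1 c] by (simp add: coprime_commute)
  then show "int q ^ c dvd s"
    using n_dvdD(2)[OF assms] coprime_dvd_mult_right_iff by blast
  have "int p ^ (b - 1) * int p dvd s * int p"
    using n_dvdD(1)[OF assms] unfolding power_b by (simp only: mult.commute)
  then show "int p ^ (b - 1) dvd s" using p by (simp only: dvd_times_right_cancel_iff)
qed

text \<open>\<open>s\<close> is a multiple of p^(b-1), so divisibility by powers below p^b is
  untouched, and by assumption neither number is divisible by p^b.\<close>

lemma multiplicity_shift:
  assumes s: "int n dvd int p * s" and x: "\<not> int p ^ b dvd x" "\<not> int p ^ b dvd x + s"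
  shows "multiplicity (int p) (x + s) = multiplicity (int p) x"
proof (rule multiplicity_cong)
  fix j
  show "int p ^ j dvd x + s \<longleftrightarrow> int p ^ j dvd x"
  proof (cases "j \<le> b - 1")
    case True
    then have "int p ^ j dvd s" using power_dvd_shift(2)[OF s] le_imp_power_dvd dvd_trans by blast
    then show ?thesis by (rule dvd_add_left_iff)
  next
    case False
    then have "int p ^ b dvd int p ^ j" by (intro le_imp_power_dvd) simp
    then show ?thesis using x dvd_trans by blast
  qed
qed

lemma multiplicity_shift':
  assumes s: "int n dvd int p * s" and x: "\<not> int q ^ c dvd x"
  shows "multiplicity (int q) (x + s) = multiplicity (int q) x"
proof (rule multiplicity_eq_of_cong[OF _ dvd_refl x])
  show "[x + s = x] (mod int q ^ c)"
    using power_dvd_shift(1)[OF s] by (simp add: cong_iff_dvd_diff)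
qed

lemma D_shift:
  assumes "int n dvd int p * s" "\<not> int p ^ b dvd x" "\<not> int q ^ c dvd x" "\<not> int p ^ b dvd x + s"
  shows "D i (x + s) = D i x"
  using multiplicity_shift[OF assms(1,2,4)] multiplicity_shift'[OF assms(1,3)]
  by (simp add: D_def dp_def dq_def)

lemma D_swap: "half_sums.D q p u i x = D i x"
  using half_sums.D_def[OF swap] half_sums.dp_def[OF swap] half_sums.dq_def[OF swap]
  by (simp add: D_def dp_def dq_def mult.commute)

lemma step_inj:
  assumes "int p ^ b dvd (int j - int k) * int (n div p)" "j < p" "k < p"
  shows "j = k"
proof -
  have "int p ^ (b - 1) * int p dvd int p ^ (b - 1) * ((int j - int k) * int q ^ c)"
    using assms(1) unfolding n_div_p power_b by (simp only: mult_ac)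
  then have "int p dvd (int j - int k) * int q ^ c" using p by simp
  moreover have "coprime (int p) (int q ^ c)" using coprime_pq_powers[of 1 c] by simp
  ultimately have "int p dvd int j - int k" using coprime_dvd_mult_left_iff by blast
  then show ?thesis
    using assms(2,3) zdvd_imp_le[of "int p" "int j - int k"] zdvd_imp_le[of "int p" "int k - int j"]
    by (simp add: dvd_diff_commute) (metis nat_neq_iff)
qed

lemma n_dvd_step: "int n dvd int p * (int j * int (n div p))"
proof -
  have "int p * (int j * int (n div p)) = int j * int n"
    unfolding n_div_p by (simp add: n power_b)
  then show ?thesis by (simp only: dvd_triv_right)
qed

lemma box:
  assumes "int n dvd int p * s" "int n dvd int q * t"
  shows "inv_fourier n h x - inv_fourier n h (x + s) - inv_fourier n h (x + t) + inv_fourier n h (x + s + t) = 0"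
  by (rule inv_fourier_box[OF n_pos h_eq_0 assms])

text \<open>Opposite signs would make y + z, one of 2x, 2x + s and 2(x + s), divisible by p^b; 2
  cancels because \<open>p\<close> is odd.\<close>

lemma not_both_signs:
  assumes y: "y = x \<or> y = x + s" and z: "z = x \<or> z = x + s"
    and x: "\<not> int p ^ b dvd x" "\<not> int p ^ b dvd x + s" "\<not> int p ^ b dvd 2 * x + s"
    and e: "e = 1 \<or> e = -1" "d = 1 \<or> d = (-1::int)"
    and dvd: "int p ^ b dvd w - e * y" "int p ^ b dvd w - d * z"
  shows "e = d"
proof (rule ccontr)
  assume "e \<noteq> d"
  then consider "e = 1" "d = -1" | "e = -1" "d = 1" using e by blast
  then have "int p ^ b dvd y + z"
  proof cases
    case 1
    then show ?thesis using dvd_diff[OF dvd(2,1)] by (simp add: add.commute)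
  next
    case 2
    then show ?thesis using dvd_diff[OF dvd(1,2)] by (simp add: add.commute)
  qed
  moreover have "x + x = 2 * x" "x + (x + s) = 2 * x + s" "(x + s) + x = 2 * x + s" "(x + s) + (x + s) = 2 * (x + s)"
    by simp_all
  ultimately show False using y z x two_dvd_cancel[of b x] two_dvd_cancel[of b "x + s"] by metis
qed

text \<open>Rows \<open>x\<close> and \<open>x + s\<close> of a box contain at most four of the points \<open>\<plusminus> D\<^sub>i u\<^sub>i\<close>, so with seven columns
  both vanish in some column.\<close>

lemma rows_eq:
  assumes q7: "q \<ge> 7" and s: "int n dvd int p * s"
    and x: "\<not> int p ^ b dvd x" "\<not> int q ^ c dvd x" "\<not> int p ^ b dvd x + s" "\<not> int p ^ b dvd 2 * x + s"
  shows "inv_fourier n h (x + s) = inv_fourier n h x"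
proof -
  define t where "t j = int j * int (n div q)" for j
  have t: "int n dvd int q * t j" for j
    unfolding t_def by (rule half_sums.n_dvd_step[OF swap])
  have pt: "int p ^ b dvd t j" for j using half_sums.power_dvd_shift(1)[OF swap t] .
  have qs: "int q ^ c dvd s" using power_dvd_shift(1)[OF s] .
  have inj: "j = k" if "int q ^ c dvd t j - t k" "j < q" "k < q" for j k
    using half_sums.step_inj[OF swap, of j k] that by (simp add: t_def left_diff_distrib)
  define w where "w i = int (D i x) * u i" for i
  define hit where "hit i j \<longleftrightarrow> (\<exists>e y. (e = 1 \<or> e = -1) \<and> (y = x \<or> y = x + s) \<and> int n dvd w i - e * (y + t j))" for i j
  \<comment> \<open>Index 4 is a fifth obstruction, the column in which \<open>x + t j\<close> is 0
    modulo q^c and the closed form fails. Five obstructions call for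
    \<open>q \<ge> 7\<close>.\<close>
  define H where "H i j \<longleftrightarrow> (if i = 4 then int q ^ c dvd x + t j else hit i j)" for i :: nat and j
  have "\<exists>j<q. \<forall>i<5. \<not> H i j"
  proof (rule exists_avoiding)
    fix i j k assume jk: "j < q" "k < q" "H i j" "H i k"
    show "j = k"
    proof (cases "i = 4")
      case True
      then have "int q ^ c dvd (x + t j) - (x + t k)" using jk by (intro dvd_diff) (simp_all add: H_def)
      then show ?thesis using inj jk by simp
    next
      case False
      obtain e y where e: "e = 1 \<or> e = -1" "y = x \<or> y = x + s" "int n dvd w i - e * (y + t j)"
        using jk(3) False unfolding H_def hit_def by auto
      obtain d z where d: "d = 1 \<or> d = -1" "z = x \<or> z = x + s" "int n dvd w i - d * (z + t k)"
        using jk(4) False unfolding H_def hit_def by auto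
      \<comment> \<open>Modulo p^b the column offset disappears, which fixes the sign; modulo q^c
        the row offset disappears, which then fixes the column.\<close>
      have "int p ^ b dvd (w i - e * (y + t j)) + e * t j" "int p ^ b dvd (w i - d * (z + t k)) + d * t k"
        by (intro dvd_add n_dvdD(1) e(3) d(3) dvd_mult pt)+
      then have "int p ^ b dvd w i - e * y" "int p ^ b dvd w i - d * z"
        by (simp_all add: algebra_simps)
      then have ed: "e = d" by (rule not_both_signs[OF e(2) d(2) x(1,3,4) e(1) d(1)])
      have yz: "int q ^ c dvd y - x" "int q ^ c dvd z - x" using e(2) d(2) qs by auto
      have "int q ^ c dvd (w i - d * (z + t k)) - (w i - e * (y + t j)) + (d * (z - x) - d * (y - x))"
        by (rule dvd_add[OF dvd_diff[OF n_dvdD(2)[OF d(3)] n_dvdD(2)[OF e(3)]]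
            dvd_diff[OF dvd_mult[OF yz(2)] dvd_mult[OF yz(1)]]])
      then have "int q ^ c dvd e * (t j - t k)" unfolding ed by (simp add: algebra_simps)
      then have "int q ^ c dvd t j - t k" using e(1) by (auto simp: dvd_diff_commute)
      then show ?thesis using inj jk by simp
    qed
  qed (use q7 in simp)
  then obtain j where j: "j < q" "\<And>i. i < 5 \<Longrightarrow> \<not> H i j" by blast
  have Q: "\<not> int q ^ c dvd x + t j" using j(2)[of 4] by (simp add: H_def)
  have nh: "\<not> hit i j" if "i < 4" for i using j(2)[of i] that by (simp add: H_def)
  have Dt: "D i (x + t j) = D i x" for i
    using half_sums.D_shift[OF swap t x(2,1) Q] by (simp add: D_swap)
  have P1: "\<not> int p ^ b dvd x + t j" "\<not> int p ^ b dvd x + s + t j"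
    using x pt[of j] by (simp_all add: dvd_add_left_iff)
  have Q1: "\<not> int q ^ c dvd x + s + t j"
    using Q qs by (metis add.assoc add.commute dvd_add_right_iff)
  have Dst: "D i (x + s + t j) = D i x" for i
    using D_shift[OF s P1(1) Q, of i] P1(2) Dt by (simp add: add_ac)
  have z: "odd_mass n (w i) (y + t j) = 0" if "i < 4" "y = x \<or> y = x + s" for i y
  proof (rule ccontr)
    assume "odd_mass n (w i) (y + t j) \<noteq> 0"
    then obtain e where "e = 1 \<or> e = -1" "int n dvd w i - e * (y + t j)" by (rule odd_mass_neq_0)
    then show False using nh[OF that(1)] that(2) unfolding hit_def by blast
  qed
  have "inv_fourier n h (x + t j) = 0"
    unfolding inv_fourier_h[OF P1(1) Q] mass_def Dt using z[of _ x] by (simp add: w_def)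
  moreover have "inv_fourier n h (x + s + t j) = 0"
    unfolding inv_fourier_h[OF P1(2) Q1] mass_def Dst using z[of _ "x + s"] by (simp add: w_def)
  ultimately show ?thesis using box[OF s t, of x j] by simp
qed

text \<open>If the rows \<open>x\<close> and \<open>x + s\<close> are opposite modulo p^b, a third
  row \<open>x + r j\<close> serves as an intermediate.\<close>

lemma rows_eq':
  assumes q7: "q \<ge> 7" and s: "int n dvd int p * s"
    and x: "\<not> int p ^ b dvd x" "\<not> int q ^ c dvd x" "\<not> int p ^ b dvd x + s"
  shows "inv_fourier n h (x + s) = inv_fourier n h x"
proof (cases "int p ^ b dvd 2 * x + s")
  case False
  then show ?thesis by (rule rows_eq[OF q7 s x])
next
  case True
  define r where "r j = int j * int (n div p)" for j
  have r: "int n dvd int p * r j" for j unfolding r_def by (rule n_dvd_step)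
  have inj: "j = k" if "int p ^ b dvd r j - r k" "j < p" "k < p" for j k
    using step_inj[of j k] that by (simp add: r_def left_diff_distrib)
  \<comment> \<open>The three conditions on the third row: it is nonzero modulo p^b, not opposite to
    \<open>x\<close>, and, since 2x + s vanishes modulo p^b, not opposite to
    \<open>x + s\<close>.\<close>
  define y where "y i = (if i = 0 then x else if i = 1 then 2 * x else 0)" for i :: nat
  have "\<exists>j<p. \<forall>i<3. \<not> int p ^ b dvd y i + r j"
  proof (rule exists_avoiding)
    fix i j k assume "j < p" "k < p" "int p ^ b dvd y i + r j" "int p ^ b dvd y i + r k"
    moreover from this have "int p ^ b dvd (y i + r j) - (y i + r k)" by (intro dvd_diff)
    ultimately show "j = k" using inj by simp
  qed (use p in simp)
  then obtain j where j: "\<And>i. i < 3 \<Longrightarrow> \<not> int p ^ b dvd y i + r j" by blast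
  have j': "\<not> int p ^ b dvd x + r j" "\<not> int p ^ b dvd 2 * x + r j" "\<not> int p ^ b dvd r j"
    using j[of 0] j[of 1] j[of 2] by (simp_all add: y_def)
  have 1: "inv_fourier n h (x + r j) = inv_fourier n h x"
    by (rule rows_eq[OF q7 r x(1,2) j'(1,2)])
  have "\<not> int q ^ c dvd x + r j"
    using x(2) power_dvd_shift(1)[OF r] by (simp add: dvd_add_left_iff)
  moreover have "int n dvd int p * (s - r j)" using dvd_diff[OF s r[of j]] by (simp add: right_diff_distrib)
  moreover have "\<not> int p ^ b dvd 2 * (x + r j) + (s - r j)"
  proof
    assume "int p ^ b dvd 2 * (x + r j) + (s - r j)"
    then have "int p ^ b dvd (2 * (x + r j) + (s - r j)) - (2 * x + s)" using True by (rule dvd_diff)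
    then show False using j'(3) by simp
  qed
  ultimately have "inv_fourier n h ((x + r j) + (s - r j)) = inv_fourier n h (x + r j)"
    using j'(1) x(3) by (intro rows_eq[OF q7]) auto
  then show ?thesis using 1 by simp
qed

text \<open>By \<open>rows_eq'\<close> the mass is constant along a column. If it is not 0, then the column contains exactly one
  point for each index \<open>i\<close>, all of the same mass, so that \<open>D (u\<^sub>1 + \<dots> + u\<^sub>4) = \<plusminus> 4 x\<close> modulo \<open>q\<^sup>c\<close>.\<close>

lemma mass_eq_0:
  assumes q7: "q \<ge> 7" and x: "\<not> int p ^ b dvd x" "\<not> int q ^ c dvd x"
  shows "mass x = 0"
proof (rule ccontr)
  assume nz: "mass x \<noteq> 0"
  define r where "r j = int j * int (n div p)" for j
  have r: "int n dvd int p * r j" for j unfolding r_def by (rule n_dvd_step)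
  have qr: "int q ^ c dvd r j" for j by (rule power_dvd_shift(1)[OF r])
  have inj: "j = k" if "int p ^ b dvd r j - r k" "j < p" "k < p" for j k
    using step_inj[of j k] that by (simp add: r_def left_diff_distrib)
  \<comment> \<open>The translates at which the closed form of the transform is available.\<close>
  define good where "good j \<longleftrightarrow> \<not> int p ^ b dvd x + r j" for j
  have Qr: "\<not> int q ^ c dvd x + r j" for j using x(2) qr[of j] by (simp add: dvd_add_left_iff)
  have Dr: "D i (x + r j) = D i x" if "good j" for i j
    using D_shift[OF r x] that by (simp add: good_def)
  have const: "mass (x + r j) = mass x" if "good j" for j
  proof -
    have g: "\<not> int p ^ b dvd x + r j" using that by (simp add: good_def)
    show ?thesis
      using rows_eq'[OF q7 r x g] unfolding inv_fourier_h[OF x] inv_fourier_h[OF g Qr] by simp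
  qed
  define w where "w i = int (D i x) * u i" for i
  define hit where "hit i j \<longleftrightarrow> odd_mass n (w i) (x + r j) \<noteq> 0" for i j
  have mass: "mass (x + r j) = (\<Sum>i<4. odd_mass n (w i) (x + r j) / real (D i x))" if "good j" for j
    using Dr[OF that] by (simp add: mass_def w_def)
  have hit_q: "\<exists>e. (e = 1 \<or> e = -1) \<and> int p ^ b dvd w i - e * (x + r j) \<and> int q ^ c dvd w i - e * x \<and> odd_mass n (w i) (x + r j) = of_int e"
    if hit: "hit i j" for i j
  proof -
    have "odd_mass n (w i) (x + r j) \<noteq> 0" using hit by (simp add: hit_def)
    then obtain e :: int where e: "e = 1 \<or> e = -1" "int n dvd w i - e * (x + r j)" "odd_mass n (w i) (x + r j) = of_int e"
      by (rule odd_mass_neq_0)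
    have "int q ^ c dvd (w i - e * (x + r j)) + e * r j"
      by (intro dvd_add n_dvdD(2) e(2) dvd_mult qr)
    moreover have "(w i - e * (x + r j)) + e * r j = w i - e * x" by (simp add: algebra_simps)
    ultimately show ?thesis using e n_dvdD(1)[OF e(2)] by auto
  qed
  have hit_inj: "j = k" if hits: "hit i j" "hit i k" and "j < p" "k < p" for i j k
  proof -
    obtain e where e: "e = 1 \<or> e = -1" "int p ^ b dvd w i - e * (x + r j)" "int q ^ c dvd w i - e * x"
      using hit_q[OF hits(1)] by blast
    obtain d where d: "d = 1 \<or> d = -1" "int p ^ b dvd w i - d * (x + r k)" "int q ^ c dvd w i - d * x"
      using hit_q[OF hits(2)] by blast
    have q2: "\<not> int q ^ c dvd 2 * x" using half_sums.two_dvd_cancel[OF swap] x(2) by simp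
    \<comment> \<open>The offsets \<open>r j\<close> vanish modulo q^c, so the sign is decided
      there; the translate is then decided modulo p^b.\<close>
    have "e = d"
      by (rule half_sums.not_both_signs[OF swap, where x = x and y = x and z = x and s = 0 and w = "w i"])
        (use x(2) q2 e d in auto)
    then have "int p ^ b dvd (w i - e * (x + r k)) - (w i - e * (x + r j))"
      using e d by (intro dvd_diff[of _ "w i - e * (x + r k)"]) auto
    then have "int p ^ b dvd e * (r j - r k)" by (simp add: algebra_simps)
    then have "int p ^ b dvd r j - r k" using e(1) by (auto simp: dvd_diff_commute)
    then show ?thesis using inj that by simp
  qed
  have bad_inj: "j = k" if "\<not> good j" "\<not> good k" "j < p" "k < p" for j k
  proof -
    have "int p ^ b dvd (x + r j) - (x + r k)" using that by (intro dvd_diff) (auto simp: good_def)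
    then show ?thesis using inj that by simp
  qed
  have others: "\<exists>j<p. good j \<and> (\<forall>i<4. i \<noteq> k \<longrightarrow> \<not> hit i j)" if "k < 4" for k
  proof -
    \<comment> \<open>Slot \<open>k\<close> is free and records the bad translate: three points and
      one bad translate against \<open>p \<ge> 5\<close>. In the translate found, only index
      \<open>k\<close> can contribute to the mass.\<close>
    define H where "H i j \<longleftrightarrow> (if i = k then \<not> good j else hit i j)" for i j
    have "\<exists>j<p. \<forall>i<4. \<not> H i j"
    proof (rule exists_avoiding)
      fix i j l assume "j < p" "l < p" "H i j" "H i l"
      then show "j = l" using hit_inj[of i j l] bad_inj[of j l] by (cases "i = k") (simp_all add: H_def)
    qed (use p in simp)
    then obtain j where j: "j < p" "\<And>i. i < 4 \<Longrightarrow> \<not> H i j" by blast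
    have "good j" using j(2)[OF that] by (simp add: H_def)
    moreover have "\<not> hit i j" if "i < 4" "i \<noteq> k" for i using j(2)[OF that(1)] that by (simp add: H_def)
    ultimately show ?thesis using j(1) by blast
  qed
  have single: "\<exists>e. (e = 1 \<or> e = -1) \<and> int q ^ c dvd w k - e * x \<and> mass x = of_int e / real (D k x)" if k: "k < 4" for k
  proof -
    obtain j where j: "j < p" "good j" "\<And>i. i < 4 \<Longrightarrow> i \<noteq> k \<Longrightarrow> \<not> hit i j" using others[OF k] by blast
    have "mass x = (\<Sum>i<4. odd_mass n (w i) (x + r j) / real (D i x))"
      using mass[OF j(2)] const[OF j(2)] by simp
    also have "\<dots> = (\<Sum>i\<in>{k}. odd_mass n (w i) (x + r j) / real (D i x))"
      by (rule sum.mono_neutral_right) (use k j(3) in \<open>auto simp: hit_def\<close>)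
    finally have m: "mass x = odd_mass n (w k) (x + r j) / real (D k x)" by simp
    then have "hit k j" using nz by (auto simp: hit_def)
    then show ?thesis using hit_q[of k j] m by auto
  qed
  have Dpos: "real (D i x) > 0" for i using p q by (simp add: D_def)
  obtain e where e: "e = 1 \<or> e = -1" "mass x = of_int e / real (D 0 x)" using single[of 0] by auto
  have all: "D k x = D 0 x \<and> int q ^ c dvd w k - e * x" if k: "k < 4" for k
  proof -
    obtain d where d: "d = 1 \<or> d = -1" "int q ^ c dvd w k - d * x" "mass x = of_int d / real (D k x)"
      using single[OF k] by blast
    have "of_int d / real (D k x) = of_int e / real (D 0 x)" using d e by simp
    then have eq: "real_of_int d * real (D 0 x) = of_int e * real (D k x)"
      using Dpos[of 0] Dpos[of k] by (simp add: field_simps)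
    \<comment> \<open>Both quotients equal \<open>mass x\<close> and their denominators are
      positive, so the signs agree, and then the multipliers agree too.\<close>
    have "d = e"
    proof (rule ccontr)
      assume "d \<noteq> e"
      then have "real_of_int d = - of_int e" using d(1) e(1) by auto
      then have "of_int e * (real (D 0 x) + real (D k x)) = 0" using eq by (simp add: algebra_simps)
      then show False using Dpos[of 0] Dpos[of k] e(1) by auto
    qed
    then show ?thesis using eq d e by auto
  qed
  have "int q ^ c dvd (\<Sum>k<4. w k - e * x)" by (rule dvd_sum) (use all in blast)
  also have "(\<Sum>k<4. w k - e * x) = (\<Sum>k<4. int (D 0 x) * u k - e * x)"
  proof (rule sum.cong)
    fix k :: nat assume "k \<in> {..<4}"
    then have "D k x = D 0 x" using all[of k] by (simp only: lessThan_iff)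
    then show "w k - e * x = int (D 0 x) * u k - e * x" by (simp add: w_def)
  qed simp
  also have "\<dots> = int (D 0 x) * (\<Sum>k<4. u k) - 2 * (2 * (e * x))"
    by (simp add: sum_subtractf sum_distrib_left)
  finally have "int q ^ c dvd int (D 0 x) * (\<Sum>k<4. u k) - (int (D 0 x) * (\<Sum>k<4. u k) - 2 * (2 * (e * x)))"
    by (rule dvd_diff[OF dvd_mult[OF n_dvdD(2)[OF zero]]])
  then have "int q ^ c dvd 2 * (2 * (e * x))" by (simp only: diff_diff_eq2 add_diff_cancel_left')
  then have "int q ^ c dvd e * x" by (simp only: half_sums.two_dvd_cancel[OF swap])
  then show False using x(2) e(1) by auto
qed

end

section \<open>From vanishing masses to a pair with sum 0\<close>

context half_sums
begin

text \<open>Index \<open>i\<close> contributes exactly 1. Another index with multiplier 1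
  contributes a negative amount only if \<open>u j + u i\<close> is 0 modulo \<open>n\<close>, and
  one with multiplier at least 5 loses at most 1/5, so the sum is at least 1 - 3/5.\<close>

lemma sum_odd_mass_pos:
  assumes i: "i < 4" and d: "\<And>j. d j = 1 \<or> d j \<ge> (5::nat)" "d i = 1"
    and no_pair: "\<And>j. j < 4 \<Longrightarrow> j \<noteq> i \<Longrightarrow> \<not> int n dvd u j + u i"
  shows "(\<Sum>j<4. odd_mass n (int (d j) * u j) (u i) / real (d j)) > 0"
proof -
  let ?T = "\<lambda>j. odd_mass n (int (d j) * u j) (u i) / real (d j)"
  have "\<not> int n dvd 2 * u i"
    using nonzero[OF i] odd_n coprime_dvd_mult_right_iff[of "int n" 2 "u i"] by simp
  moreover have "u i - - u i = 2 * u i" by simp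
  ultimately have "\<not> [u i = - u i] (mod int n)" by (simp only: cong_iff_dvd_diff not_False_eq_True)
  then have Ti: "?T i = 1" using d(2) by (simp add: odd_mass_def)
  have T: "?T j \<ge> - (1 / 5)" if "j \<in> {..<4} - {i}" for j
  proof (cases "d j = 1")
    case True
    have "\<not> [u j = - u i] (mod int n)" using no_pair[of j] that by (simp add: cong_iff_dvd_diff)
    then have "odd_mass n (u j) (u i) \<ge> 0" by (simp add: odd_mass_def)
    then show ?thesis using True by simp
  next
    case False
    then have d5: "real (d j) \<ge> 5" using d(1)[of j] by simp
    have "odd_mass n (int (d j) * u j) (u i) \<ge> - 1" by (simp add: odd_mass_def of_bool_def)
    then have "?T j \<ge> - 1 / real (d j)" using d5 by (intro divide_right_mono) auto
    moreover have "1 / real (d j) \<le> 1 / 5" using d5 by (intro divide_left_mono) auto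
    ultimately show ?thesis by simp
  qed
  have S: "(\<Sum>j<4. ?T j) = ?T i + (\<Sum>j\<in>{..<4} - {i}. ?T j)" using i by (intro sum.remove) auto
  have "(\<Sum>j\<in>{..<4} - {i}. - (1 / 5)) \<le> (\<Sum>j\<in>{..<4} - {i}. ?T j)" by (rule sum_mono) (rule T)
  moreover have "(\<Sum>j\<in>{..<4} - {i}. - (1 / 5)) = - (3 / 5 :: real)" using i by simp
  ultimately show ?thesis unfolding S Ti by linarith
qed

lemma power_eq_1_or_ge_5: "q ^ j = 1 \<or> q ^ j \<ge> 5"
proof (cases j)
  case (Suc k)
  then have "q \<le> q ^ j" using q by simp
  then show ?thesis using q by linarith
qed simp

text \<open>At the point \<open>u i\<close> itself the multiplier of index \<open>i\<close> is 1 and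
  the others are 1 or at least 5. Without a pair the mass there would be positive, against
  \<open>mass_eq_0\<close>.\<close>

lemma pair_of_unit:
  assumes "q \<ge> 7" and i: "i < 4" and "\<not> int p ^ b dvd u i" "\<not> int q ^ c dvd u i"
  shows "\<exists>j<4. j \<noteq> i \<and> int n dvd u j + u i"
proof (rule ccontr)
  assume "\<not> ?thesis"
  then have no_pair: "\<And>j. j < 4 \<Longrightarrow> j \<noteq> i \<Longrightarrow> \<not> int n dvd u j + u i" by blast
  have "D j (u i) = 1 \<or> D j (u i) \<ge> 5" for j
  proof (cases "p ^ dp j (u i) = 1")
    case True
    then show ?thesis using power_eq_1_or_ge_5[of "dq j (u i)"] unfolding D_def True mult_1 by blast
  next
    case False
    then have "p ^ dp j (u i) \<ge> 5" using half_sums.power_eq_1_or_ge_5[OF swap] by blast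
    moreover have "q ^ dq j (u i) \<ge> 1" using q by simp
    ultimately show ?thesis unfolding D_def by (metis mult_le_mono mult.right_neutral)
  qed
  moreover have "D i (u i) = 1" by (simp add: D_def dp_def dq_def)
  ultimately have "mass (u i) > 0"
    unfolding mass_def by (intro sum_odd_mass_pos[OF i _ _ no_pair])
  then show False using mass_eq_0 assms by simp
qed

context
  assumes u_p: "\<And>i. i < 4 \<Longrightarrow> int p ^ b dvd u i"
begin

lemma f_periodic_q: "f (k + q ^ c * m) = f k"
proof (rule f_cong)
  fix i :: nat assume "i < 4"
  have "int n dvd u i * int (q ^ c)"
    using mult_dvd_mono[OF u_p[OF \<open>i < 4\<close>] dvd_refl[of "int (q ^ c)"]] by (simp add: n)
  then have "int n dvd u i * int (q ^ c) * int m" by (rule dvd_mult2)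
  then show "[int (k + q ^ c * m) * u i = int k * u i] (mod int n)"
    by (simp add: cong_iff_dvd_diff algebra_simps)
qed

lemma h_periodic_q: "h (k + q ^ c) = h k"
proof -
  have "f (q ^ j * (p ^ i * (k + q ^ c))) = f (q ^ j * (p ^ i * k))" for i j
    using f_periodic_q[of "q ^ j * (p ^ i * k)" "q ^ j * p ^ i"] by (simp add: algebra_simps)
  then show ?thesis unfolding h_def resolvent_def by simp
qed

text \<open>Here \<open>h\<close> depends only on \<open>k\<close> modulo q^c, and adding q^c to a
  multiple of \<open>p\<close> prime to \<open>q\<close> produces a unit: vanishing on units spreads
  to all indices prime to \<open>q\<close>.\<close>

lemma h_eq_0_q:
  assumes k: "\<not> q dvd k"
  shows "h k = 0"
proof (cases "p dvd k")
  case True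
  have "\<not> p dvd q" using p(1) q(1) pq primes_dvd_imp_eq by blast
  then have "\<not> p dvd q ^ c" using p(1) prime_dvd_power by blast
  then have "\<not> p dvd k + q ^ c" using True by (simp add: dvd_add_right_iff)
  moreover have "\<not> q dvd k + q ^ c" using k c by (simp add: dvd_add_left_iff)
  ultimately have "h (k + q ^ c) = 0" by (rule h_eq_0)
  then show ?thesis by (simp add: h_periodic_q)
qed (use k h_eq_0 in blast)

lemma resolvent_f_eq_0:
  assumes k: "\<not> q dvd k"
  shows "resolvent q f k = 0"
proof -
  have "\<not> q dvd p" using p(1) q(1) pq primes_dvd_imp_eq by blast
  then have "\<not> q dvd p * k" using k q(1) by (simp add: prime_dvd_mult_iff)
  then have "h k - h (p * k) / of_nat p = 0" using h_eq_0_q k by simp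
  then show ?thesis
    using resolvent_step[OF resolvent_f_bounded pos_pq(1), where k = k] by (simp add: h_def)
qed

text \<open>Each \<open>u i\<close> is 0 modulo p^b, so the transform \<open>N\<close> of
  \<open>resolvent q f\<close> replaces \<open>mass\<close>. It is invariant under translation by
  n/q because \<open>resolvent q f\<close> lives on multiples of \<open>q\<close>. Without a pair it
  is positive at \<open>u 0\<close>, yet some translate meets none of the positive masses.\<close>

lemma pair_of_multiples: "\<exists>j<4. j \<noteq> 0 \<and> int n dvd u j + u 0"
proof (rule ccontr)
  assume "\<not> ?thesis"
  then have no_pair: "\<And>j. j < 4 \<Longrightarrow> j \<noteq> 0 \<Longrightarrow> \<not> int n dvd u j + u 0" by blast
  define N where "N x = inv_fourier n (resolvent q f) x" for x
  define t where "t j = int j * int (n div q)" for j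
  have t: "int n dvd int q * t j" for j
    unfolding t_def by (rule half_sums.n_dvd_step[OF swap])
  have pt: "int p ^ b dvd t j" for j using half_sums.power_dvd_shift(1)[OF swap t] .
  have inj: "j = k" if "int q ^ c dvd t j - t k" "j < q" "k < q" for j k
    using half_sums.step_inj[OF swap, of j k] that by (simp add: t_def left_diff_distrib)
  have shift: "N (x + t j) = N x" for x j
    unfolding N_def by (rule inv_fourier_shift[OF n_pos resolvent_f_eq_0 t])
  have N: "N x = of_real (\<Sum>i<4. odd_mass n (int (q ^ dq i x) * u i) x / real (q ^ dq i x))"
    if "\<not> int q ^ c dvd x" for x
    using inv_fourier_resolvent_f[OF that, of 0] by (simp add: N_def)
  have Q0: "\<not> int q ^ c dvd u 0" using nonzero[of 0] u_p[of 0] n_dvd_iff by simp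
  have "(\<Sum>i<4. odd_mass n (int (q ^ dq i (u 0)) * u i) (u 0) / real (q ^ dq i (u 0))) > 0"
    by (rule sum_odd_mass_pos[OF _ power_eq_1_or_ge_5 _ no_pair]) (simp_all add: dq_def)
  then obtain r where r: "r > 0" "N (u 0) = complex_of_real r" using N[OF Q0] by blast
  \<comment> \<open>A translate divisible by q^c would be 0 modulo \<open>n\<close>, where the
    transform of an odd function vanishes. So no column is lost, and four obstructions stand against
    \<open>q \<ge> 5\<close>.\<close>
  have Q: "\<not> int q ^ c dvd u 0 + t j" for j
  proof
    assume "int q ^ c dvd u 0 + t j"
    moreover have "int p ^ b dvd u 0 + t j" using u_p[of 0] pt by simp
    ultimately have "[u 0 + t j = 0] (mod int n)" by (simp add: cong_0_iff n_dvd_iff)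
    then have "N (u 0 + t j) = N 0" unfolding N_def by (rule inv_fourier_cong[OF n_pos])
    also have "N 0 = (\<Sum>k<n. resolvent q f k) / of_nat n"
      by (simp add: N_def inv_fourier_def unity_root_def)
    also have "(\<Sum>k<n. resolvent q f k) = 0"
      by (rule odd_sum_eq_0) (rule resolvent_odd[OF f_bounded pos_pq(2) f_odd])
    finally show False using shift r by simp
  qed
  define w where "w i = int (q ^ dq i (u 0)) * u i" for i
  \<comment> \<open>Only positive masses are avoided: a value at most 0 already contradicts
    \<open>r > 0\<close>.\<close>
  define hit where "hit i j \<longleftrightarrow> int n dvd w i - (u 0 + t j)" for i j
  have "\<exists>j<q. \<forall>i<4. \<not> hit i j"
  proof (rule exists_avoiding)
    fix i j k assume "j < q" "k < q" "hit i j" "hit i k"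
    moreover from this have "int n dvd (w i - (u 0 + t k)) - (w i - (u 0 + t j))"
      unfolding hit_def by (intro dvd_diff[of _ "w i - (u 0 + t k)"])
    then have "int q ^ c dvd t j - t k" using n_dvdD(2) by simp
    ultimately show "j = k" using inj by blast
  qed (use q in simp)
  then obtain j where j: "\<And>i. i < 4 \<Longrightarrow> \<not> hit i j" by blast
  have "dq i (u 0 + t j) = dq i (u 0)" for i
    using half_sums.multiplicity_shift[OF swap t Q0 Q] by (simp add: dq_def)
  then have "complex_of_real r = of_real (\<Sum>i<4. odd_mass n (w i) (u 0 + t j) / real (q ^ dq i (u 0)))"
    using N[OF Q[of j]] shift r by (simp add: w_def)
  then have "r = (\<Sum>i<4. odd_mass n (w i) (u 0 + t j) / real (q ^ dq i (u 0)))" by (simp only: of_real_eq_iff)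
  also have "\<dots> \<le> (\<Sum>i<4::nat. 0)"
  proof (rule sum_mono)
    fix i :: nat assume "i \<in> {..<4}"
    then have "\<not> [w i = u 0 + t j] (mod int n)" using j[of i] by (simp add: hit_def cong_iff_dvd_diff)
    then have "odd_mass n (w i) (u 0 + t j) \<le> 0" by (simp add: odd_mass_def)
    then show "odd_mass n (w i) (u 0 + t j) / real (q ^ dq i (u 0)) \<le> 0"
      by (intro divide_nonpos_nonneg) auto
  qed
  finally show False using r by simp
qed

end

text \<open>Modulo q^c the terms outside \<open>A\<close> vanish, and so does the total; hence the
  sum over \<open>A\<close> is 0 modulo both prime powers.\<close>

lemma subset_sums:
  assumes A: "A \<subseteq> {..<4}" "\<And>i. i \<in> A \<Longrightarrow> int p ^ b dvd u i" "\<And>i. i \<in> {..<4} - A \<Longrightarrow> int q ^ c dvd u i"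
  shows "int n dvd (\<Sum>i\<in>A. u i)" "int n dvd (\<Sum>i\<in>{..<4} - A. u i)"
proof -
  have e: "(\<Sum>i<4. u i) = (\<Sum>i\<in>{..<4} - A. u i) + (\<Sum>i\<in>A. u i)"
    by (rule sum.subset_diff[OF A(1)]) simp
  have pA: "int p ^ b dvd (\<Sum>i\<in>A. u i)" and qB: "int q ^ c dvd (\<Sum>i\<in>{..<4} - A. u i)"
    using A by (auto intro!: dvd_sum)
  have "int q ^ c dvd (\<Sum>i\<in>{..<4} - A. u i) + (\<Sum>i\<in>A. u i)"
    using n_dvdD(2)[OF zero] unfolding e .
  then have "int q ^ c dvd (\<Sum>i\<in>A. u i)" using dvd_add_right_iff[OF qB] by blast
  then show A: "int n dvd (\<Sum>i\<in>A. u i)" using pA n_dvd_iff by blast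
  show "int n dvd (\<Sum>i\<in>{..<4} - A. u i)"
    using zero unfolding e dvd_add_left_iff[OF A] .
qed

text \<open>If no \<open>u i\<close> is nonzero modulo both prime powers, \<open>A\<close> collects
  those divisible by p^b. A single element in \<open>A\<close> or in its complement would be
  divisible by \<open>n\<close>; two elements form the pair; an empty or full \<open>A\<close> is
  the case of multiples of one prime power.\<close>

lemma pair_7:
  assumes q7: "q \<ge> 7"
  shows "\<exists>i<4. \<exists>j<4. i \<noteq> j \<and> int n dvd u i + u j"
proof (cases "\<exists>i<4. \<not> int p ^ b dvd u i \<and> \<not> int q ^ c dvd u i")
  case True
  then show ?thesis using pair_of_unit[OF q7] by blast
next
  case False
  define A where "A = {i. i < (4::nat) \<and> int p ^ b dvd u i}"
  have A: "A \<subseteq> {..<4}" by (auto simp: A_def)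
  have in_A: "int p ^ b dvd u i" if "i \<in> A" for i using that by (simp add: A_def)
  have in_B: "int q ^ c dvd u i" if "i \<in> {..<4} - A" for i using that False by (auto simp: A_def)
  note sums = subset_sums[OF A in_A in_B]
  have "finite A" using A finite_subset by blast
  have card: "card ({..<4} - A) = 4 - card A" using A \<open>finite A\<close> by (simp add: card_Diff_subset)
  have "card A \<le> 4" using card_mono[OF _ A] by simp
  then consider "card A = 0" | "card A = 1" | "card A = 2" | "card ({..<4} - A) = 1" | "card A = 4"
    unfolding card by linarith
  then show ?thesis
  proof cases
    case 1
    then have "A = {}" using \<open>finite A\<close> by simp
    then have "\<exists>j<4. j \<noteq> 0 \<and> int n dvd u j + u 0"
      using in_B by (intro half_sums.pair_of_multiples[OF swap]) auto
    then show ?thesis by (metis zero_less_numeral)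
  next
    case 2
    then obtain i where "A = {i}" using card_1_singletonE by blast
    then show ?thesis using sums(1) nonzero[of i] A by simp
  next
    case 3
    then obtain i j where "A = {i, j}" "i \<noteq> j" by (metis card_2_iff)
    then show ?thesis using sums(1) A by auto
  next
    case 4
    then obtain i where i: "{..<4} - A = {i}" using card_1_singletonE by blast
    then have "i < 4" by auto
    then show ?thesis using sums(2) nonzero[of i] unfolding i by simp
  next
    case 5
    then have "A = {..<4}" using A card_subset_eq[of "{..<4}" A] by simp
    then have "\<exists>j<4. j \<noteq> 0 \<and> int n dvd u j + u 0"
      using in_A by (intro pair_of_multiples) auto
    then show ?thesis by (metis zero_less_numeral)
  qed
qed

theorem pair: "\<exists>i<4. \<exists>j<4. i \<noteq> j \<and> int n dvd u i + u j"
proof -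
  \<comment> \<open>With 6 ruled out, the larger of two distinct primes from 5 on is at least
    7.\<close>
  have "\<not> Factorial_Ring.prime (6::nat)"
  proof
    assume "Factorial_Ring.prime (6::nat)"
    then have "\<forall>m. m dvd (6::nat) \<longrightarrow> m = 1 \<or> m = 6" unfolding prime_nat_iff by blast
    from this[rule_format, of 2] show False by simp
  qed
  then have "p \<noteq> 6" "q \<noteq> 6" using p q by auto
  then consider "q \<ge> 7" | "p \<ge> 7" using p(2) q(2) pq by linarith
  then show ?thesis using pair_7 half_sums.pair_7[OF swap] by cases blast+
qed

end

text \<open>No residue is 0, so the residue sum is a multiple of \<open>n\<close> strictly between 0
  and \<open>4 * n\<close>. Multiplication by n - 1, that is by -1, exchanges \<open>n\<close> and
  \<open>3 * n\<close>; if \<open>n\<close> never occurs, only \<open>2 * n\<close> remains.\<close>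

theorem exists_multiplier:
  fixes p q b c n :: nat and u :: "nat \<Rightarrow> int"
  assumes p: "Factorial_Ring.prime p" "p \<ge> 5" and q: "Factorial_Ring.prime q" "q \<ge> 5" and pq: "p \<noteq> q"
    and b: "b \<ge> 1" and c: "c \<ge> 1" and n: "n = p ^ b * q ^ c"
    and nonzero: "\<And>i. i < 4 \<Longrightarrow> \<not> int n dvd u i"
    and zero: "int n dvd (\<Sum>i<4. u i)"
    and no_pair: "\<And>i j. i < 4 \<Longrightarrow> j < 4 \<Longrightarrow> i \<noteq> j \<Longrightarrow> \<not> int n dvd u i + u j"
  shows "\<exists>k. coprime k n \<and> (\<Sum>i<4. int k * u i mod int n) = int n"
proof (rule ccontr)
  assume none: "\<not> ?thesis"
  have n1: "n > 1"
    using n p q b c by (metis One_nat_def less_1_mult one_less_power prime_gt_1_nat less_le_trans zero_less_one Suc_le_eq)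
  define R where "R g = (\<Sum>i<4. int g * u i mod int n)" for g :: nat
  have nz: "int g * u i mod int n \<noteq> 0" if "coprime g n" "i < 4" for g i
    using nonzero[OF that(2)] that(1) coprime_dvd_mult_right_iff[of "int n" "int g" "u i"]
    by (simp add: coprime_commute dvd_eq_mod_eq_0[symmetric])
  have neg: "R (g * (n - 1)) = 4 * int n - R g" if g: "coprime g n" for g
  proof -
    have "int (g * (n - 1)) * u i mod int n = int n - int g * u i mod int n" if "i < 4" for i
    proof -
      have e: "int (g * (n - 1)) * u i = - (int g * u i) + int g * u i * int n"
        using n1 by (simp add: of_nat_diff algebra_simps)
      have "int (g * (n - 1)) * u i mod int n = - (int g * u i) mod int n"
        unfolding e by (rule mod_mult_self1)
      then show ?thesis using nz[OF g that] by (simp add: zmod_zminus1_eq_if)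
    qed
    then have "R (g * (n - 1)) = (\<Sum>i<4. int n - int g * u i mod int n)"
      unfolding R_def by (intro sum.cong) auto
    then show ?thesis by (simp add: R_def sum_subtractf)
  qed
  have "R g = 2 * int n" if g: "coprime g n" for g
  proof -
    have pos: "0 < int g * u i mod int n" "int g * u i mod int n < int n" if "i < 4" for i
      using nz[OF g that] n1 pos_mod_bound[of "int n" "int g * u i"] pos_mod_sign[of "int n" "int g * u i"]
      by linarith+
    have "R g > 0" unfolding R_def by (rule sum_pos) (use pos in \<open>auto simp: lessThan_empty_iff\<close>)
    moreover have "R g < (\<Sum>i<4::nat. int n)" unfolding R_def
      by (rule sum_strict_mono) (use pos in \<open>auto simp: lessThan_empty_iff\<close>)
    moreover have "int n dvd R g"
    proof -
      have "R g mod int n = (int g * (\<Sum>i<4. u i)) mod int n"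
        unfolding R_def by (simp add: mod_sum_eq sum_distrib_left)
      moreover have "int n dvd int g * (\<Sum>i<4. u i)" using zero by (rule dvd_mult)
      ultimately show ?thesis by (simp only: dvd_eq_mod_eq_0)
    qed
    ultimately have R: "R g > 0" "R g < 4 * int n" "int n dvd R g" by simp_all
    from R(3) obtain m where m: "R g = int n * m" ..
    have "int n * 0 < int n * m" "int n * m < int n * 4"
      using R(1,2) unfolding m by (simp, simp only: mult.commute)
    then have "0 < m" "m < 4" using n1 by (simp_all only: mult_less_cancel_left_pos of_nat_0_less_iff)
    moreover have "m \<noteq> 1" using none g m by (auto simp: R_def)
    moreover have "m \<noteq> 3"
    proof
      assume "m = 3"
      then have "R (g * (n - 1)) = int n" using neg[OF g] m by simp
      moreover have "coprime (n - 1) n"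
        using n1 coprime_Suc_right_nat[of "n - 1"] by simp
      then have "coprime (g * (n - 1)) n" using g by simp
      ultimately show False using none unfolding R_def by blast
    qed
    ultimately show ?thesis using m by simp
  qed
  then have "half_sums p q b c n u"
    using assms by unfold_locales (auto simp: R_def)
  then show False using half_sums.pair no_pair by blast
qed

section \<open>The index\<close>

lemma (in comm_monoid) seq_sum_eq:
  assumes "finite A" "set_mset M \<subseteq> A" "A \<subseteq> carrier G"
  shows "seq_sum G M = finprod G (\<lambda>x. x [^] count M x) A"
  unfolding seq_sum_def
  by (rule finprod_mono_neutral_cong_left) (use assms in \<open>auto simp: not_in_iff\<close>)

lemma (in comm_monoid) seq_sum_add_mset:
  assumes "set_mset M \<subseteq> carrier G" "a \<in> carrier G"
  shows "seq_sum G (add_mset a M) = a \<otimes> seq_sum G M"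
proof -
  let ?A = "insert a (set_mset M)"
  have A: "finite ?A" "?A \<subseteq> carrier G" using assms by auto
  have "seq_sum G (add_mset a M) = finprod G (\<lambda>x. x [^] count (add_mset a M) x) ?A"
    using A by (intro seq_sum_eq) auto
  also have "\<dots> = finprod G (\<lambda>x. (if a = x then x else \<one>) \<otimes> x [^] count M x) ?A"
  proof (rule finprod_cong')
    fix x assume "x \<in> ?A"
    then have "x \<in> carrier G" using A by auto
    then show "x [^] count (add_mset a M) x = (if a = x then x else \<one>) \<otimes> x [^] count M x"
      using nat_pow_Suc2[of x "count M x"] by auto
  qed (use A in auto)
  also have "\<dots> = finprod G (\<lambda>x. if a = x then x else \<one>) ?A \<otimes> finprod G (\<lambda>x. x [^] count M x) ?A"
    by (rule finprod_multf) (use A in auto)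
  also have "finprod G (\<lambda>x. if a = x then x else \<one>) ?A = a"
    by (rule finprod_singleton) (use A in auto)
  also have "finprod G (\<lambda>x. x [^] count M x) ?A = seq_sum G M"
    using A by (intro seq_sum_eq[symmetric]) auto
  finally show ?thesis .
qed

section \<open>Norms with respect to a generator\<close>

context group
begin

context
  fixes g :: 'a
  assumes g: "g \<in> carrier G" "generate G {g} = carrier G" and fin: "order G > 0"
begin

lemma generator_comm_group: "comm_group G"
proof (rule cyclic_imp_abelian_group)
  have "carrier G = {g [^] (k :: int) | k. k \<in> UNIV}"
    using generate_pow[OF g(1)] g(2) by simp
  then have "carrier G = range (\<lambda>k::int. g [^] k)" by blast
  then show "cyclic_group G" using g(1) cyclic_group by blast
qed

lemma ord_generator: "ord g = order G"
  using generate_pow_card[OF g(1)] g(2) by (simp add: order_def)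

lemma generator_pow_eq_iff: "g [^] (x::int) = g [^] (y::int) \<longleftrightarrow> [x = y] (mod int (order G))"
  unfolding int_pow_eq[OF g(1)] ord_generator cong_iff_dvd_diff by (rule dvd_diff_commute)

lemma seq_sum_pow: "seq_sum G (image_mset (\<lambda>x::int. g [^] x) M) = g [^] (\<Sum>x\<in>#M. x)"
proof (induction M)
  case empty
  interpret comm_group G by (rule generator_comm_group)
  show ?case by (simp add: seq_sum_def)
next
  case (add x M)
  interpret comm_group G by (rule generator_comm_group)
  show ?case
    using add g by (simp add: seq_sum_add_mset image_subset_iff int_pow_mult)
qed

lemma zero_sum_pow_iff:
  "zero_sum G (image_mset (\<lambda>x::int. g [^] x) M) \<longleftrightarrow> int (order G) dvd (\<Sum>x\<in>#M. x)"
  using g int_pow_eq_id[OF g(1)] by (auto simp: zero_sum_def seq_sum_pow ord_generator)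

lemma seq_coeff_generator:
  assumes "x \<in> carrier G"
  shows "1 \<le> seq_coeff G g x" "seq_coeff G g x \<le> order G" "x = g [^] seq_coeff G g x"
proof -
  obtain i :: int where i: "x = g [^] i"
    using assms g generate_pow[OF g(1)] by auto
  define r where "r = nat (i mod int (order G))"
  have r: "int r = i mod int (order G)" using fin by (simp add: r_def)
  \<comment> \<open>The residue 0 is represented by \<open>order G\<close>, since coefficients start
    at 1.\<close>
  define k where "k = (if r = 0 then order G else r)"
  have k: "1 \<le> k" "k \<le> order G" "x = g [^] k"
  proof -
    have "r < order G" using r fin by (metis of_nat_0_less_iff of_nat_less_iff pos_mod_bound)
    then show "1 \<le> k" "k \<le> order G" using fin by (auto simp: k_def)
    have "[i = int k] (mod int (order G))" using r by (auto simp: k_def cong_def)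
    then have "g [^] i = g [^] int k" by (simp only: generator_pow_eq_iff)
    then show "x = g [^] k" by (simp add: i int_pow_int)
  qed
  have uniq: "l = k" if "1 \<le> l" "l \<le> order G" "x = g [^] l" for l
  proof (rule inj_onD[OF ord_inj'[OF g(1)]])
    show "g [^] l = g [^] k" using that(3) k(3) by metis
  qed (use that k in \<open>simp_all add: ord_generator\<close>)
  have "1 \<le> seq_coeff G g x \<and> seq_coeff G g x \<le> order G \<and> x = g [^] seq_coeff G g x"
    unfolding seq_coeff_def
  proof (rule theI[of _ k])
    show "1 \<le> k \<and> k \<le> order G \<and> x = g [^] k" using k by blast
    show "l = k" if "1 \<le> l \<and> l \<le> order G \<and> x = g [^] l" for l using uniq that by blast
  qed
  then show "1 \<le> seq_coeff G g x" "seq_coeff G g x \<le> order G" "x = g [^] seq_coeff G g x" by blast+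
qed

lemma seq_coeff_eqI:
  assumes "1 \<le> k" "k \<le> order G" "x = g [^] k"
  shows "seq_coeff G g x = k"
proof -
  have "x \<in> carrier G" using assms g by simp
  note k = seq_coeff_generator[OF this]
  show ?thesis
  proof (rule inj_onD[OF ord_inj'[OF g(1)]])
    show "g [^] seq_coeff G g x = g [^] k" using k(3) assms(3) by metis
  qed (use k assms in \<open>simp_all add: ord_generator\<close>)
qed

text \<open>The coefficients are positive and their sum is a multiple of the group order, so the
  quotient cannot be below 1.\<close>

lemma seq_norm_ge_1:
  assumes S: "zero_sum G S" "S \<noteq> {#}"
  shows "seq_norm G g S \<ge> 1"
proof -
  have carrier: "set_mset S \<subseteq> carrier G" using S by (simp add: zero_sum_def)
  have "image_mset (\<lambda>x::int. g [^] x) (image_mset (\<lambda>x. int (seq_coeff G g x)) S) = image_mset (\<lambda>x. x) S"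
    unfolding multiset.map_comp o_def
  proof (rule image_mset_cong)
    fix x assume "x \<in># S"
    then have "x \<in> carrier G" using carrier by auto
    then show "g [^] int (seq_coeff G g x) = x" using seq_coeff_generator(3) by (simp add: int_pow_int)
  qed
  then have "zero_sum G (image_mset (\<lambda>x::int. g [^] x) (image_mset (\<lambda>x. int (seq_coeff G g x)) S))"
    using S by simp
  then have "int (order G) dvd int (\<Sum>x\<in>#S. seq_coeff G g x)"
    unfolding zero_sum_pow_iff by (simp add: multiset.map_comp o_def)
  then have "order G dvd (\<Sum>x\<in>#S. seq_coeff G g x)" by (simp only: of_nat_dvd_iff)
  moreover have "(\<Sum>x\<in>#S. seq_coeff G g x) > 0"
  proof -
    obtain a T where T: "S = add_mset a T" using S(2) by (meson multiset_cases)
    then have "seq_coeff G g a \<ge> 1" using seq_coeff_generator(1) carrier by simp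
    then show ?thesis by (simp add: T)
  qed
  ultimately have "order G \<le> (\<Sum>x\<in>#S. seq_coeff G g x)" by (rule dvd_imp_le)
  then have "real (order G) \<le> real (\<Sum>x\<in>#S. seq_coeff G g x)" by (simp only: of_nat_le_iff)
  then show ?thesis unfolding seq_norm_def ord_generator
    using fin by (simp only: le_divide_eq_1_pos of_nat_0_less_iff)
qed

end

end

theorem theorem3p1:
  fixes G :: "('a, 'b) monoid_scheme" (structure)
    and g :: 'a and p q \<beta> \<gamma> n :: nat and x1 x2 x3 x4 :: int and S :: "'a multiset"
  assumes "Factorial_Ring.prime p" and "Factorial_Ring.prime q" and "p \<noteq> q"
    and "\<beta> \<ge> 1" and "\<gamma> \<ge> 1"
    and "n = p ^ \<beta> * q ^ \<gamma>"
    and "gcd n 6 = 1"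
    and "group G" and "order G = n"
    and "g \<in> carrier G" and "generate G {g} = carrier G"
    and "S = {# g [^] x1, g [^] x2, g [^] x3, g [^] x4 #}"
    and "minimal_zero_sum G S"
  shows "seq_index G S = 1"
proof -
  interpret group G by fact
  have n: "order G > 0" using assms by (simp add: prime_gt_0_nat)
  note gen = assms(10,11) n
  have ge_5: "r \<ge> 5" if r: "Factorial_Ring.prime r" "r dvd n" for r
  proof -
    have "\<not> r dvd 6" using r \<open>gcd n 6 = 1\<close> by (metis gcd_greatest not_prime_unit)
    then have "r \<noteq> 2" "r \<noteq> 3" by auto
    moreover have "r \<noteq> 4"
    proof
      assume "r = 4"
      then have "\<forall>m. m dvd (4::nat) \<longrightarrow> m = 1 \<or> m = 4" using r(1) unfolding prime_nat_iff by blast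
      from this[rule_format, of 2] show False by simp
    qed
    ultimately show ?thesis using prime_ge_2_nat[OF r(1)] by linarith
  qed
  have pq5: "p \<ge> 5" "q \<ge> 5" using assms(1-6) by (auto intro!: ge_5)
  define u where "u i = [x1, x2, x3, x4] ! i" for i
  let ?pow = "\<lambda>x::int. g [^] x"
  have S: "S = image_mset ?pow {#x1, x2, x3, x4#}" by (simp add: assms(12))
  have zero: "zero_sum G S" and minimal: "\<And>T. T \<subset># S \<Longrightarrow> T \<noteq> {#} \<Longrightarrow> \<not> zero_sum G T"
    using assms(13) by (auto simp: minimal_zero_sum_def)
  \<comment> \<open>Minimality in terms of exponents, to be applied to single terms and to
    pairs.\<close>
  have sub: "\<not> int n dvd (\<Sum>x\<in>#M. x)" if "M \<subset># {#x1, x2, x3, x4#}" "M \<noteq> {#}" for M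
    using minimal[of "image_mset ?pow M"] that image_mset_subset_mono[OF that(1), of ?pow]
      zero_sum_pow_iff[OF gen, of M] by (simp add: S assms(9))
  have less_4: "i = 0 \<or> i = 1 \<or> i = 2 \<or> i = 3" if "i < 4" for i :: nat
    using that by linarith
  have "\<exists>k. coprime k n \<and> (\<Sum>i<4. int k * u i mod int n) = int n"
  proof (rule exists_multiplier[OF assms(1) pq5(1) assms(2) pq5(2) assms(3-6)])
    fix i :: nat assume "i < 4"
    then have "{#u i#} \<subset># {#x1, x2, x3, x4#}"
      using less_4[of i] by (auto simp: u_def subset_mset_def)
    then show "\<not> int n dvd u i" using sub[of "{#u i#}"] by simp
  next
    show "int n dvd (\<Sum>i<4. u i)"
      using zero zero_sum_pow_iff[OF gen, of "{#x1, x2, x3, x4#}"]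
      by (simp add: S assms(9) sum_less_4 u_def add_ac)
  next
    fix i j :: nat assume "i < 4" "j < 4" "i \<noteq> j"
    then have "{#u i, u j#} \<subset># {#x1, x2, x3, x4#}"
      using less_4[of i] less_4[of j] by (auto simp: u_def subset_mset_def)
    then show "\<not> int n dvd u i + u j" using sub[of "{#u i, u j#}"] by simp
  qed
  then obtain k where k: "coprime k n" "(\<Sum>i<4. int k * u i mod int n) = int n" by blast
  obtain k' where "[k * k' = 1] (mod n)" using cong_solve_coprime_nat[OF k(1)] by auto
  then have "[int (k * k') = int 1] (mod int n)" by (simp only: cong_int_iff)
  then have k': "[int k' * int k = 1] (mod int n)" by (simp add: mult.commute)
  \<comment> \<open>As \<open>k'\<close> is inverse to \<open>k\<close> modulo \<open>n\<close>,
    passing from \<open>g\<close> to this generator multiplies all exponents by \<open>k\<close>, so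
    the coefficients become the residues that add up to \<open>n\<close>.\<close>
  define h where "h = g [^] int k'"
  have hc: "h \<in> carrier G" using gen by (simp add: h_def)
  have h_pow: "h [^] i = g [^] (int k' * i)" for i :: int
    using int_pow_pow[OF gen(1)] by (simp add: h_def)
  have h_pow': "h [^] (int k * x) = g [^] x" for x :: int
  proof -
    have "[int k' * (int k * x) = x] (mod int n)"
      using cong_scalar_right[OF k', of x] by (simp add: mult.assoc)
    then show ?thesis unfolding h_pow generator_pow_eq_iff[OF gen] assms(9) .
  qed
  have "generate G {h} = carrier G"
  proof
    show "generate G {h} \<subseteq> carrier G" using hc by (intro generate_incl) simp
    show "carrier G \<subseteq> generate G {h}"
    proof
      fix y assume "y \<in> carrier G"
      then obtain i :: int where "y = g [^] i" using generate_pow[OF gen(1)] gen(2) by auto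
      then have "y = h [^] (int k * i)" by (simp only: h_pow')
      then show "y \<in> generate G {h}" using generate_pow[OF hc] by auto
    qed
  qed
  note genh = hc this n
  have coeff: "int (seq_coeff G h (g [^] u i)) = int k * u i mod int n" if "i < 4" for i
  proof -
    let ?r = "int k * u i mod int n"
    have "{#u i#} \<subset># {#x1, x2, x3, x4#}"
      using less_4[OF that] by (auto simp: u_def subset_mset_def)
    then have "\<not> int n dvd u i" using sub[of "{#u i#}"] by simp
    then have "\<not> int n dvd int k * u i"
      using k(1) coprime_dvd_mult_right_iff[of "int n" "int k" "u i"] by (simp add: coprime_commute)
    then have "?r \<noteq> 0" by (simp add: dvd_eq_mod_eq_0)
    then have r: "0 < ?r" "?r < int n"
      using n assms(9) pos_mod_bound[of "int n" "int k * u i"] pos_mod_sign[of "int n" "int k * u i"] by linarith+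
    have "h [^] nat ?r = h [^] ?r" using r by (simp flip: int_pow_int)
    also have "\<dots> = h [^] (int k * u i)"
      unfolding generator_pow_eq_iff[OF genh] assms(9) by (simp add: cong_def)
    finally have "g [^] u i = h [^] nat ?r" by (simp only: h_pow')
    then have "seq_coeff G h (g [^] u i) = nat ?r"
      using r assms(9) by (intro seq_coeff_eqI[OF genh]) auto
    then show ?thesis using r by simp
  qed
  have "int (\<Sum>x\<in>#S. seq_coeff G h x) = (\<Sum>i<4. int (seq_coeff G h (g [^] u i)))"
    by (simp add: S sum_less_4 u_def)
  also have "\<dots> = int n" using coeff k(2) by simp
  finally have "(\<Sum>x\<in>#S. seq_coeff G h x) = n" by (simp only: of_nat_eq_iff)
  then have norm_h: "seq_norm G h S = 1"
    using n assms(9) by (simp add: seq_norm_def ord_generator[OF genh])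
  show ?thesis unfolding seq_index_def
  proof (rule Min_eqI)
    have "finite (carrier G)" using n by (simp add: order_gt_0_iff_finite)
    then show "finite ((\<lambda>h. seq_norm G h S) ` group_generators G)"
      by (simp add: group_generators_def)
    show "1 \<in> (\<lambda>h. seq_norm G h S) ` group_generators G"
      using norm_h genh by (intro image_eqI[of _ _ h]) (auto simp: group_generators_def)
    fix y assume "y \<in> (\<lambda>h. seq_norm G h S) ` group_generators G"
    then obtain a where "a \<in> carrier G" "generate G {a} = carrier G" "y = seq_norm G a S"
      by (auto simp: group_generators_def)
    then show "1 \<le> y" using seq_norm_ge_1[OF _ _ n zero] by (simp add: S)
  qed
qed

end
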